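(* Let $V$ be an irreducible integrable $\tau(B)$-module with finite dimensional weight spaces with respect to $H$, such that $K_0$ acts by a positive integer and $K_i$ acts trivially for $1\le i\le n$. Assume that $\ker\varphi$ acts trivially on $V$ (so that $V$ is an irreducible $\widetilde G$-module) and that there are positive integers $l_1,\dots,l_n$ and non-zero central operators $z_i$ on $V$ of degree $(0,\dots,0,l_i,0,\dots,0)$ ($l_i$ in the position of $t_i$), $1\le i\le n$. Let $W$ be a maximal proper $G$-submodule of $V$ such that $\overline V=V/W$ has finite dimensional weight spaces with respect to $\dot{\mathfrak h}\oplus\mathbb CK_0\oplus\mathbb Cd_0$; let $v\in V_\lambda$ be a non-zero weight vector with $\tau(B)^+v=0$, let $\overline v$ be its image in $\overline V$ (a highest weight vector of $\overline V$), and let $\overline V\otimes A_n$ carry the $\widetilde G$-module structure $\rho(\underline\alpha)$ with $\underline\alpha=(\lambda(d_1),\dots,\lambda(d_n))$. Then: 1. As $\widetilde G$-modules, $\overline V\otimes A_n=\sum_{\underline s\in\mathbb Z^n}U(\widetilde G)(\overline v\otimes t^{\underline s})=\bigoplus_{\underline s\in F}U(\widetilde G)(\overline v\otimes t^{\underline s})$ for some $F\subseteq\{(s_1,\dots,s_n)\in\mathbb Z^n:0\le s_i<l_i\}$. 2. $V\simeq U(\widetilde G)(\overline v\otimes1)$ as $\widetilde G$-modules.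
   Context: Everything is over $\mathbb C$. $\dot{\mathfrak g}$ is a finite dimensional simple Lie algebra with Cartan subalgebra $\dot{\mathfrak h}$, root system $\dot\Delta$, triangular decomposition $\dot{\mathfrak g}=\dot{\mathfrak g}^-\oplus\dot{\mathfrak h}\oplus\dot{\mathfrak g}^+$, and normalized invariant non-degenerate symmetric bilinear form $(\cdot,\cdot)$. $n\ge 1$ is an integer and $B$ is a commutative associative finitely generated unital $\mathbb C$-algebra. $A=\mathbb C[t_0^{\pm1},\dots,t_n^{\pm1}]$, $A_n=\mathbb C[t_1^{\pm1},\dots,t_n^{\pm1}]$, $t^{\underline m}=t_1^{m_1}\cdots t_n^{m_n}$ for $\underline m\in\mathbb Z^n$. $\Omega_A$ is the vector space with basis $t_0^{k_0}t^{\underline k}K_i$ ($0\le i\le n$, $k_0\in\mathbb Z$, $\underline k\in\mathbb Z^n$), $dA$ is the span of the elements $\sum_{i=0}^n k_i t_0^{k_0}t^{\underline k}K_i$, and $Z=\Omega_A/dA$. $\tau_0=\dot{\mathfrak g}\otimes A\oplus Z$ with $Z$ central and $[x\otimes t_0^{k_0}t^{\underline k},y\otimes t_0^{r_0}t^{\underline r}]=[x,y]\otimes t_0^{k_0+r_0}t^{\underline k+\underline r}+(x,y)\sum_{i=0}^n k_i t_0^{k_0+r_0}t^{\underline k+\underline r}K_i$. $\tau(B)=\tau_0\otimes B\oplus D$, $D=\mathrm{span}\{d_0,\dots,d_n\}$, with $[x\otimes b,y\otimes b']=[x,y]\otimes bb'$, $[d_i,x\otimes t_0^{k_0}t^{\underline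 k}\otimes b]=k_i\,x\otimes t_0^{k_0}t^{\underline k}\otimes b$, $[d_i,t_0^{k_0}t^{\underline k}K_j\otimes b]=k_i\,t_0^{k_0}t^{\underline k}K_j\otimes b$, $[d_i,d_j]=0$. $K_i$ and $\dot{\mathfrak h}$ are identified with $K_i\otimes 1$ and $\dot{\mathfrak h}\otimes1\otimes1$; $H=\dot{\mathfrak h}\oplus\bigoplus_i\mathbb CK_i\oplus\bigoplus_i\mathbb Cd_i$. $\tau(B)^+=\dot{\mathfrak g}^+\otimes A_n\otimes B+\dot{\mathfrak g}\otimes t_0A_n[t_0]\otimes B+\sum_{i=0}^nt_0A_n[t_0]K_i\otimes B$. A $\tau(B)$-module $V$ is integrable if $V=\bigoplus_{\lambda\in H^*}V_\lambda$ with $V_\lambda=\{v:hv=\lambda(h)v\ \forall h\in H\}$ (weight spaces), and all $X_\alpha\otimes t_0^{m_0}t^{\underline m}\otimes b$ ($X_\alpha$ a root vector of root $\alpha\in\dot\Delta$, $(m_0,\underline m)\in\mathbb Z^{n+1}$, $b\in B$) act locally nilpotently. A central operator of degree $(m_0,\underline m)$ on $V$ is a linear map $z:V\to V$ commuting with $\dot{\mathfrak g}\otimes A\otimes B\oplus Z\otimes B$ and satisfying $d_iz-zd_i=m_iz$ for $0\le i\le n$. $\mathfrak g_{af}'=\dot{\mathfrak g}\otimes\mathbb C[t_0^{\pm1}]\oplus\mathbb CK_0$ is the derived algebra of the affine Lie algebra $\mathfrak g_{af}=\mathfrak g_{af}'\oplus\mathbb Cd_0$. $G=\mathfrak g_{af}'\otimes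 A_n\otimes B\oplus\mathbb Cd_0$ with $[X\otimes a,Y\otimes a']=[X,Y]\otimes aa'$, $[d_0,X\otimes a]=[d_0,X]\otimes a$. $\widetilde G=G\oplus\mathrm{span}\{d_1,\dots,d_n\}$ with $[d_i,X\otimes t^{\underline r}\otimes b]=r_iX\otimes t^{\underline r}\otimes b$, the $d_i$ commuting; $G_{\underline r}=\{X\in G:[d_i,X]=r_iX,\ 1\le i\le n\}$. $\varphi:\tau(B)\to\widetilde G$ is the surjective homomorphism $X\otimes t_0^{r_0}t^{\underline r}\otimes b\mapsto(X\otimes t_0^{r_0})\otimes t^{\underline r}\otimes b$; $t_0^{r_0}t^{\underline r}K_i\otimes b\mapsto0$ for $1\le i\le n$; $t_0^{r_0}t^{\underline r}K_0\otimes b\mapsto0$ if $r_0\ne0$ and $\mapsto K_0\otimes t^{\underline r}\otimes b$ if $r_0=0$; $d_i\mapsto d_i$. The $\widetilde G$-module $(\overline V\otimes A_n,\rho(\underline\alpha))$: $X_{\underline r}(u\otimes t^{\underline s})=(X_{\underline r}u)\otimes t^{\underline r+\underline s}$ for $X_{\underline r}\in G_{\underline r}$ (in particular $d_0(u\otimes t^{\underline s})=(d_0u)\otimes t^{\underline s}$), and $d_i(u\otimes t^{\underline s})=(\alpha_i+s_i)(u\otimes t^{\underline s})$ for $1\le i\le n$. *)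

theory Defs
  imports "HOL-Analysis.Finite_Cartesian_Product" "HOL-Library.Poly_Mapping" "HOL-Library.Product_Plus"
begin

section \<open>Complex vector spaces\<close>

class cvs = ab_group_add +
  fixes scaleC :: "complex \<Rightarrow> 'a \<Rightarrow> 'a" (infixr \<open>*\<^sub>C\<close> 75)
  assumes scaleC_add_right: "a *\<^sub>C (x + y) = a *\<^sub>C x + a *\<^sub>C y"
    and scaleC_add_left: "(a + b) *\<^sub>C x = a *\<^sub>C x + b *\<^sub>C x"
    and scaleC_scaleC: "a *\<^sub>C (b *\<^sub>C x) = (a * b) *\<^sub>C x"
    and scaleC_one: "1 *\<^sub>C x = x"

global_interpretation cv: vector_space "scaleC :: complex \<Rightarrow> 'a \<Rightarrow> 'a::cvs"
  by unfold_locales (simp_all add: scaleC_add_right scaleC_add_left scaleC_scaleC scaleC_one)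

abbreviation clinear :: "('a::cvs \<Rightarrow> 'b::cvs) \<Rightarrow> bool"
  where "clinear \<equiv> Vector_Spaces.linear scaleC scaleC"

lemma clinear_iff:
  "clinear f \<longleftrightarrow> (\<forall>x y. f (x + y) = f x + f y) \<and> (\<forall>c x. f (c *\<^sub>C x) = c *\<^sub>C f x)"
  by (simp add: Vector_Spaces.linear_iff cv.vector_space_axioms)

lemma clinearI:
  assumes "\<And>x y. f (x + y) = f x + f y" "\<And>c x. f (c *\<^sub>C x) = c *\<^sub>C f x"
  shows "clinear f"
  using assms by (simp add: clinear_iff)

lemma clinear_add: "clinear f \<Longrightarrow> f (x + y) = f x + f y"
  and clinear_scale: "clinear f \<Longrightarrow> f (c *\<^sub>C x) = c *\<^sub>C f x"
  by (auto simp: clinear_iff)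

lemma clinear_0: "clinear f \<Longrightarrow> f 0 = 0"
  using clinear_scale[of f 0 0] by simp

lemma clinear_diff: "clinear f \<Longrightarrow> f (x - y) = f x - f y"
  by (metis add_diff_cancel clinear_add diff_add_cancel)

lemma clinear_compose: "clinear f \<Longrightarrow> clinear g \<Longrightarrow> clinear (\<lambda>x. g (f x))"
  by (simp add: clinear_iff)

lemma clinear_plus: "clinear f \<Longrightarrow> clinear g \<Longrightarrow> clinear (\<lambda>x. f x + g x)"
  by (simp add: clinear_iff scaleC_add_right algebra_simps)

lemma clinear_minus: "clinear f \<Longrightarrow> clinear g \<Longrightarrow> clinear (\<lambda>x. f x - g x)"
  by (simp add: clinear_iff cv.scale_right_diff_distrib algebra_simps)

lemma clinear_scaled: "clinear f \<Longrightarrow> clinear (\<lambda>x. c *\<^sub>C f x)"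
  by (simp add: clinear_iff scaleC_add_right cv.scale_left_commute)

lemma clinear_sum: "clinear f \<Longrightarrow> f (sum g S) = (\<Sum>i\<in>S. f (g i))"
  by (induction S rule: infinite_finite_induct) (auto simp: clinear_0 clinear_add)

definition cbilinear :: "('a::cvs \<Rightarrow> 'b::cvs \<Rightarrow> 'c::cvs) \<Rightarrow> bool"
  where "cbilinear f \<longleftrightarrow> (\<forall>y. clinear (\<lambda>x. f x y)) \<and> (\<forall>x. clinear (f x))"

definition fin_dim :: "'a::cvs set \<Rightarrow> bool"
  where "fin_dim S \<longleftrightarrow> (\<exists>T. finite T \<and> S \<subseteq> cv.span T)"

definition direct_sum :: "'i set \<Rightarrow> ('i \<Rightarrow> 'a::cvs set) \<Rightarrow> 'a set \<Rightarrow> bool"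
  where "direct_sum I M U \<longleftrightarrow>
    (\<forall>i\<in>I. cv.subspace (M i)) \<and> U = cv.span (\<Union>i\<in>I. M i) \<and>
    (\<forall>J f. finite J \<longrightarrow> J \<subseteq> I \<longrightarrow> (\<forall>i\<in>J. f i \<in> M i) \<longrightarrow> (\<Sum>i\<in>J. f i) = 0 \<longrightarrow> (\<forall>i\<in>J. f i = 0))"

text \<open>Functionals on a subspace \<^term>\<open>S\<close> are represented by functions vanishing off \<^term>\<open>S\<close>,
  so that each element of the dual space has exactly one representative.\<close>

definition dual_space :: "'a::cvs set \<Rightarrow> ('a \<Rightarrow> complex) set"
  where "dual_space S = {l. (\<forall>x. x \<notin> S \<longrightarrow> l x = 0) \<and>
    (\<forall>x\<in>S. \<forall>y\<in>S. l (x + y) = l x + l y) \<and> (\<forall>c. \<forall>x\<in>S. l (c *\<^sub>C x) = c * l x)}"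

instantiation complex :: cvs
begin
definition scaleC_complex :: "complex \<Rightarrow> complex \<Rightarrow> complex" where "scaleC_complex = (*)"
instance by standard (simp_all add: scaleC_complex_def algebra_simps)
end

instantiation prod :: (cvs, cvs) cvs
begin
definition scaleC_prod :: "complex \<Rightarrow> 'a \<times> 'b \<Rightarrow> 'a \<times> 'b"
  where "scaleC_prod c p = (c *\<^sub>C fst p, c *\<^sub>C snd p)"
instance by standard (simp_all add: scaleC_prod_def scaleC_add_right scaleC_add_left scaleC_one)
end

instantiation vec :: (cvs, finite) cvs
begin
definition scaleC_vec :: "complex \<Rightarrow> 'a ^ 'b \<Rightarrow> 'a ^ 'b"
  where "scaleC_vec c x = (\<chi> i. c *\<^sub>C (x $ i))"
instance by standard (simp_all add: scaleC_vec_def vec_eq_iff scaleC_add_right scaleC_add_left scaleC_one)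
end

instantiation poly_mapping :: (type, cvs) cvs
begin
lift_definition scaleC_poly_mapping :: "complex \<Rightarrow> ('a \<Rightarrow>\<^sub>0 'b) \<Rightarrow> ('a \<Rightarrow>\<^sub>0 'b)"
  is "\<lambda>c f k. c *\<^sub>C f k"
proof -
  fix c and f :: "'a \<Rightarrow> 'b"
  assume "finite {k. f k \<noteq> 0}"
  then show "finite {k. c *\<^sub>C f k \<noteq> 0}"
    by (rule rev_finite_subset) auto
qed
instance by standard (transfer; simp add: scaleC_add_right scaleC_add_left scaleC_one fun_eq_iff)+
end

section \<open>Linear extension from a basis\<close>

definition lin_ext :: "('k \<Rightarrow> 'v::cvs) \<Rightarrow> ('k \<Rightarrow>\<^sub>0 complex) \<Rightarrow> 'v"
  where "lin_ext h f = (\<Sum>k\<in>Poly_Mapping.keys f. Poly_Mapping.lookup f k *\<^sub>C h k)"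

lemma lookup_scaleC: "Poly_Mapping.lookup (c *\<^sub>C f) k = c *\<^sub>C Poly_Mapping.lookup f k"
  by transfer simp

lemma lin_ext_superset:
  assumes "finite S" "Poly_Mapping.keys f \<subseteq> S"
  shows "lin_ext h f = (\<Sum>k\<in>S. Poly_Mapping.lookup f k *\<^sub>C h k)"
  unfolding lin_ext_def by (rule sum.mono_neutral_left) (use assms in \<open>auto simp: in_keys_iff\<close>)

lemma lin_ext_add: "lin_ext h (f + g) = lin_ext h f + lin_ext h g"
proof -
  let ?S = "Poly_Mapping.keys f \<union> Poly_Mapping.keys g"
  have "Poly_Mapping.keys (f + g) \<subseteq> ?S" by (rule Poly_Mapping.keys_add)
  then show ?thesis
    by (simp add: lin_ext_superset[of ?S] lookup_add scaleC_add_left sum.distrib)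
qed

lemma lin_ext_scaleC: "lin_ext h (c *\<^sub>C f) = c *\<^sub>C lin_ext h f"
proof -
  let ?S = "Poly_Mapping.keys f"
  have "Poly_Mapping.keys (c *\<^sub>C f) \<subseteq> ?S"
    by (auto simp: in_keys_iff lookup_scaleC)
  then show ?thesis
    by (simp add: lin_ext_superset[of ?S] lookup_scaleC cv.scale_sum_right scaleC_complex_def)
qed

lemma lin_ext_linear: "clinear (lin_ext h)"
  by (simp add: clinear_iff lin_ext_add lin_ext_scaleC)

lemma lin_ext_single [simp]: "lin_ext h (Poly_Mapping.single k c) = c *\<^sub>C h k"
  by (cases "c = 0") (simp_all add: lin_ext_def)

lemma poly_mapping_eq_lin_ext:
  fixes f :: "'k \<Rightarrow>\<^sub>0 complex"
  shows "f = lin_ext (\<lambda>k. Poly_Mapping.single k 1) f"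
proof (rule poly_mapping_eqI)
  fix j :: 'k
  have "Poly_Mapping.lookup (lin_ext (\<lambda>k. Poly_Mapping.single k 1) f) j
      = (\<Sum>k\<in>Poly_Mapping.keys f. Poly_Mapping.lookup (Poly_Mapping.lookup f k *\<^sub>C Poly_Mapping.single k 1) j)"
    by (simp add: lin_ext_def lookup_sum)
  also have "\<dots> = (\<Sum>k\<in>Poly_Mapping.keys f. if k = j then Poly_Mapping.lookup f k else 0)"
    by (rule sum.cong) (auto simp: lookup_scaleC lookup_single when_def scaleC_complex_def)
  also have "\<dots> = Poly_Mapping.lookup f j"
    by (simp add: in_keys_iff)
  finally show "Poly_Mapping.lookup f j = Poly_Mapping.lookup (lin_ext (\<lambda>k. Poly_Mapping.single k 1) f) j"
    by simp
qed

lemma lin_ext_unique: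
  assumes "clinear F" "clinear G"
    "\<And>k. F (Poly_Mapping.single k 1) = G (Poly_Mapping.single k (1::complex))"
  shows "F f = G f"
proof -
  have "F f = F (lin_ext (\<lambda>k. Poly_Mapping.single k 1) f)"
    using poly_mapping_eq_lin_ext[of f] by simp
  also have "\<dots> = G (lin_ext (\<lambda>k. Poly_Mapping.single k 1) f)"
    unfolding lin_ext_def using assms by (simp add: clinear_sum clinear_scale)
  finally show ?thesis
    using poly_mapping_eq_lin_ext[of f] by simp
qed

section \<open>Tensor products over the complex numbers\<close>

definition pair1 :: "'a \<Rightarrow> 'b \<Rightarrow> ('a \<times> 'b) \<Rightarrow>\<^sub>0 complex"
  where "pair1 x y = Poly_Mapping.single (x, y) 1"

definition tensor_rel :: "(('a::cvs \<times> 'b::cvs) \<Rightarrow>\<^sub>0 complex) set"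
  where "tensor_rel = cv.span (
     {pair1 (x + x') y - pair1 x y - pair1 x' y | x x' y. True} \<union>
     {pair1 x (y + y') - pair1 x y - pair1 x y' | x y y'. True} \<union>
     {pair1 (c *\<^sub>C x) y - c *\<^sub>C pair1 x y | c x y. True} \<union>
     {pair1 x (c *\<^sub>C y) - c *\<^sub>C pair1 x y | c x y. True})"

lemma subspace_tensor_rel: "cv.subspace tensor_rel"
  by (simp add: tensor_rel_def)

lemma subspace_equivp:
  assumes "cv.subspace S"
  shows "equivp (\<lambda>f g. f - g \<in> S)"
proof (rule equivpI)
  show "reflp (\<lambda>f g. f - g \<in> S)" by (simp add: reflp_def cv.subspace_0[OF assms])
  show "symp (\<lambda>f g. f - g \<in> S)"
    by (metis (mono_tags, lifting) assms cv.subspace_neg minus_diff_eq sympI)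
  show "transp (\<lambda>f g. f - g \<in> S)"
  proof (rule transpI)
    fix x y z assume "x - y \<in> S" "y - z \<in> S"
    from cv.subspace_add[OF assms this] show "x - z \<in> S" by simp
  qed
qed

lemma subspace_cong:
  assumes "cv.subspace S"
  shows "a - b \<in> S \<Longrightarrow> c - d \<in> S \<Longrightarrow> (a + c) - (b + d) \<in> S"
    and "a - b \<in> S \<Longrightarrow> c - d \<in> S \<Longrightarrow> (a - c) - (b - d) \<in> S"
    and "a - b \<in> S \<Longrightarrow> (- a) - (- b) \<in> S"
    and "a - b \<in> S \<Longrightarrow> (k *\<^sub>C a) - (k *\<^sub>C b) \<in> S"
  using cv.subspace_add[OF assms, of "a - b" "c - d"] cv.subspace_diff[OF assms, of "a - b" "c - d"]
    cv.subspace_neg[OF assms, of "a - b"] cv.subspace_scale[OF assms, of "a - b" k]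
  by (simp_all add: algebra_simps cv.scale_right_diff_distrib)

quotient_type (overloaded) ('a, 'b) tensor =
  "('a::cvs \<times> 'b::cvs) \<Rightarrow>\<^sub>0 complex" / "\<lambda>f g. f - g \<in> tensor_rel"
  by (rule subspace_equivp[OF subspace_tensor_rel])

instantiation tensor :: (cvs, cvs) cvs
begin
lift_definition zero_tensor :: "('a, 'b) tensor" is 0 .
lift_definition plus_tensor :: "('a, 'b) tensor \<Rightarrow> ('a, 'b) tensor \<Rightarrow> ('a, 'b) tensor" is "(+)"
  by (rule subspace_cong[OF subspace_tensor_rel])
lift_definition minus_tensor :: "('a, 'b) tensor \<Rightarrow> ('a, 'b) tensor \<Rightarrow> ('a, 'b) tensor" is "(-)"
  by (rule subspace_cong[OF subspace_tensor_rel])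
lift_definition uminus_tensor :: "('a, 'b) tensor \<Rightarrow> ('a, 'b) tensor" is uminus
  by (rule subspace_cong[OF subspace_tensor_rel])
lift_definition scaleC_tensor :: "complex \<Rightarrow> ('a, 'b) tensor \<Rightarrow> ('a, 'b) tensor" is scaleC
  by (rule subspace_cong[OF subspace_tensor_rel])
instance
  by standard
    (transfer; simp add: cv.subspace_0[OF subspace_tensor_rel] scaleC_add_right scaleC_add_left
      scaleC_scaleC scaleC_one ac_simps)+
end

lift_definition tens :: "'a::cvs \<Rightarrow> 'b::cvs \<Rightarrow> ('a, 'b) tensor" (infixl \<open>\<otimes>\<close> 76) is pair1 .

text \<open>For bilinear \<^term>\<open>f\<close>, \<^term>\<open>tensor_lift f\<close> is the induced linear map.  It is
  computed on an arbitrary representative; \<^term>\<open>tensor_lift_tens\<close> below shows independence.\<close>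

definition tensor_lift :: "('a::cvs \<Rightarrow> 'b::cvs \<Rightarrow> 'c::cvs) \<Rightarrow> ('a, 'b) tensor \<Rightarrow> 'c"
  where "tensor_lift f t = lin_ext (\<lambda>(x, y). f x y) (rep_tensor t)"

lemma abs_tensor_eq_iff: "abs_tensor p = abs_tensor q \<longleftrightarrow> p - q \<in> tensor_rel"
  by (simp add: tensor.abs_eq_iff)

lemma abs_rep_tensor: "abs_tensor (rep_tensor t) = t"
  by (rule Quotient3_abs_rep[OF Quotient3_tensor])

lemma clinear_abs_tensor: "clinear abs_tensor"
  by (simp add: clinear_iff plus_tensor.abs_eq scaleC_tensor.abs_eq)

lemma tens_linear_left: "clinear (\<lambda>x::'a::cvs. x \<otimes> (y::'b::cvs))"
proof (rule clinearI)
  fix x x' :: 'a and c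
  have "pair1 (x + x') y - (pair1 x y + pair1 x' y) \<in> tensor_rel"
    "pair1 (c *\<^sub>C x) y - c *\<^sub>C pair1 x y \<in> tensor_rel"
    unfolding tensor_rel_def diff_diff_add[symmetric] by (rule cv.span_base; blast)+
  then show "(x + x') \<otimes> y = x \<otimes> y + x' \<otimes> y" "(c *\<^sub>C x) \<otimes> y = c *\<^sub>C x \<otimes> y"
    by (simp_all add: tens.abs_eq plus_tensor.abs_eq scaleC_tensor.abs_eq tensor.abs_eq_iff)
qed

lemma tens_linear_right: "clinear (\<lambda>y::'b::cvs. (x::'a::cvs) \<otimes> y)"
proof (rule clinearI)
  fix y y' :: 'b and c
  have "pair1 x (y + y') - (pair1 x y + pair1 x y') \<in> tensor_rel"
    "pair1 x (c *\<^sub>C y) - c *\<^sub>C pair1 x y \<in> tensor_rel"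
    unfolding tensor_rel_def diff_diff_add[symmetric] by (rule cv.span_base; blast)+
  then show "x \<otimes> (y + y') = x \<otimes> y + x \<otimes> y'" "x \<otimes> (c *\<^sub>C y) = c *\<^sub>C x \<otimes> y"
    by (simp_all add: tens.abs_eq plus_tensor.abs_eq scaleC_tensor.abs_eq tensor.abs_eq_iff)
qed

lemma cbilinear_tens: "cbilinear (\<otimes>)"
  by (simp add: cbilinear_def tens_linear_left tens_linear_right)

lemma lin_ext_kills_tensor_rel:
  assumes f: "cbilinear f" and r: "r \<in> tensor_rel"
  shows "lin_ext (\<lambda>(x, y). f x y) r = 0"
proof -
  let ?L = "lin_ext (\<lambda>(x, y). f x y)"
  have f': "f (x + x') y = f x y + f x' y" "f x (y + y') = f x y + f x y'"
    "f (c *\<^sub>C x) y = c *\<^sub>C f x y" "f x (c *\<^sub>C y) = c *\<^sub>C f x y" for x x' y y' c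
    using f by (auto simp: cbilinear_def clinear_iff)
  have L: "?L (p - q) = ?L p - ?L q" for p q
    by (rule clinear_diff[OF lin_ext_linear])
  have "cv.subspace {p. ?L p = 0}"
    by (rule cv.subspaceI) (simp_all add: lin_ext_add lin_ext_scaleC clinear_0[OF lin_ext_linear])
  then have "tensor_rel \<subseteq> {p. ?L p = 0}"
    unfolding tensor_rel_def
    by (rule cv.span_minimal[rotated])
      (auto simp: L lin_ext_scaleC pair1_def f' scaleC_one)
  with r show ?thesis by auto
qed

lemma tensor_lift_abs:
  assumes "cbilinear f"
  shows "tensor_lift f (abs_tensor p) = lin_ext (\<lambda>(x, y). f x y) p"
proof -
  have "rep_tensor (abs_tensor p) - p \<in> tensor_rel"
    by (simp add: abs_tensor_eq_iff[symmetric] abs_rep_tensor)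
  from lin_ext_kills_tensor_rel[OF assms this] show ?thesis
    by (simp add: tensor_lift_def clinear_diff[OF lin_ext_linear])
qed

lemma tensor_lift_tens: "cbilinear f \<Longrightarrow> tensor_lift f (x \<otimes> y) = f x y"
  by (simp add: tens.abs_eq tensor_lift_abs pair1_def scaleC_one)

lemma tensor_lift_linear:
  assumes "cbilinear f"
  shows "clinear (tensor_lift f)"
proof (rule clinearI)
  fix s t c
  have "tensor_lift f (abs_tensor (rep_tensor s) + abs_tensor (rep_tensor t))
      = tensor_lift f (abs_tensor (rep_tensor s)) + tensor_lift f (abs_tensor (rep_tensor t))"
    by (simp add: plus_tensor.abs_eq tensor_lift_abs[OF assms] lin_ext_add)
  then show "tensor_lift f (s + t) = tensor_lift f s + tensor_lift f t"
    by (simp only: abs_rep_tensor)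
  have "tensor_lift f (c *\<^sub>C abs_tensor (rep_tensor s)) = c *\<^sub>C tensor_lift f (abs_tensor (rep_tensor s))"
    by (simp add: scaleC_tensor.abs_eq tensor_lift_abs[OF assms] lin_ext_scaleC)
  then show "tensor_lift f (c *\<^sub>C s) = c *\<^sub>C tensor_lift f s"
    by (simp only: abs_rep_tensor)
qed

lemma tensor_unique:
  assumes "clinear F" "clinear G" "\<And>x y. F (x \<otimes> y) = G (x \<otimes> y)"
  shows "F t = G t"
proof -
  have "clinear (\<lambda>p. F (abs_tensor p))" "clinear (\<lambda>p. G (abs_tensor p))"
    by (rule clinear_compose[OF clinear_abs_tensor], fact)+
  moreover have "F (abs_tensor (Poly_Mapping.single k 1)) = G (abs_tensor (Poly_Mapping.single k 1))" for k
    using assms(3)[of "fst k" "snd k"] by (simp add: tens.abs_eq pair1_def)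
  ultimately have "F (abs_tensor (rep_tensor t)) = G (abs_tensor (rep_tensor t))"
    by (rule lin_ext_unique)
  then show ?thesis by (simp only: abs_rep_tensor)
qed

lemma lin_ext_linear_in:
  assumes "\<And>k. clinear (\<lambda>x. h x k)"
  shows "clinear (\<lambda>x. lin_ext (h x) p)"
proof (rule clinearI)
  have "h (x + y) k = h x k + h y k" "h (c *\<^sub>C x) k = c *\<^sub>C h x k" for x y c k
    using clinear_add[OF assms] clinear_scale[OF assms] by auto
  then show "lin_ext (h (x + y)) p = lin_ext (h x) p + lin_ext (h y) p"
    "lin_ext (h (c *\<^sub>C x)) p = c *\<^sub>C lin_ext (h x) p" for x y c
    by (simp_all add: lin_ext_def scaleC_add_right sum.distrib cv.scale_sum_right mult.commute)
qed

lemma tensor_lift_linear_in: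
  assumes "\<And>x y. clinear (\<lambda>a. f a x y)"
  shows "clinear (\<lambda>a. tensor_lift (f a) t)"
  unfolding tensor_lift_def by (rule lin_ext_linear_in) (auto simp: assms)

text \<open>Bilinear maps on a pair of tensor products, given on pure tensors.\<close>

definition tensor_lift2 ::
  "('a::cvs \<Rightarrow> 'b::cvs \<Rightarrow> 'c::cvs \<Rightarrow> 'd::cvs \<Rightarrow> 'e::cvs) \<Rightarrow> ('a, 'b) tensor \<Rightarrow> ('c, 'd) tensor \<Rightarrow> 'e"
  where "tensor_lift2 f s t = tensor_lift (\<lambda>x y. tensor_lift (\<lambda>x' y'. f x y x' y') t) s"

definition cquadrilinear :: "('a::cvs \<Rightarrow> 'b::cvs \<Rightarrow> 'c::cvs \<Rightarrow> 'd::cvs \<Rightarrow> 'e::cvs) \<Rightarrow> bool"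
  where "cquadrilinear f \<longleftrightarrow>
    (\<forall>y x' y'. clinear (\<lambda>x. f x y x' y')) \<and> (\<forall>x x' y'. clinear (\<lambda>y. f x y x' y')) \<and>
    (\<forall>x y y'. clinear (\<lambda>x'. f x y x' y')) \<and> (\<forall>x y x'. clinear (\<lambda>y'. f x y x' y'))"

lemma tensor_lift2_tens:
  assumes "cquadrilinear f"
  shows "tensor_lift2 f (x \<otimes> y) (x' \<otimes> y') = f x y x' y'"
proof -
  have "cbilinear (\<lambda>x y. tensor_lift (\<lambda>x' y'. f x y x' y') t)" for t
    using assms unfolding cbilinear_def cquadrilinear_def
    by (auto intro: tensor_lift_linear_in)
  moreover have "cbilinear (\<lambda>x' y'. f x y x' y')" for x y
    using assms unfolding cbilinear_def cquadrilinear_def by auto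
  ultimately show ?thesis
    by (simp add: tensor_lift2_def tensor_lift_tens[of "\<lambda>x y. tensor_lift (f x y) _"] tensor_lift_tens[of "f x y"])
qed

lemma tensor_lift2_linear:
  assumes "cquadrilinear f"
  shows "clinear (\<lambda>s. tensor_lift2 f s t)" "clinear (tensor_lift2 f s)"
proof -
  have "cbilinear (\<lambda>x y. tensor_lift (\<lambda>x' y'. f x y x' y') t)" for t
    using assms unfolding cbilinear_def cquadrilinear_def
    by (auto intro: tensor_lift_linear_in)
  then show "clinear (\<lambda>s. tensor_lift2 f s t)"
    unfolding tensor_lift2_def by (rule tensor_lift_linear)
  have "cbilinear (\<lambda>x' y'. f x y x' y')" for x y
    using assms unfolding cbilinear_def cquadrilinear_def by auto
  then have *: "clinear (\<lambda>t. tensor_lift (\<lambda>x' y'. f x y x' y') t)" for x y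
    by (rule tensor_lift_linear)
  show "clinear (tensor_lift2 f s)"
    unfolding tensor_lift2_def by (rule tensor_lift_linear_in) (rule *)
qed

section \<open>Commutative algebras\<close>

text \<open>The class \<^class>\<open>comm_ring_1\<close> excludes the zero algebra.\<close>

class comm_calg = comm_ring_1 + cvs +
  assumes scaleC_mult: "(c *\<^sub>C x) * y = c *\<^sub>C (x * y)"

definition finitely_generated_alg :: "'b::comm_calg itself \<Rightarrow> bool"
  where "finitely_generated_alg _ \<longleftrightarrow> (\<exists>S::'b set. finite S \<and>
    (\<forall>T. S \<subseteq> T \<longrightarrow> cv.subspace T \<longrightarrow> 1 \<in> T \<longrightarrow> (\<forall>x\<in>T. \<forall>y\<in>T. x * y \<in> T) \<longrightarrow> T = UNIV))"

lemma comm_calg_linear: "clinear (\<lambda>x::'b::comm_calg. x * y)" "clinear (\<lambda>y::'b::comm_calg. x * y)"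
proof -
  show *: "clinear (\<lambda>x. x * y)" for y :: 'b
    by (simp add: clinear_iff scaleC_mult distrib_right)
  show "clinear (\<lambda>y. x * y)"
    using *[of x] by (simp only: mult.commute[of x])
qed

instance complex :: comm_calg
  by standard (simp add: scaleC_complex_def)

lemma scaleC_poly_mapping_conv: "c *\<^sub>C f = Poly_Mapping.single 0 c * (f :: 'k::comm_monoid_add \<Rightarrow>\<^sub>0 complex)"
  unfolding mult_map_scale_conv_mult[symmetric]
  by (transfer, auto simp: fun_eq_iff scaleC_complex_def when_def)

text \<open>The ring \<open>'k \<Rightarrow>\<^sub>0 complex\<close> is the group algebra of \<open>'k\<close>; for \<open>'k = \<int>\<^sup>r\<close> this is the ring of
  Laurent polynomials in \<open>r\<close> variables, with \<open>Poly_Mapping.single m 1\<close> the monomial of exponent \<open>m\<close>.\<close>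

abbreviation lmon :: "'k \<Rightarrow> 'k \<Rightarrow>\<^sub>0 complex"
  where "lmon m \<equiv> Poly_Mapping.single m 1"

lemma laurent_mult_linear:
  fixes f g :: "'k::comm_monoid_add \<Rightarrow>\<^sub>0 complex"
  shows "clinear (\<lambda>f. f * g)" "clinear (\<lambda>g. f * g)"
  by (auto simp: clinear_iff algebra_simps scaleC_poly_mapping_conv)


section \<open>Lie algebras and their modules\<close>

definition lie_algebra :: "('g::cvs \<Rightarrow> 'g \<Rightarrow> 'g) \<Rightarrow> bool"
  where "lie_algebra br \<longleftrightarrow> cbilinear br \<and> (\<forall>x. br x x = 0) \<and>
    (\<forall>x y z. br x (br y z) + br y (br z x) + br z (br x y) = 0)"

definition lie_ideal :: "('g::cvs \<Rightarrow> 'g \<Rightarrow> 'g) \<Rightarrow> 'g set \<Rightarrow> bool"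
  where "lie_ideal br I \<longleftrightarrow> cv.subspace I \<and> (\<forall>x. \<forall>y\<in>I. br x y \<in> I)"

definition simple_lie :: "('g::cvs \<Rightarrow> 'g \<Rightarrow> 'g) \<Rightarrow> bool"
  where "simple_lie br \<longleftrightarrow> lie_algebra br \<and> (\<exists>x y. br x y \<noteq> 0) \<and>
    (\<forall>I. lie_ideal br I \<longrightarrow> I = {0} \<or> I = UNIV)"

fun lower_central :: "('g::cvs \<Rightarrow> 'g \<Rightarrow> 'g) \<Rightarrow> 'g set \<Rightarrow> nat \<Rightarrow> 'g set"
  where "lower_central br S 0 = S"
  | "lower_central br S (Suc k) = cv.span {br x y | x y. x \<in> S \<and> y \<in> lower_central br S k}"

definition cartan_subalgebra :: "('g::cvs \<Rightarrow> 'g \<Rightarrow> 'g) \<Rightarrow> 'g set \<Rightarrow> bool"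
  where "cartan_subalgebra br h \<longleftrightarrow> cv.subspace h \<and> (\<forall>x\<in>h. \<forall>y\<in>h. br x y \<in> h) \<and>
    (\<exists>k. lower_central br h k = {0}) \<and> {x. \<forall>y\<in>h. br x y \<in> h} = h"

definition root_space :: "('g::cvs \<Rightarrow> 'g \<Rightarrow> 'g) \<Rightarrow> 'g set \<Rightarrow> ('g \<Rightarrow> complex) \<Rightarrow> 'g set"
  where "root_space br h \<alpha> = {x. \<forall>k\<in>h. br k x = \<alpha> k *\<^sub>C x}"

definition roots :: "('g::cvs \<Rightarrow> 'g \<Rightarrow> 'g) \<Rightarrow> 'g set \<Rightarrow> ('g \<Rightarrow> complex) set"
  where "roots br h = {\<alpha> \<in> dual_space h. \<alpha> \<noteq> (\<lambda>_. 0) \<and> root_space br h \<alpha> \<noteq> {0}}"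

definition nonneg_comb :: "('g \<Rightarrow> complex) set \<Rightarrow> ('g \<Rightarrow> complex) \<Rightarrow> bool"
  where "nonneg_comb \<Theta> \<alpha> \<longleftrightarrow> (\<exists>c :: _ \<Rightarrow> nat. \<forall>x. \<alpha> x = (\<Sum>\<beta>\<in>\<Theta>. of_nat (c \<beta>) * \<beta> x))"

text \<open>A triangular decomposition is fixed by a base \<^term>\<open>\<Theta>\<close> of the root system.\<close>

definition root_base :: "('g::cvs \<Rightarrow> 'g \<Rightarrow> 'g) \<Rightarrow> 'g set \<Rightarrow> ('g \<Rightarrow> complex) set \<Rightarrow> bool"
  where "root_base br h \<Theta> \<longleftrightarrow> finite \<Theta> \<and> \<Theta> \<subseteq> roots br h \<and>
    (\<forall>u. (\<forall>x. (\<Sum>\<beta>\<in>\<Theta>. u \<beta> * \<beta> x) = 0) \<longrightarrow> (\<forall>\<beta>\<in>\<Theta>. u \<beta> = 0)) \<and>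
    (\<forall>\<alpha>\<in>roots br h. nonneg_comb \<Theta> \<alpha> \<or> nonneg_comb \<Theta> (\<lambda>x. - \<alpha> x))"

definition g_plus :: "('g::cvs \<Rightarrow> 'g \<Rightarrow> 'g) \<Rightarrow> 'g set \<Rightarrow> ('g \<Rightarrow> complex) set \<Rightarrow> 'g set"
  where "g_plus br h \<Theta> = cv.span (\<Union>\<alpha>\<in>{\<alpha>\<in>roots br h. nonneg_comb \<Theta> \<alpha>}. root_space br h \<alpha>)"

definition invariant_form :: "('g::cvs \<Rightarrow> 'g \<Rightarrow> 'g) \<Rightarrow> ('g \<Rightarrow> 'g \<Rightarrow> complex) \<Rightarrow> bool"
  where "invariant_form br form \<longleftrightarrow> cbilinear form \<and> (\<forall>x y. form x y = form y x) \<and>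
    (\<forall>x y z. form (br x y) z = form x (br y z)) \<and> (\<forall>x. (\<forall>y. form x y = 0) \<longrightarrow> x = 0)"

text \<open>Normalization: long roots have square length 2 for the form induced on the dual of the
  Cartan subalgebra, where \<open>(\<alpha>, \<alpha>) = (t, t)\<close> for the \<open>t\<close> in the Cartan subalgebra with \<open>(t, k) = \<alpha>(k)\<close>.\<close>

definition root_sq_length :: "('g::cvs \<Rightarrow> 'g \<Rightarrow> complex) \<Rightarrow> 'g set \<Rightarrow> ('g \<Rightarrow> complex) \<Rightarrow> complex"
  where "root_sq_length form h \<alpha> = (let t = (THE t. t \<in> h \<and> (\<forall>k\<in>h. form t k = \<alpha> k)) in form t t)"

definition normalized_form :: "('g::cvs \<Rightarrow> 'g \<Rightarrow> 'g) \<Rightarrow> 'g set \<Rightarrow> ('g \<Rightarrow> 'g \<Rightarrow> complex) \<Rightarrow> bool"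
  where "normalized_form br h form \<longleftrightarrow>
    (\<forall>\<alpha>\<in>roots br h. root_sq_length form h \<alpha> \<in> \<real> \<and> Re (root_sq_length form h \<alpha>) \<le> 2) \<and>
    (\<exists>\<alpha>\<in>roots br h. root_sq_length form h \<alpha> = 2)"

definition lie_module :: "('l::cvs \<Rightarrow> 'l \<Rightarrow> 'l) \<Rightarrow> ('l \<Rightarrow> 'v::cvs \<Rightarrow> 'v) \<Rightarrow> bool"
  where "lie_module br act \<longleftrightarrow> cbilinear act \<and>
    (\<forall>x y v. act (br x y) v = act x (act y v) - act y (act x v))"

definition submodule :: "'l set \<Rightarrow> ('l \<Rightarrow> 'v::cvs \<Rightarrow> 'v) \<Rightarrow> 'v set \<Rightarrow> bool"
  where "submodule L act M \<longleftrightarrow> cv.subspace M \<and> (\<forall>x\<in>L. \<forall>v\<in>M. act x v \<in> M)"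

definition irreducible_module :: "('l \<Rightarrow> 'v::cvs \<Rightarrow> 'v) \<Rightarrow> bool"
  where "irreducible_module act \<longleftrightarrow> (UNIV :: 'v set) \<noteq> {0} \<and>
    (\<forall>M. submodule UNIV act M \<longrightarrow> M = {0} \<or> M = UNIV)"

definition maximal_proper_submodule :: "'l set \<Rightarrow> ('l \<Rightarrow> 'v::cvs \<Rightarrow> 'v) \<Rightarrow> 'v set \<Rightarrow> bool"
  where "maximal_proper_submodule L act W \<longleftrightarrow> submodule L act W \<and> W \<noteq> UNIV \<and>
    (\<forall>M. submodule L act M \<longrightarrow> W \<subseteq> M \<longrightarrow> M = W \<or> M = UNIV)"

text \<open>\<open>U(L) v\<close>: the universal enveloping algebra is spanned by the products of elements of the
  Lie algebra (here a whole type).\<close>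

definition U_orbit :: "('l \<Rightarrow> 'v::cvs \<Rightarrow> 'v) \<Rightarrow> 'v \<Rightarrow> 'v set"
  where "U_orbit act v = cv.span {foldr act xs v | xs. True}"

definition weight_space :: "('l \<Rightarrow> 'v::cvs \<Rightarrow> 'v) \<Rightarrow> 'l set \<Rightarrow> ('l \<Rightarrow> complex) \<Rightarrow> 'v set"
  where "weight_space act H l = {v. \<forall>k\<in>H. act k v = l k *\<^sub>C v}"

definition locally_nilpotent :: "('v::cvs \<Rightarrow> 'v) \<Rightarrow> bool"
  where "locally_nilpotent f \<longleftrightarrow> (\<forall>v. \<exists>N. (f ^^ N) v = 0)"

text \<open>A surjection with kernel \<^term>\<open>W\<close> exhibits its target as \<open>V / W\<close>.\<close>

definition quotient_map :: "'v::cvs set \<Rightarrow> ('v \<Rightarrow> 'w::cvs) \<Rightarrow> bool"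
  where "quotient_map W \<pi> \<longleftrightarrow> clinear \<pi> \<and> surj \<pi> \<and> {v. \<pi> v = 0} = W"

definition quotient_act :: "('v \<Rightarrow> 'w) \<Rightarrow> ('l \<Rightarrow> 'v \<Rightarrow> 'v) \<Rightarrow> 'l \<Rightarrow> 'w \<Rightarrow> 'w"
  where "quotient_act \<pi> act x w = \<pi> (act x (inv \<pi> w))"

text \<open>The action of the target of a surjective homomorphism \<^term>\<open>\<phi>\<close> whose kernel acts trivially.\<close>

definition induced_act :: "('l \<Rightarrow> 'm) \<Rightarrow> ('l \<Rightarrow> 'v \<Rightarrow> 'v) \<Rightarrow> 'm \<Rightarrow> 'v \<Rightarrow> 'v"
  where "induced_act \<phi> act y v = act (inv \<phi> y) v"

section \<open>The toroidal Lie algebra\<close>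

text \<open>The index set \<open>{0, \<dots>, n}\<close> is \<^typ>\<open>'n option\<close>, with \<^const>\<open>None\<close> for \<open>0\<close>; exponents
  \<open>(k\<^sub>0, k)\<close> are elements of \<open>int \<times> (int ^ 'n)\<close>, and a coordinate vector \<open>d :: complex ^ ('n option)\<close>
  stands for \<open>\<Sum>\<^sub>i d $ i \<cdot> d\<^sub>i\<close>.\<close>

type_synonym 'n expo = "int \<times> (int ^ 'n)"
type_synonym 'n laurent = "'n expo \<Rightarrow>\<^sub>0 complex"
type_synonym 'n laurent_n = "(int ^ 'n) \<Rightarrow>\<^sub>0 complex"
type_synonym 'n omega = "('n expo \<times> 'n option) \<Rightarrow>\<^sub>0 complex"

fun deg :: "'n::finite expo \<Rightarrow> 'n option \<Rightarrow> int"
  where "deg k None = fst k" | "deg k (Some i) = snd k $ i"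

definition dA :: "'n::finite omega set"
  where "dA = cv.span {(\<Sum>i\<in>UNIV. of_int (deg k i) *\<^sub>C lmon (k, i)) | k. True}"

lemma subspace_dA: "cv.subspace dA"
  by (simp add: dA_def)

quotient_type (overloaded) 'n kahler = "'n::finite omega" / "\<lambda>f g. f - g \<in> dA"
  by (rule subspace_equivp[OF subspace_dA])

instantiation kahler :: (finite) cvs
begin
lift_definition zero_kahler :: "'a kahler" is 0 .
lift_definition plus_kahler :: "'a kahler \<Rightarrow> 'a kahler \<Rightarrow> 'a kahler" is "(+)"
  by (rule subspace_cong[OF subspace_dA])
lift_definition minus_kahler :: "'a kahler \<Rightarrow> 'a kahler \<Rightarrow> 'a kahler" is "(-)"
  by (rule subspace_cong[OF subspace_dA])
lift_definition uminus_kahler :: "'a kahler \<Rightarrow> 'a kahler" is uminus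
  by (rule subspace_cong[OF subspace_dA])
lift_definition scaleC_kahler :: "complex \<Rightarrow> 'a kahler \<Rightarrow> 'a kahler" is scaleC
  by (rule subspace_cong[OF subspace_dA])
instance
  by standard
    (transfer; simp add: cv.subspace_0[OF subspace_dA] scaleC_add_right scaleC_add_left
      scaleC_scaleC scaleC_one ac_simps)+
end

lift_definition zK :: "'n::finite expo \<Rightarrow> 'n option \<Rightarrow> 'n kahler" is "\<lambda>k i. lmon (k, i)" .

definition kahler_lift :: "('n::finite expo \<Rightarrow> 'n option \<Rightarrow> 'v::cvs) \<Rightarrow> 'n kahler \<Rightarrow> 'v"
  where "kahler_lift h z = lin_ext (\<lambda>(k, i). h k i) (rep_kahler z)"

definition kills_dA :: "('n::finite expo \<Rightarrow> 'n option \<Rightarrow> 'v::cvs) \<Rightarrow> bool"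
  where "kills_dA h \<longleftrightarrow> (\<forall>k. (\<Sum>i\<in>UNIV. of_int (deg k i) *\<^sub>C h k i) = 0)"

lemma abs_kahler_eq_iff: "abs_kahler p = abs_kahler q \<longleftrightarrow> p - q \<in> dA"
  by (simp add: kahler.abs_eq_iff)

lemma abs_rep_kahler: "abs_kahler (rep_kahler t) = t"
  by (rule Quotient3_abs_rep[OF Quotient3_kahler])

lemma kahler_lift_abs:
  assumes "kills_dA h"
  shows "kahler_lift h (abs_kahler p) = lin_ext (\<lambda>(k, i). h k i) p"
proof -
  let ?L = "lin_ext (\<lambda>(k, i). h k i)"
  have "cv.subspace {p. ?L p = 0}"
    by (rule cv.subspaceI) (simp_all add: lin_ext_add lin_ext_scaleC clinear_0[OF lin_ext_linear])
  then have "dA \<subseteq> {p. ?L p = 0}"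
    unfolding dA_def
    by (rule cv.span_minimal[rotated])
      (use assms in \<open>auto simp: clinear_sum[OF lin_ext_linear] lin_ext_scaleC scaleC_one kills_dA_def\<close>)
  moreover have "rep_kahler (abs_kahler p) - p \<in> dA"
    by (simp add: abs_kahler_eq_iff[symmetric] abs_rep_kahler)
  ultimately have "?L (rep_kahler (abs_kahler p) - p) = 0" by blast
  then show ?thesis
    by (simp add: kahler_lift_def clinear_diff[OF lin_ext_linear])
qed

lemma kahler_lift_zK: "kills_dA h \<Longrightarrow> kahler_lift h (zK k i) = h k i"
  by (simp add: zK.abs_eq kahler_lift_abs scaleC_one)

lemma kahler_lift_linear:
  assumes "kills_dA h"
  shows "clinear (kahler_lift h)"
proof (rule clinearI)
  fix s t c
  have "kahler_lift h (abs_kahler (rep_kahler s) + abs_kahler (rep_kahler t))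
      = kahler_lift h (abs_kahler (rep_kahler s)) + kahler_lift h (abs_kahler (rep_kahler t))"
    by (simp add: plus_kahler.abs_eq kahler_lift_abs[OF assms] lin_ext_add)
  then show "kahler_lift h (s + t) = kahler_lift h s + kahler_lift h t"
    by (simp only: abs_rep_kahler)
  have "kahler_lift h (c *\<^sub>C abs_kahler (rep_kahler s)) = c *\<^sub>C kahler_lift h (abs_kahler (rep_kahler s))"
    by (simp add: scaleC_kahler.abs_eq kahler_lift_abs[OF assms] lin_ext_scaleC)
  then show "kahler_lift h (c *\<^sub>C s) = c *\<^sub>C kahler_lift h s"
    by (simp only: abs_rep_kahler)
qed

lemma zK_relation: "(\<Sum>i\<in>UNIV. of_int (deg k i) *\<^sub>C zK k i) = 0"
proof -
  have lin: "clinear abs_kahler"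
    by (simp add: clinear_iff plus_kahler.abs_eq scaleC_kahler.abs_eq)
  have "(\<Sum>i\<in>UNIV. of_int (deg k i) *\<^sub>C lmon (k, i)) - 0 \<in> dA"
    unfolding dA_def diff_0_right by (rule cv.span_base) blast
  then have "abs_kahler (\<Sum>i\<in>UNIV. of_int (deg k i) *\<^sub>C lmon (k, i)) = 0"
    by (simp only: abs_kahler_eq_iff zero_kahler_def)
  then show ?thesis
    by (simp add: clinear_sum[OF lin] clinear_scale[OF lin] zK.abs_eq)
qed

type_synonym ('g, 'n) tau0 = "('g, 'n laurent) tensor \<times> 'n kahler"
type_synonym ('g, 'n, 'b) tau = "(('g, 'n) tau0, 'b) tensor \<times> (complex ^ ('n option))"

text \<open>\<open>omega_form f g = (d f) g\<close> in \<open>\<Omega>\<^sub>A / dA\<close>.\<close>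

definition omega_form :: "'n::finite laurent \<Rightarrow> 'n laurent \<Rightarrow> 'n kahler"
  where "omega_form f g =
    lin_ext (\<lambda>k. lin_ext (\<lambda>r. \<Sum>i\<in>UNIV. of_int (deg k i) *\<^sub>C zK (k + r) i) g) f"

definition tau0_bracket ::
  "('g::cvs \<Rightarrow> 'g \<Rightarrow> 'g) \<Rightarrow> ('g \<Rightarrow> 'g \<Rightarrow> complex) \<Rightarrow>
    ('g, 'n::finite) tau0 \<Rightarrow> ('g, 'n) tau0 \<Rightarrow> ('g, 'n) tau0"
  where "tau0_bracket br form u u' =
    tensor_lift2 (\<lambda>x f y g. (br x y \<otimes> (f * g), form x y *\<^sub>C omega_form f g)) (fst u) (fst u')"

definition d_eigen :: "complex ^ ('n option) \<Rightarrow> 'n::finite expo \<Rightarrow> complex"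
  where "d_eigen d k = (\<Sum>i\<in>UNIV. d $ i * of_int (deg k i))"

definition tau0_der :: "complex ^ ('n option) \<Rightarrow> ('g::cvs, 'n::finite) tau0 \<Rightarrow> ('g, 'n) tau0"
  where "tau0_der d u =
    (tensor_lift (\<lambda>x f. x \<otimes> lin_ext (\<lambda>k. d_eigen d k *\<^sub>C lmon k) f) (fst u),
     kahler_lift (\<lambda>k i. d_eigen d k *\<^sub>C zK k i) (snd u))"

definition tau_bracket ::
  "('g::cvs \<Rightarrow> 'g \<Rightarrow> 'g) \<Rightarrow> ('g \<Rightarrow> 'g \<Rightarrow> complex) \<Rightarrow>
    ('g, 'n::finite, 'b::comm_calg) tau \<Rightarrow> ('g, 'n, 'b) tau \<Rightarrow> ('g, 'n, 'b) tau"
  where "tau_bracket br form X Y =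
    (tensor_lift2 (\<lambda>x b y b'. tau0_bracket br form x y \<otimes> (b * b')) (fst X) (fst Y)
       + tensor_lift (\<lambda>y b. tau0_der (snd X) y \<otimes> b) (fst Y)
       - tensor_lift (\<lambda>x b. tau0_der (snd Y) x \<otimes> b) (fst X), 0)"

definition tau_X :: "'g::cvs \<Rightarrow> 'n::finite expo \<Rightarrow> 'b::comm_calg \<Rightarrow> ('g, 'n, 'b) tau"
  where "tau_X x k b = ((x \<otimes> lmon k, 0) \<otimes> b, 0)"

definition tau_K :: "'n::finite expo \<Rightarrow> 'n option \<Rightarrow> 'b::comm_calg \<Rightarrow> ('g::cvs, 'n, 'b) tau"
  where "tau_K k i b = ((0, zK k i) \<otimes> b, 0)"

definition tau_d :: "'n::finite option \<Rightarrow> ('g::cvs, 'n, 'b::comm_calg) tau"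
  where "tau_d i = (0, axis i 1)"

definition tau_H :: "'g::cvs set \<Rightarrow> ('g, 'n::finite, 'b::comm_calg) tau set"
  where "tau_H h = cv.span ({tau_X x 0 1 | x. x \<in> h} \<union> {tau_K 0 i 1 | i. True} \<union> range tau_d)"

definition tau_plus :: "'g::cvs set \<Rightarrow> ('g, 'n::finite, 'b::comm_calg) tau set"
  where "tau_plus gp = cv.span (
     {tau_X x (0, m) b | x m b. x \<in> gp} \<union>
     {tau_X x (k, m) b | x k m b. k \<ge> 1} \<union>
     {tau_K (k, m) i b | k m i b. k \<ge> 1})"

definition integrable_module ::
  "('g::cvs \<Rightarrow> 'g \<Rightarrow> 'g) \<Rightarrow> 'g set \<Rightarrow> (('g, 'n::finite, 'b::comm_calg) tau \<Rightarrow> 'v::cvs \<Rightarrow> 'v) \<Rightarrow> bool"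
  where "integrable_module br h act \<longleftrightarrow>
    direct_sum (dual_space (tau_H h)) (weight_space act (tau_H h)) UNIV \<and>
    (\<forall>\<alpha>\<in>roots br h. \<forall>x\<in>root_space br h \<alpha>. \<forall>k b. locally_nilpotent (act (tau_X x k b)))"

definition central_operator ::
  "(('g::cvs, 'n::finite, 'b::comm_calg) tau \<Rightarrow> 'v::cvs \<Rightarrow> 'v) \<Rightarrow> 'n expo \<Rightarrow> ('v \<Rightarrow> 'v) \<Rightarrow> bool"
  where "central_operator act m z \<longleftrightarrow> clinear z \<and>
    (\<forall>X v. snd X = 0 \<longrightarrow> z (act X v) = act X (z v)) \<and>
    (\<forall>i v. act (tau_d i) (z v) - z (act (tau_d i) v) = of_int (deg m i) *\<^sub>C z v)"

section \<open>The multiloop algebra of the affine Lie algebra\<close>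

type_synonym 'g aff = "('g, int \<Rightarrow>\<^sub>0 complex) tensor \<times> complex"
type_synonym ('g, 'n, 'b) gtilde =
  "(('g aff, 'n laurent_n) tensor, 'b) tensor \<times> (complex ^ ('n option))"

definition aff_bracket ::
  "('g::cvs \<Rightarrow> 'g \<Rightarrow> 'g) \<Rightarrow> ('g \<Rightarrow> 'g \<Rightarrow> complex) \<Rightarrow> 'g aff \<Rightarrow> 'g aff \<Rightarrow> 'g aff"
  where "aff_bracket br form u u' =
    tensor_lift2 (\<lambda>x p y q. (br x y \<otimes> (p * q),
      form x y * lin_ext (\<lambda>k. lin_ext (\<lambda>r. if k + r = 0 then of_int k else 0) q) p)) (fst u) (fst u')"

definition aff_d0 :: "'g::cvs aff \<Rightarrow> 'g aff"
  where "aff_d0 u = (tensor_lift (\<lambda>x p. x \<otimes> lin_ext (\<lambda>k. of_int k *\<^sub>C lmon k) p) (fst u), 0)"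

definition gtilde_der ::
  "complex ^ ('n option) \<Rightarrow> (('g::cvs aff, 'n::finite laurent_n) tensor, 'b::comm_calg) tensor
    \<Rightarrow> (('g aff, 'n laurent_n) tensor, 'b) tensor"
  where "gtilde_der d = tensor_lift (\<lambda>h b. tensor_lift (\<lambda>y a.
      (d $ None *\<^sub>C aff_d0 y) \<otimes> a
      + y \<otimes> lin_ext (\<lambda>r. (\<Sum>i\<in>UNIV. d $ Some i * of_int (r $ i)) *\<^sub>C lmon r) a) h \<otimes> b)"

definition gtilde_bracket ::
  "('g::cvs \<Rightarrow> 'g \<Rightarrow> 'g) \<Rightarrow> ('g \<Rightarrow> 'g \<Rightarrow> complex) \<Rightarrow>
    ('g, 'n::finite, 'b::comm_calg) gtilde \<Rightarrow> ('g, 'n, 'b) gtilde \<Rightarrow> ('g, 'n, 'b) gtilde"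
  where "gtilde_bracket br form X Y =
    (tensor_lift2 (\<lambda>h b h' b'.
        tensor_lift2 (\<lambda>y a y' a'. aff_bracket br form y y' \<otimes> (a * a')) h h' \<otimes> (b * b')) (fst X) (fst Y)
      + gtilde_der (snd X) (fst Y) - gtilde_der (snd Y) (fst X), 0)"

definition gt_Y :: "'g::cvs aff \<Rightarrow> int ^ 'n \<Rightarrow> 'b::comm_calg \<Rightarrow> ('g, 'n::finite, 'b) gtilde"
  where "gt_Y y r b = ((y \<otimes> lmon r) \<otimes> b, 0)"

definition gt_d :: "'n::finite option \<Rightarrow> ('g::cvs, 'n, 'b::comm_calg) gtilde"
  where "gt_d i = (0, axis i 1)"

text \<open>The subalgebra \<open>G\<close>, which contains \<open>d\<^sub>0\<close> but not \<open>d\<^sub>1, \<dots>, d\<^sub>n\<close>.\<close>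

definition G_sub :: "('g::cvs, 'n::finite, 'b::comm_calg) gtilde set"
  where "G_sub = {X. \<forall>i. snd X $ Some i = 0}"

definition G_deg ::
  "('g::cvs \<Rightarrow> 'g \<Rightarrow> 'g) \<Rightarrow> ('g \<Rightarrow> 'g \<Rightarrow> complex) \<Rightarrow> int ^ 'n
    \<Rightarrow> ('g, 'n::finite, 'b::comm_calg) gtilde set"
  where "G_deg br form r = {X \<in> G_sub. \<forall>i. gtilde_bracket br form (gt_d (Some i)) X = of_int (r $ i) *\<^sub>C X}"

definition gt_H0 :: "'g::cvs set \<Rightarrow> ('g, 'n::finite, 'b::comm_calg) gtilde set"
  where "gt_H0 h = cv.span ({gt_Y (x \<otimes> lmon 0, 0) 0 1 | x. x \<in> h} \<union> {gt_Y (0, 1) 0 1, gt_d None})"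

definition phi0 :: "('g::cvs, 'n::finite) tau0 \<Rightarrow> ('g aff, 'n laurent_n) tensor"
  where "phi0 u =
    tensor_lift (\<lambda>x. lin_ext (\<lambda>k. (x \<otimes> lmon (fst k), 0) \<otimes> lmon (snd k))) (fst u)
    + kahler_lift (\<lambda>k i. if i = None \<and> fst k = 0 then (0, 1) \<otimes> lmon (snd k) else 0) (snd u)"

definition phi :: "('g::cvs, 'n::finite, 'b::comm_calg) tau \<Rightarrow> ('g, 'n, 'b) gtilde"
  where "phi X = (tensor_lift (\<lambda>u b. phi0 u \<otimes> b) (fst X), snd X)"

text \<open>The action \<open>\<rho>(\<alpha>)\<close> on \<open>V' \<otimes> A\<^sub>n\<close> for a \<open>G\<close>-module \<open>V'\<close>; only the values of \<^term>\<open>act\<close> on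
  \<^const>\<open>G_sub\<close> are used.  Homogeneous elements of \<open>G\<close> shift the \<open>A\<^sub>n\<close>-degree
  (\<open>rho_G_deg\<close> below) and \<open>d\<^sub>1, \<dots>, d\<^sub>n\<close> act by \<open>\<alpha>\<^sub>i + s\<^sub>i\<close> (\<open>rho_d\<close> below).\<close>

definition rho ::
  "(('g::cvs, 'n::finite, 'b::comm_calg) gtilde \<Rightarrow> 'w::cvs \<Rightarrow> 'w) \<Rightarrow> ('n \<Rightarrow> complex) \<Rightarrow>
    ('g, 'n, 'b) gtilde \<Rightarrow> ('w, 'n laurent_n) tensor \<Rightarrow> ('w, 'n laurent_n) tensor"
  where "rho act \<alpha> X =
    tensor_lift (\<lambda>u p.
      tensor_lift (\<lambda>h b. tensor_lift (\<lambda>y.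
        lin_ext (\<lambda>r. act (gt_Y y r b) u \<otimes> (lmon r * p))) h) (fst X)
      + snd X $ None *\<^sub>C (act (gt_d None) u \<otimes> p)
      + u \<otimes> lin_ext (\<lambda>s. (\<Sum>i\<in>UNIV. snd X $ Some i * (\<alpha> i + of_int (s $ i))) *\<^sub>C lmon s) p)"


section \<open>The defining formulas\<close>

lemma clinear_id: "clinear (\<lambda>x. x)"
  and clinear_zero: "clinear (\<lambda>x. 0)"
  and clinear_fst: "clinear fst"
  and clinear_snd: "clinear snd"
  by (simp_all add: clinear_iff scaleC_prod_def)

lemma clinear_Pair: "clinear f \<Longrightarrow> clinear g \<Longrightarrow> clinear (\<lambda>x. (f x, g x))"
  by (simp add: clinear_iff scaleC_prod_def)

lemma clinear_tens1: "clinear f \<Longrightarrow> clinear (\<lambda>x. f x \<otimes> y)"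
  by (rule clinear_compose[OF _ tens_linear_left])

lemma clinear_tens2: "clinear f \<Longrightarrow> clinear (\<lambda>x. y \<otimes> f x)"
  by (rule clinear_compose[OF _ tens_linear_right])

lemma clinear_scalar: "clinear f \<Longrightarrow> clinear (\<lambda>x. f x *\<^sub>C y)"
  by (simp add: clinear_iff scaleC_add_left) (simp add: scaleC_complex_def)

lemmas clin = clinear_id clinear_zero clinear_Pair clinear_plus clinear_minus clinear_scaled
  clinear_tens1 clinear_tens2 clinear_scalar lin_ext_linear comm_calg_linear laurent_mult_linear

lemma scaleC_Pair: "c *\<^sub>C (x, y) = (c *\<^sub>C x, c *\<^sub>C y)"
  by (simp add: scaleC_prod_def)

lemma tens_0 [simp]: "x \<otimes> 0 = 0" "0 \<otimes> x = 0"
  by (rule clinear_0[OF tens_linear_right] clinear_0[OF tens_linear_left])+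

lemma tensor_lift2_0: 
  assumes "cquadrilinear f"
  shows "tensor_lift2 f 0 t = 0" "tensor_lift2 f s 0 = 0"
  by (rule clinear_0[OF tensor_lift2_linear(1)[OF assms]] clinear_0[OF tensor_lift2_linear(2)[OF assms]])+

lemma tensor_lift_0: "cbilinear f \<Longrightarrow> tensor_lift f 0 = 0"
  by (rule clinear_0[OF tensor_lift_linear])

lemma omega_form_linear: "clinear (\<lambda>f. omega_form f g)" "clinear (omega_form f)"
  unfolding omega_form_def by (rule lin_ext_linear lin_ext_linear_in)+

lemma omega_form_lmon:
  "omega_form (lmon k) (lmon r) = (\<Sum>i\<in>UNIV. of_int (deg k i) *\<^sub>C zK (k + r) i)"
  by (simp add: omega_form_def scaleC_one)

lemma cbilinearD: "cbilinear f \<Longrightarrow> clinear (\<lambda>x. f x y)" "cbilinear f \<Longrightarrow> clinear (f x)"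
  by (auto simp: cbilinear_def)

lemma tau0_quadrilinear:
  assumes "cbilinear br" "cbilinear form"
  shows "cquadrilinear (\<lambda>x f y g. (br x y \<otimes> (f * g), form x y *\<^sub>C omega_form f g))"
  unfolding cquadrilinear_def
  by (intro conjI allI clin cbilinearD[OF assms(1)] cbilinearD[OF assms(2)] omega_form_linear)

lemma tau0_bracket_tens:
  assumes "cbilinear br" "cbilinear form"
  shows "tau0_bracket br form (x \<otimes> f, z) (y \<otimes> g, z') = (br x y \<otimes> (f * g), form x y *\<^sub>C omega_form f g)"
  by (simp add: tau0_bracket_def tensor_lift2_tens[OF tau0_quadrilinear[OF assms]])

lemma tau0_bracket_central:
  assumes "cbilinear br" "cbilinear form"
  shows "tau0_bracket br form (0, z) u = 0" "tau0_bracket br form u (0, z) = 0"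
  by (simp_all add: tau0_bracket_def tensor_lift2_0[OF tau0_quadrilinear[OF assms]])

lemma tau0_bracket_linear:
  assumes "cbilinear br" "cbilinear form"
  shows "clinear (\<lambda>u. tau0_bracket br form u v)" "clinear (tau0_bracket br form u)"
  unfolding tau0_bracket_def
  by (rule clinear_compose[OF clinear_fst tensor_lift2_linear(1)[OF tau0_quadrilinear[OF assms]]]
      clinear_compose[OF clinear_fst tensor_lift2_linear(2)[OF tau0_quadrilinear[OF assms]]])+

lemma tau0_der_aux:
  "cbilinear (\<lambda>x f. x \<otimes> lin_ext (\<lambda>k. d_eigen d k *\<^sub>C lmon k) f)"
  "kills_dA (\<lambda>k i. d_eigen d k *\<^sub>C zK k i)"
proof -
  show "cbilinear (\<lambda>x f. x \<otimes> lin_ext (\<lambda>k. d_eigen d k *\<^sub>C lmon k) f)"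
    unfolding cbilinear_def by (intro conjI allI clin)
  show "kills_dA (\<lambda>k i. d_eigen d k *\<^sub>C zK k i)"
    unfolding kills_dA_def cv.scale_left_commute[of _ "d_eigen _ _"] cv.scale_sum_right[symmetric]
    by (simp add: zK_relation)
qed

lemma tau0_der_linear: "clinear (tau0_der d)"
  unfolding tau0_der_def
  by (intro clinear_Pair clinear_compose[OF clinear_fst tensor_lift_linear]
      clinear_compose[OF clinear_snd kahler_lift_linear] tau0_der_aux)

lemma tau0_der_generators:
  "tau0_der d (x \<otimes> lmon k, 0) = d_eigen d k *\<^sub>C (x \<otimes> lmon k, 0)"
  "tau0_der d (0, zK k i) = d_eigen d k *\<^sub>C (0, zK k i)"
  by (simp_all add: tau0_der_def tensor_lift_tens tensor_lift_0 kahler_lift_zK tau0_der_aux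
      clinear_0[OF kahler_lift_linear] clinear_scale[OF tens_linear_right] scaleC_one scaleC_Pair)

lemma d_eigen_axis: "d_eigen (axis i 1) k = of_int (deg k i)"
  by (simp add: d_eigen_def axis_def if_distrib[of "\<lambda>x. x * _"] cong: if_cong)

lemma tau_bracket_aux:
  assumes "cbilinear br" "cbilinear form"
  shows "cquadrilinear (\<lambda>x b y (b'::'b::comm_calg). tau0_bracket br form x y \<otimes> (b * b'))"
    and "cbilinear (\<lambda>y (b::'b::comm_calg). tau0_der d y \<otimes> b)"
  unfolding cquadrilinear_def cbilinear_def
  by (intro conjI allI clin tau0_bracket_linear[OF assms] tau0_der_linear)+

lemma tensor_lift2_left:
  assumes "cquadrilinear f"
  shows "tensor_lift2 f (x \<otimes> y) t = tensor_lift (f x y) t"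
proof -
  have "cbilinear (\<lambda>x y. tensor_lift (\<lambda>x' y'. f x y x' y') t)"
    using assms unfolding cbilinear_def cquadrilinear_def
    by (auto intro: tensor_lift_linear_in)
  then show ?thesis by (simp add: tensor_lift2_def tensor_lift_tens)
qed

lemma tensor_lift_zero_fun: "tensor_lift (\<lambda>x y. 0) t = 0"
  by (simp add: tensor_lift_def lin_ext_def)

lemma tau0_der_zero: "tau0_der 0 u = 0"
  by (simp add: tau0_der_def d_eigen_def lin_ext_def tensor_lift_def kahler_lift_def
      zero_prod_def case_prod_beta)

lemma tau_bracket_loop:
  "tau_bracket br form (U, 0) (U', 0)
    = (tensor_lift2 (\<lambda>x b y b'. tau0_bracket br form x y \<otimes> (b * b')) U U', 0)"
  by (simp add: tau_bracket_def tau0_der_zero tensor_lift_zero_fun)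

lemma tau_bracket_d:
  assumes "cbilinear br" "cbilinear form"
  shows "tau_bracket br form (0, d) (U, 0) = (tensor_lift (\<lambda>y b. tau0_der d y \<otimes> b) U, 0)"
  by (simp add: tau_bracket_def tau0_der_zero tensor_lift_zero_fun tensor_lift2_0[OF tau_bracket_aux(1)[OF assms]])

theorem tau_bracket_generators:
  fixes br :: "'g::cvs \<Rightarrow> 'g \<Rightarrow> 'g" and k r :: "'n::finite expo" and b b' :: "'b::comm_calg"
  assumes "cbilinear br" "cbilinear form"
  shows "tau_bracket br form (tau_X x k b) (tau_X y r b') =
      tau_X (br x y) (k + r) (b * b')
        + form x y *\<^sub>C (\<Sum>i\<in>UNIV. of_int (deg k i) *\<^sub>C tau_K (k + r) i (b * b'))" (is ?XX)
    and "tau_bracket br form (tau_K k i b) (U, 0) = 0" (is ?KU)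
    and "tau_bracket br form (U, 0) (tau_K k i b) = 0" (is ?UK)
    and "tau_bracket br form (tau_d i) (tau_X x k b) = of_int (deg k i) *\<^sub>C tau_X x k b" (is ?dX)
    and "tau_bracket br form (tau_d i) (tau_K k j b) = of_int (deg k i) *\<^sub>C tau_K k j b" (is ?dK)
    and "tau_bracket br form (tau_d i) (tau_d j) = 0" (is ?dd)
proof -
  note aux = tau_bracket_aux(1)[OF assms]
  note der_aux = tau_bracket_aux(2)[OF assms]
  have K: "(tau_K m i b :: ('g, 'n, 'b) tau) = ((0, zK m i) \<otimes> b, 0)" for m i b by (simp add: tau_K_def)
  have lin: "clinear (\<lambda>w. ((0, w) \<otimes> b, 0) :: ('g, 'n, 'b) tau)" for b
    by (intro clin)
  have "form x y *\<^sub>C (\<Sum>i\<in>UNIV. of_int (deg k i) *\<^sub>C (tau_K (k + r) i (b * b') :: ('g, 'n, 'b) tau))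
      = ((0, form x y *\<^sub>C omega_form (lmon k) (lmon r)) \<otimes> (b * b'), 0)"
    unfolding omega_form_lmon clinear_scale[OF lin] clinear_sum[OF lin] K ..
  then have "tau_X (br x y) (k + r) (b * b')
        + form x y *\<^sub>C (\<Sum>i\<in>UNIV. of_int (deg k i) *\<^sub>C tau_K (k + r) i (b * b'))
      = ((br x y \<otimes> lmon (k + r), form x y *\<^sub>C omega_form (lmon k) (lmon r)) \<otimes> (b * b'), 0)"
    by (simp add: tau_X_def clinear_add[OF tens_linear_left, symmetric])
  then show ?XX
    by (simp add: tau_X_def tau_bracket_loop tensor_lift2_tens[OF aux] tau0_bracket_tens[OF assms] mult_single)
  show ?KU
    by (simp add: K tau_bracket_loop tensor_lift2_left[OF aux] tau0_bracket_central[OF assms]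
        tensor_lift_zero_fun zero_prod_def[symmetric])
  have "tensor_lift2 (\<lambda>x b y b'. tau0_bracket br form x y \<otimes> (b * b')) U ((0, zK k i) \<otimes> b) = 0"
    by (rule tensor_unique[OF tensor_lift2_linear(1)[OF aux] clinear_zero])
      (simp add: tensor_lift2_tens[OF aux] tau0_bracket_central[OF assms])
  then show ?UK
    by (simp add: K tau_bracket_loop zero_prod_def[symmetric])
  have "tensor_lift (\<lambda>y b. tau0_der (axis i 1) y \<otimes> b) ((x \<otimes> lmon k, 0) \<otimes> b)
      = of_int (deg k i) *\<^sub>C ((x \<otimes> lmon k, 0) \<otimes> b)"
    by (simp add: tensor_lift_tens[OF der_aux] tau0_der_generators d_eigen_axis clinear_scale[OF tens_linear_left])
  then show ?dX
    by (simp add: tau_X_def tau_d_def tau_bracket_d[OF assms] scaleC_Pair)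
  have "tensor_lift (\<lambda>y b. tau0_der (axis i 1) y \<otimes> b) ((0 :: ('g, 'n laurent) tensor, zK k j) \<otimes> b)
      = of_int (deg k i) *\<^sub>C ((0, zK k j) \<otimes> b)"
    by (simp add: tensor_lift_tens[OF der_aux] tau0_der_generators d_eigen_axis clinear_scale[OF tens_linear_left])
  then show ?dK
    by (simp add: K tau_d_def tau_bracket_d[OF assms] scaleC_Pair)
  show ?dd
    by (simp add: tau_d_def tau_bracket_def tensor_lift2_0[OF aux] tensor_lift_0[OF der_aux] zero_prod_def[symmetric])
qed

lemma phi0_aux:
  "cbilinear (\<lambda>x. lin_ext (\<lambda>k. (x \<otimes> lmon (fst k), 0) \<otimes> lmon (snd k)))"
  "kills_dA (\<lambda>k i. if i = None \<and> fst k = 0 then (0, 1) \<otimes> lmon (snd k) else 0)"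
proof -
  show "cbilinear (\<lambda>x. lin_ext (\<lambda>k. (x \<otimes> lmon (fst k), 0) \<otimes> lmon (snd k)))"
    unfolding cbilinear_def by (intro conjI allI clin lin_ext_linear_in)
  have "of_int (deg k i) *\<^sub>C (if i = None \<and> fst k = 0 then (0, 1) \<otimes> lmon (snd k) else 0) = 0"
    for k and i :: "'n::finite option"
    by (cases i) auto
  then show "kills_dA (\<lambda>k i. if i = None \<and> fst k = 0 then (0, 1) \<otimes> lmon (snd k) else 0)"
    unfolding kills_dA_def by (intro allI sum.neutral ballI)
qed

lemma phi0_linear: "clinear phi0"
  unfolding phi0_def
  by (intro clinear_plus clinear_compose[OF clinear_fst tensor_lift_linear]
      clinear_compose[OF clinear_snd kahler_lift_linear] phi0_aux)

lemma phi0_generators: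
  "phi0 (x \<otimes> lmon k, 0) = (x \<otimes> lmon (fst k), 0) \<otimes> lmon (snd k)"
  "phi0 (0, zK k i) = (if i = None \<and> fst k = 0 then (0, 1) \<otimes> lmon (snd k) else 0)"
  by (simp_all add: phi0_def tensor_lift_tens[OF phi0_aux(1)] tensor_lift_0[OF phi0_aux(1)]
      clinear_0[OF kahler_lift_linear[OF phi0_aux(2)]] kahler_lift_zK[OF phi0_aux(2)] scaleC_one)

lemma phi_aux: "cbilinear (\<lambda>u b. phi0 u \<otimes> b)"
  unfolding cbilinear_def by (intro conjI allI clin phi0_linear)

lemma phi_tens: "phi (u \<otimes> b, d) = (phi0 u \<otimes> b, d)"
  by (simp add: phi_def tensor_lift_tens[OF phi_aux])

theorem phi_generators:
  "clinear phi"
  "phi (tau_X x (k, r) b) = gt_Y (x \<otimes> lmon k, 0) r b"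
  "phi (tau_K (k, r) (Some i) b) = 0"
  "phi (tau_K (k, r) None b) = (if k = 0 then gt_Y (0, 1) r b else 0)"
  "phi (tau_d j) = gt_d j"
proof -
  show "clinear phi"
    unfolding phi_def
    by (intro clinear_Pair clinear_snd clinear_compose[OF clinear_fst tensor_lift_linear] phi_aux)
  show "phi (tau_d j) = gt_d j"
    by (simp add: phi_def tau_d_def gt_d_def tensor_lift_0[OF phi_aux])
qed (simp_all add: tau_X_def tau_K_def gt_Y_def phi_tens phi0_generators zero_prod_def)

lemma clinear_mult:
  fixes f :: "'x::cvs \<Rightarrow> complex"
  shows "clinear f \<Longrightarrow> clinear (\<lambda>x. f x * c)" "clinear f \<Longrightarrow> clinear (\<lambda>x. c * f x)"
  by (rule clinear_compose[OF _ comm_calg_linear(1)] clinear_compose[OF _ comm_calg_linear(2)]; assumption)+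

lemma aff_quadrilinear:
  fixes form :: "'g::cvs \<Rightarrow> 'g \<Rightarrow> complex"
  assumes "cbilinear br" "cbilinear form"
  shows "cquadrilinear (\<lambda>x p y q. (br x y \<otimes> (p * q),
      form x y * lin_ext (\<lambda>k. lin_ext (\<lambda>r. if k + r = 0 then of_int k else 0) q) p))"
  unfolding cquadrilinear_def
  by (intro conjI allI clin clinear_mult lin_ext_linear_in cbilinearD[OF assms(1)] cbilinearD[OF assms(2)])

lemma aff_bracket_generators:
  assumes "cbilinear br" "cbilinear form"
  shows "aff_bracket br form (x \<otimes> lmon k, c) (y \<otimes> lmon r, c') =
      (br x y \<otimes> lmon (k + r), form x y * (if k + r = 0 then of_int k else 0))"
  by (simp add: aff_bracket_def tensor_lift2_tens[OF aff_quadrilinear[OF assms]] mult_single scaleC_one)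

lemma aff_d0_aux: "cbilinear (\<lambda>x p. x \<otimes> lin_ext (\<lambda>k. of_int k *\<^sub>C lmon k) p)"
  unfolding cbilinear_def by (intro conjI allI clin)

lemma aff_d0_linear: "clinear aff_d0"
  unfolding aff_d0_def
  by (intro clinear_Pair clinear_zero clinear_compose[OF clinear_fst tensor_lift_linear] aff_d0_aux)

lemma aff_d0_generators: "aff_d0 (x \<otimes> lmon k, c) = (of_int k *\<^sub>C (x \<otimes> lmon k), 0)"
  by (simp add: aff_d0_def tensor_lift_tens[OF aff_d0_aux] scaleC_one clinear_scale[OF tens_linear_right])

lemma aff_bracket_linear:
  assumes "cbilinear br" "cbilinear form"
  shows "clinear (\<lambda>u. aff_bracket br form u v)" "clinear (aff_bracket br form u)"
  unfolding aff_bracket_def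
  by (rule clinear_compose[OF clinear_fst tensor_lift2_linear(1)[OF aff_quadrilinear[OF assms]]]
      clinear_compose[OF clinear_fst tensor_lift2_linear(2)[OF aff_quadrilinear[OF assms]]])+

lemma gtilde_loop_aux:
  assumes "cbilinear br" "cbilinear form"
  shows "cquadrilinear (\<lambda>y (a :: 'n::finite laurent_n) y' a'. aff_bracket br form y y' \<otimes> (a * a'))"
  unfolding cquadrilinear_def by (intro conjI allI clin aff_bracket_linear[OF assms])

lemma gtilde_loop_quadrilinear:
  assumes "cbilinear br" "cbilinear form"
  shows "cquadrilinear (\<lambda>h (b :: 'b::comm_calg) h' b'. tensor_lift2
      (\<lambda>y (a :: 'n::finite laurent_n) y' a'. aff_bracket br form y y' \<otimes> (a * a')) h h' \<otimes> (b * b'))"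
  unfolding cquadrilinear_def
  by (intro conjI allI clin tensor_lift2_linear gtilde_loop_aux[OF assms])

lemma gtilde_der_aux1:
  "cbilinear (\<lambda>y a. (d $ None *\<^sub>C aff_d0 y) \<otimes> a
      + y \<otimes> lin_ext (\<lambda>r. (\<Sum>i\<in>UNIV. d $ Some i * of_int (r $ i)) *\<^sub>C lmon r) a)"
  unfolding cbilinear_def by (intro conjI allI clin aff_d0_linear)

lemma gtilde_der_aux2:
  "cbilinear (\<lambda>h b. tensor_lift (\<lambda>y a. (d $ None *\<^sub>C aff_d0 y) \<otimes> a
      + y \<otimes> lin_ext (\<lambda>r. (\<Sum>i\<in>UNIV. d $ Some i * of_int (r $ i)) *\<^sub>C lmon r) a) h \<otimes> b)"
  unfolding cbilinear_def by (intro conjI allI clin tensor_lift_linear gtilde_der_aux1)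

lemma gtilde_der_linear: "clinear (gtilde_der d)"
  unfolding gtilde_der_def by (rule tensor_lift_linear[OF gtilde_der_aux2])

lemma gtilde_der_tens:
  "gtilde_der d ((y \<otimes> lmon r) \<otimes> b) =
    d $ None *\<^sub>C ((aff_d0 y \<otimes> lmon r) \<otimes> b) + (\<Sum>i\<in>UNIV. d $ Some i * of_int (r $ i)) *\<^sub>C ((y \<otimes> lmon r) \<otimes> b)"
  unfolding gtilde_der_def tensor_lift_tens[OF gtilde_der_aux2] tensor_lift_tens[OF gtilde_der_aux1]
  by (simp add: scaleC_one clinear_add[OF tens_linear_left] clinear_scale[OF tens_linear_right]
      clinear_scale[OF tens_linear_left])

lemma gtilde_der_zero: "gtilde_der 0 t = 0"
  by (simp add: gtilde_der_def lin_ext_def tensor_lift_zero_fun)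

theorem gtilde_bracket_generators:
  assumes "cbilinear br" "cbilinear form"
  shows "gtilde_bracket br form (gt_Y y r b) (gt_Y y' r' b') = gt_Y (aff_bracket br form y y') (r + r') (b * b')"
    and "gtilde_bracket br form (gt_d None) (gt_Y y r b) = gt_Y (aff_d0 y) r b"
    and "gtilde_bracket br form (gt_d (Some i)) (gt_Y y r b) = of_int (r $ i) *\<^sub>C gt_Y y r b"
    and "gtilde_bracket br form (gt_d j) (gt_d k) = 0"
  by (simp_all add: gtilde_bracket_def gt_Y_def gt_d_def gtilde_der_zero gtilde_der_tens mult_single
      clinear_0[OF gtilde_der_linear] scaleC_one scaleC_Pair zero_prod_def
      tensor_lift2_tens[OF gtilde_loop_quadrilinear[OF assms]]
      tensor_lift2_tens[OF gtilde_loop_aux[OF assms]]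
      tensor_lift2_0[OF gtilde_loop_quadrilinear[OF assms]]
      axis_def if_distrib[of "\<lambda>x. x * _"] cong: if_cong)

text \<open>Projection of the loop part to the component of degree \<^term>\<open>r\<close>.\<close>

definition loop_comp :: "int ^ 'n \<Rightarrow> (('g::cvs aff, 'n::finite laurent_n) tensor, 'b::comm_calg) tensor
    \<Rightarrow> (('g aff, 'n laurent_n) tensor, 'b) tensor"
  where "loop_comp r = tensor_lift (\<lambda>h b.
    tensor_lift (\<lambda>y a. y \<otimes> Poly_Mapping.single r (Poly_Mapping.lookup a r)) h \<otimes> b)"

lemma loop_comp_aux1:
  "cbilinear (\<lambda>y a. y \<otimes> Poly_Mapping.single r (Poly_Mapping.lookup a r :: complex))"
proof -
  have "Poly_Mapping.single r (c * d) = c *\<^sub>C Poly_Mapping.single r d" for c d :: complex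
    by (rule poly_mapping_eqI) (simp add: lookup_scaleC lookup_single when_def scaleC_complex_def)
  then have "clinear (\<lambda>a. Poly_Mapping.single r (Poly_Mapping.lookup a r :: complex))"
    by (auto simp: clinear_iff lookup_add single_add lookup_scaleC scaleC_complex_def)
  then show ?thesis
    unfolding cbilinear_def by (intro conjI allI clin)
qed

lemma loop_comp_aux2:
  "cbilinear (\<lambda>h b. tensor_lift (\<lambda>y a. y \<otimes> Poly_Mapping.single r (Poly_Mapping.lookup a r :: complex)) h \<otimes> b)"
  unfolding cbilinear_def by (intro conjI allI clin tensor_lift_linear loop_comp_aux1)

lemma loop_comp_linear: "clinear (loop_comp r)"
  unfolding loop_comp_def by (rule tensor_lift_linear[OF loop_comp_aux2])

lemma loop_comp_tens:
  "loop_comp r ((y \<otimes> lmon s) \<otimes> b) = (if s = r then (y \<otimes> lmon s) \<otimes> b else 0)"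
  by (simp add: loop_comp_def tensor_lift_tens[OF loop_comp_aux2] tensor_lift_tens[OF loop_comp_aux1]
      lookup_single)

lemma subspace_vimage: "clinear F \<Longrightarrow> cv.subspace S \<Longrightarrow> cv.subspace {x. F x \<in> S}"
  by (auto simp: cv.subspace_def clinear_0 clinear_add clinear_scale)

lemma lin_ext_mem: "cv.subspace S \<Longrightarrow> (\<And>k. h k \<in> S) \<Longrightarrow> lin_ext h f \<in> S"
  unfolding lin_ext_def by (intro cv.subspace_sum cv.subspace_scale)

lemma laurent_mem:
  assumes "cv.subspace S" "\<And>k. lmon k \<in> S"
  shows "f \<in> S"
  by (subst poly_mapping_eq_lin_ext) (rule lin_ext_mem[OF assms])

lemma tensor_mem:
  assumes "cv.subspace S" "\<And>x y. x \<otimes> y \<in> S"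
  shows "t \<in> S"
proof -
  have "lmon k \<in> {p. abs_tensor p \<in> S}" for k
    using assms(2)[of "fst k" "snd k"] by (simp add: tens.abs_eq pair1_def)
  then have "rep_tensor t \<in> {p. abs_tensor p \<in> S}"
    by (rule laurent_mem[OF subspace_vimage[OF clinear_abs_tensor assms(1)]])
  then show ?thesis by (simp add: abs_rep_tensor)
qed

lemma loop_mem:
  assumes S: "cv.subspace S" and gen: "\<And>y s b. (y \<otimes> lmon s) \<otimes> b \<in> S"
  shows "t \<in> S"
proof (rule tensor_mem[OF S])
  fix h b
  have ya: "(y \<otimes> a) \<otimes> b \<in> S" for y a
    using laurent_mem[of "{a. (y \<otimes> a) \<otimes> b \<in> S}"] gen
      subspace_vimage[OF clinear_tens1[OF tens_linear_right] S] by auto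
  have "h \<in> {h. h \<otimes> b \<in> S}"
    by (rule tensor_mem[OF subspace_vimage[OF tens_linear_left S]]) (simp add: ya)
  then show "h \<otimes> b \<in> S" by simp
qed

lemma loop_unique:
  assumes F: "clinear F" and G: "clinear G"
    and eq: "\<And>y s b. F ((y \<otimes> lmon s) \<otimes> b) = G ((y \<otimes> lmon s) \<otimes> b)"
  shows "F t = G t"
proof -
  have "cv.subspace {t. F t = G t}"
    by (auto simp: cv.subspace_def clinear_0 clinear_add clinear_scale F G)
  then show ?thesis using loop_mem[of "{t. F t = G t}" t] eq by auto
qed

lemma loop_comp_sum:
  fixes t :: "(('g::cvs aff, 'n::finite laurent_n) tensor, 'b::comm_calg) tensor"
  shows "\<exists>R0. finite R0 \<and> (\<forall>R. finite R \<longrightarrow> R0 \<subseteq> R \<longrightarrow> t = (\<Sum>r\<in>R. loop_comp r t))"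
proof -
  let ?S = "{t :: (('g aff, 'n laurent_n) tensor, 'b) tensor. \<exists>R0. finite R0 \<and> (\<forall>R. finite R \<longrightarrow> R0 \<subseteq> R \<longrightarrow> t = (\<Sum>r\<in>R. loop_comp r t))}"
  have "cv.subspace ?S"
  proof (rule cv.subspaceI)
    show "0 \<in> ?S" by (auto simp: clinear_0[OF loop_comp_linear])
  next
    fix s t :: "(('g aff, 'n laurent_n) tensor, 'b) tensor" assume "s \<in> ?S" "t \<in> ?S"
    then obtain R S where R: "finite R" "\<And>Q. finite Q \<Longrightarrow> R \<subseteq> Q \<Longrightarrow> s = (\<Sum>r\<in>Q. loop_comp r s)"
      and S: "finite S" "\<And>Q. finite Q \<Longrightarrow> S \<subseteq> Q \<Longrightarrow> t = (\<Sum>r\<in>Q. loop_comp r t)"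
      by auto
    have "s + t = (\<Sum>r\<in>Q. loop_comp r (s + t))" if "finite Q" "R \<union> S \<subseteq> Q" for Q
      using R(2)[of Q] S(2)[of Q] that by (simp add: clinear_add[OF loop_comp_linear] sum.distrib)
    then show "s + t \<in> ?S" using R(1) S(1) by (auto intro!: exI[of _ "R \<union> S"])
  next
    fix c and t :: "(('g aff, 'n laurent_n) tensor, 'b) tensor" assume "t \<in> ?S"
    then obtain S where S: "finite S" "\<And>Q. finite Q \<Longrightarrow> S \<subseteq> Q \<Longrightarrow> t = (\<Sum>r\<in>Q. loop_comp r t)"
      by auto
    have "c *\<^sub>C t = (\<Sum>r\<in>Q. loop_comp r (c *\<^sub>C t))" if "finite Q" "S \<subseteq> Q" for Q
      using S(2)[OF that] by (simp add: clinear_scale[OF loop_comp_linear] cv.scale_sum_right[symmetric])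
    then show "c *\<^sub>C t \<in> ?S" using S(1) by auto
  qed
  moreover have "(y \<otimes> lmon s) \<otimes> b \<in> ?S" for y s b
    by (auto simp: loop_comp_tens intro!: exI[of _ "{s}"])
  ultimately show ?thesis using loop_mem[of ?S t] by auto
qed

lemma G_deg_cases:
  assumes "cbilinear br" "cbilinear form" and X: "X \<in> G_deg br form r"
  shows "fst X = loop_comp r (fst X)" "snd X = snd X $ None *\<^sub>C axis None 1" "r \<noteq> 0 \<Longrightarrow> snd X = 0"
proof -
  obtain Y d where XY: "X = (Y, d)" by (cases X)
  have d: "d $ Some i = 0" for i using X by (simp add: XY G_deg_def G_sub_def)
  show "snd X = snd X $ None *\<^sub>C axis None 1"
    using d by (simp add: XY vec_eq_iff scaleC_vec_def axis_def split_option_all scaleC_complex_def)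
  have "gtilde_bracket br form (0, axis (Some i) 1) (Y, d) = of_int (r $ i) *\<^sub>C (Y, d)" for i
    using X by (simp add: XY G_deg_def gt_d_def)
  then have der: "gtilde_der (axis (Some i) 1) Y = of_int (r $ i) *\<^sub>C Y"
    and rd: "0 = of_int (r $ i) *\<^sub>C d" for i
    by (auto simp: gtilde_bracket_def tensor_lift2_0[OF gtilde_loop_quadrilinear[OF assms(1,2)]]
        clinear_0[OF gtilde_der_linear] scaleC_Pair)
  show "snd X = 0" if "r \<noteq> 0"
    using that rd by (auto simp: XY vec_eq_iff scaleC_vec_def scaleC_complex_def)
  have comp_der: "loop_comp s (gtilde_der (axis (Some i) 1) Y) = of_int (s $ i) *\<^sub>C loop_comp s Y" for s i
    by (rule loop_unique[OF clinear_compose[OF gtilde_der_linear loop_comp_linear] clinear_scaled[OF loop_comp_linear]])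
      (simp add: gtilde_der_tens clinear_add[OF loop_comp_linear] clinear_scale[OF loop_comp_linear]
        clinear_0[OF loop_comp_linear] loop_comp_tens axis_def if_distrib[of "\<lambda>x. x * _"] cong: if_cong)
  have "loop_comp s Y = 0" if "s \<noteq> r" for s
  proof -
    from that obtain i where i: "s $ i \<noteq> r $ i" by (auto simp: vec_eq_iff)
    have "of_int (s $ i) *\<^sub>C loop_comp s Y = of_int (r $ i) *\<^sub>C loop_comp s Y"
      unfolding comp_der[symmetric] der by (rule clinear_scale[OF loop_comp_linear])
    then have "(of_int (s $ i) - of_int (r $ i)) *\<^sub>C loop_comp s Y = 0"
      by (simp add: cv.scale_left_diff_distrib)
    moreover have "(of_int (s $ i) - of_int (r $ i) :: complex) \<noteq> 0" using i by simp
    ultimately show ?thesis using cv.scale_eq_0_iff by blast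
  qed
  moreover obtain R where "finite R" "\<And>Q. finite Q \<Longrightarrow> R \<subseteq> Q \<Longrightarrow> Y = (\<Sum>r\<in>Q. loop_comp r Y)"
    using loop_comp_sum[of Y] by auto
  then have "Y = (\<Sum>s\<in>insert r R. loop_comp s Y)" by blast
  ultimately show "fst X = loop_comp r (fst X)"
    using \<open>finite R\<close> by (simp add: XY sum.insert_remove)
qed

context
  fixes act :: "('g::cvs, 'n::finite, 'b::comm_calg) gtilde \<Rightarrow> 'w::cvs \<Rightarrow> 'w"
  assumes act_add: "\<And>X Y u. X \<in> G_sub \<Longrightarrow> Y \<in> G_sub \<Longrightarrow> act (X + Y) u = act X u + act Y u"
    and act_scale: "\<And>X c u. X \<in> G_sub \<Longrightarrow> act (c *\<^sub>C X) u = c *\<^sub>C act X u"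
    and act_linear: "\<And>X. X \<in> G_sub \<Longrightarrow> clinear (act X)"
begin

lemma gt_in_G_sub: "(Y, 0) \<in> G_sub" "gt_Y y r b \<in> G_sub" "gt_d None \<in> G_sub"
  by (simp_all add: G_sub_def gt_Y_def gt_d_def axis_def)

lemma act_loop_linear: "clinear (\<lambda>Y. act (Y, 0) u)"
  using act_add[OF gt_in_G_sub(1) gt_in_G_sub(1)] act_scale[OF gt_in_G_sub(1)]
  by (auto simp: clinear_iff scaleC_Pair)

lemma act_Y_linear: "clinear (\<lambda>y. act (gt_Y y r b) u)" "clinear (\<lambda>b. act (gt_Y y r b) u)"
  unfolding gt_Y_def
  by (rule clinear_compose[OF clinear_tens1[OF tens_linear_left] act_loop_linear]
      clinear_compose[OF tens_linear_right act_loop_linear])+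

lemma rho_aux1:
  "cbilinear (\<lambda>y. lin_ext (\<lambda>r. act (gt_Y y r b) u \<otimes> (lmon r * p)))"
  unfolding cbilinear_def by (intro conjI allI lin_ext_linear lin_ext_linear_in clinear_tens1 act_Y_linear)

lemma rho_aux2:
  "cbilinear (\<lambda>h b. tensor_lift (\<lambda>y. lin_ext (\<lambda>r. act (gt_Y y r b) u \<otimes> (lmon r * p))) h)"
  unfolding cbilinear_def
  by (intro conjI allI tensor_lift_linear rho_aux1 tensor_lift_linear_in lin_ext_linear_in
      clinear_tens1 act_Y_linear)

lemma rho_aux3:
  "cbilinear (\<lambda>u p.
      tensor_lift (\<lambda>h b. tensor_lift (\<lambda>y.
        lin_ext (\<lambda>r. act (gt_Y y r b) u \<otimes> (lmon r * p))) h) Y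
      + c *\<^sub>C (act (gt_d None) u \<otimes> p)
      + u \<otimes> lin_ext (\<lambda>s. (\<Sum>i\<in>UNIV. d i * (\<alpha> i + of_int (s $ i))) *\<^sub>C lmon s) p)"
  unfolding cbilinear_def
  by (intro conjI allI clin tensor_lift_linear_in lin_ext_linear_in act_linear gt_in_G_sub)

lemma rho_tens:
  "rho act \<alpha> X (u \<otimes> lmon s) =
    tensor_lift (\<lambda>h b. tensor_lift (\<lambda>y.
        lin_ext (\<lambda>r. act (gt_Y y r b) u \<otimes> (lmon r * lmon s))) h) (fst X)
      + snd X $ None *\<^sub>C (act (gt_d None) u \<otimes> lmon s)
      + (\<Sum>i\<in>UNIV. snd X $ Some i * (\<alpha> i + of_int (s $ i))) *\<^sub>C (u \<otimes> lmon s)"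
  by (simp add: rho_def tensor_lift_tens[OF rho_aux3] scaleC_one clinear_scale[OF tens_linear_right])

theorem rho_G_deg:
  assumes "cbilinear br" "cbilinear form" and X: "X \<in> G_deg br form r"
  shows "rho act \<alpha> X (u \<otimes> lmon s) = act X u \<otimes> lmon (r + s)"
proof -
  let ?L = "tensor_lift (\<lambda>h b. tensor_lift (\<lambda>y.
        lin_ext (\<lambda>r. act (gt_Y y r b) u \<otimes> (lmon r * lmon s))) h)"
  let ?c = "snd X $ None"
  note cases = G_deg_cases[OF assms]
  have L1: "?L ((y \<otimes> lmon r) \<otimes> b) = act ((y \<otimes> lmon r) \<otimes> b, 0) u \<otimes> lmon (r + s)" for y b
    unfolding tensor_lift_tens[OF rho_aux2] tensor_lift_tens[OF rho_aux1]
    by (simp add: mult_single gt_Y_def scaleC_one)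
  have L0: "?L 0 = 0"
    by (rule tensor_lift_0[OF rho_aux2])
  have L: "?L (loop_comp r Y) = act (loop_comp r Y, 0) u \<otimes> lmon (r + s)" for Y
  proof (rule loop_unique[OF clinear_compose[OF loop_comp_linear tensor_lift_linear[OF rho_aux2]]
          clinear_tens1[OF clinear_compose[OF loop_comp_linear act_loop_linear]]])
    fix y q b
    show "?L (loop_comp r ((y \<otimes> lmon q) \<otimes> b)) = act (loop_comp r ((y \<otimes> lmon q) \<otimes> b), 0) u \<otimes> lmon (r + s)"
      by (cases "q = r") (simp_all only: loop_comp_tens L1 L0 clinear_0[OF act_loop_linear] tens_0 if_True if_False simp_thms)
  qed
  have "X = (fst X, 0) + ?c *\<^sub>C gt_d None"
    using cases(2) by (simp add: gt_d_def scaleC_Pair prod_eq_iff)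
  moreover have "act ((fst X, 0) + ?c *\<^sub>C gt_d None) u = act (fst X, 0) u + ?c *\<^sub>C act (gt_d None) u"
    using act_add[of "(fst X, 0)" "?c *\<^sub>C gt_d None"] act_scale[OF gt_in_G_sub(3), of ?c]
    by (simp add: G_sub_def gt_d_def scaleC_Pair scaleC_vec_def axis_def)
  ultimately have "act X u = act (fst X, 0) u + ?c *\<^sub>C act (gt_d None) u" by metis
  moreover have "?L (fst X) = act (fst X, 0) u \<otimes> lmon (r + s)"
    using L[of "fst X"] cases(1) by simp
  moreover have "?c *\<^sub>C (act (gt_d None) u \<otimes> lmon s) = (?c *\<^sub>C act (gt_d None) u) \<otimes> lmon (r + s)"
    using cases(3) by (cases "r = 0") (simp_all add: clinear_scale[OF tens_linear_left])
  moreover have "snd X $ Some i = 0" for i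
    using X by (simp add: G_deg_def G_sub_def)
  ultimately show ?thesis
    by (simp add: rho_tens clinear_add[OF tens_linear_left])
qed

theorem rho_d: "rho act \<alpha> (gt_d (Some i)) (u \<otimes> lmon s) = (\<alpha> i + of_int (s $ i)) *\<^sub>C (u \<otimes> lmon s)"
proof -
  have "(\<Sum>j\<in>UNIV. axis (Some i) 1 $ Some j * (\<alpha> j + of_int (s $ j)))
      = (\<Sum>j\<in>UNIV. if j = i then \<alpha> j + of_int (s $ j) else 0)"
    by (rule sum.cong) (simp_all add: axis_def)
  also have "\<dots> = \<alpha> i + of_int (s $ i)" by simp
  finally have *: "(\<Sum>j\<in>UNIV. axis (Some i) 1 $ Some j * (\<alpha> j + of_int (s $ j))) = \<alpha> i + of_int (s $ i)" .
  have "axis (Some i) (1 :: complex) $ None = 0" by (simp add: axis_def)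
  then show ?thesis
    unfolding rho_tens gt_d_def fst_conv snd_conv tensor_lift_0[OF rho_aux2] * by simp
qed

end

end

theory Submission
  imports Defs "HOL-Computational_Algebra.Fundamental_Theorem_Algebra"
begin

text \<open>Why the theorem holds.  The module \<open>V\<close> is graded by \<open>\<int>\<^sup>n\<close>: it is generated by \<open>v\<close>, so it is
  the sum of the joint eigenspaces \<open>V\<^sub>r\<close> of \<open>d\<^sub>1, \<dots>, d\<^sub>n\<close> with eigenvalues \<open>\<alpha>\<^sub>i + r\<^sub>i\<close>.  For every
  \<open>s\<close> the map \<open>V \<rightarrow> V' \<otimes> A\<^sub>n\<close> sending \<open>u \<in> V\<^sub>r\<close> to \<open>\<pi> u \<otimes> t\<^bsup>r+s\<^esup>\<close>, where \<open>V' = V / W\<close>, commutes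
  with \<open>G\<close>, and with the \<open>d\<^sub>i\<close> up to the shift \<open>s\<^sub>i\<close>.  Preimages of submodules are therefore
  submodules of the irreducible module \<open>V\<close>, so the image of this map is an irreducible submodule
  and equals the orbit of \<open>\<pi> v \<otimes> t\<^sup>s\<close>.  For \<open>s = 0\<close> the map is a homomorphism, which gives the
  isomorphism of \<open>V\<close> with the orbit of \<open>\<pi> v \<otimes> 1\<close>.

  The loop module is the sum of these irreducible submodules, so it is the direct sum of some of
  them.  To choose the exponents in the box, one needs that exponents congruent modulo
  \<open>(l\<^sub>1, \<dots>, l\<^sub>n)\<close> have the same orbit.  This follows from \<open>\<pi> (z\<^sub>i u) = c \<pi> u\<close> with \<open>c \<noteq> 0\<close>
  (\<open>central_operator_scalar\<close>), since then the \<open>s\<close>-th map composed with the bijection \<open>z\<^sub>i\<close> is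
  \<open>c\<close> times the \<open>(s + l\<^sub>i e\<^sub>i)\<close>-th map.

  That \<open>z\<^sub>i\<close> acts on \<open>V'\<close> by a scalar is the heart of the proof; it is not formal, because \<open>z\<^sub>i\<close>
  need not preserve a maximal \<open>G\<close>-submodule of an arbitrary graded module.  It suffices that
  \<open>\<pi> (z\<^sub>i v)\<close> is a multiple of \<open>\<pi> v\<close>.  Both lie in the top space of \<open>V'\<close>, the eigenspace of \<open>\<pi> v\<close>
  for the operator \<open>\<delta>\<close> below, and that space is a line (\<open>top_space_one_dimensional\<close>): by the
  triangular decomposition it is generated over any of its nonzero vectors by the degree zero part
  of \<open>G\<close>, whose generators commute as operators on \<open>V'\<close> and, the top space being finite
  dimensional, have eigenvectors in it.

  The triangular decomposition itself comes from a single operator \<open>\<delta> = N d\<^sub>0 + \<rho>\<close>, where \<open>\<rho>\<close> is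
  the element of the Cartan subalgebra on which all simple roots take the value 1, and \<open>N\<close>
  exceeds the heights of all roots.  Semisimplicity of the Cartan subalgebra is read off from
  \<open>V\<close>: the finite dimensional algebra acts faithfully because \<open>K\<^sub>0\<close> acts nontrivially, and the
  Cartan subalgebra acts diagonally on \<open>V\<close>, so it is abelian and acts diagonalizably on the
  algebra; this yields the root space decomposition.\<close>

section \<open>Eigenvectors of a linear operator\<close>

text \<open>The product \<open>(T - b\<^sub>1) \<cdots> (T - b\<^sub>k)\<close>.  Vectors killed by such products take the place of a
  primary decomposition, which the infinite dimensional modules below do not have.\<close>

definition shift_prod :: "('a::cvs \<Rightarrow> 'a) \<Rightarrow> complex list \<Rightarrow> 'a \<Rightarrow> 'a"
  where "shift_prod T bs = foldr (\<lambda>b x. T x - b *\<^sub>C x) bs"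

lemma shift_prod_Nil [simp]: "shift_prod T [] x = x"
  and shift_prod_Cons [simp]: "shift_prod T (b # bs) x = T (shift_prod T bs x) - b *\<^sub>C shift_prod T bs x"
  by (simp_all add: shift_prod_def)

lemma shift_prod_append: "shift_prod T (bs @ cs) x = shift_prod T bs (shift_prod T cs x)"
  by (simp add: shift_prod_def)

lemma shift_prod_linear:
  assumes "clinear T" shows "clinear (shift_prod T bs)"
proof (induction bs)
  case Nil
  show ?case by (simp add: shift_prod_def clinear_iff id_def)
next
  case (Cons b bs)
  have "clinear (\<lambda>x. T (shift_prod T bs x) - b *\<^sub>C shift_prod T bs x)"
    by (rule clinear_minus[OF clinear_compose[OF Cons assms] clinear_scaled[OF Cons]])
  then show ?case by (simp add: shift_prod_def)
qed

lemma shift_prod_commute: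
  assumes "clinear T" shows "shift_prod T bs (T x) = T (shift_prod T bs x)"
  by (induction bs)
    (simp_all add: clinear_diff[OF assms] clinear_scale[OF assms])

lemma shift_prod_commute_shift:
  assumes "clinear T"
  shows "shift_prod T bs (T x - a *\<^sub>C x) = T (shift_prod T bs x) - a *\<^sub>C shift_prod T bs x"
  by (simp add: clinear_diff[OF shift_prod_linear[OF assms]] clinear_scale[OF shift_prod_linear[OF assms]]
      shift_prod_commute[OF assms])

lemma shift_prod_swap:
  assumes "clinear T"
  shows "shift_prod T bs (shift_prod T cs x) = shift_prod T cs (shift_prod T bs x)"
  by (induction bs) (simp_all add: shift_prod_commute_shift[OF assms])

lemma shift_prod_eigenvector_eq_0:
  assumes T: "clinear T" and y: "T y = a *\<^sub>C y" and a: "a \<notin> set bs" and 0: "shift_prod T bs y = 0"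
  shows "y = 0"
proof -
  have "shift_prod T bs y = (\<Prod>b\<leftarrow>bs. a - b) *\<^sub>C y"
    by (induction bs)
      (simp_all add: scaleC_one clinear_scale[OF T] y algebra_simps cv.scale_left_diff_distrib)
  moreover have "(\<Prod>b\<leftarrow>bs. a - b) \<noteq> 0"
    using a by (induction bs) auto
  ultimately show ?thesis using 0 by simp
qed

text \<open>A sum of eigenvectors is the part with eigenvalue \<open>a\<close> plus a remainder that is killed by
  factors \<open>T - b\<close> with \<open>b \<noteq> a\<close> only.  As such factors are injective on the eigenspace of \<open>a\<close>,
  this separates eigenvalues without a finite dimensional ambient space.\<close>

lemma span_eigenvectors_split:
  assumes T: "clinear T" and eig: "\<And>s. s \<in> S \<Longrightarrow> \<exists>b. T s = b *\<^sub>C s" and x: "x \<in> cv.span S"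
  shows "\<exists>xa bs. xa \<in> cv.span {s \<in> S. T s = a *\<^sub>C s} \<and> a \<notin> set bs \<and> shift_prod T bs (x - xa) = 0"
  using x
proof (induction rule: cv.span_induct_alt)
  case base
  then show ?case
    by (intro exI[of _ 0] exI[of _ "[]"]) (simp add: cv.span_zero)
next
  case (step c s x)
  note lin = shift_prod_linear[OF T]
  from step obtain xa bs where x: "xa \<in> cv.span {s \<in> S. T s = a *\<^sub>C s}" "a \<notin> set bs"
    "shift_prod T bs (x - xa) = 0" by blast
  obtain b where b: "T s = b *\<^sub>C s" using eig step.hyps by blast
  show ?case
  proof (cases "b = a")
    case True
    have "c *\<^sub>C s + xa \<in> cv.span {s \<in> S. T s = a *\<^sub>C s}"
      using b step.hyps True x(1) by (intro cv.span_add cv.span_scale cv.span_base[of s]) auto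
    then show ?thesis using x(2,3)
      by (intro exI[of _ "c *\<^sub>C s + xa"] exI[of _ bs]) simp
  next
    case False
    have "shift_prod T (b # bs) s = 0"
      using shift_prod_swap[OF T, of "[b]" bs s] by (simp add: b clinear_0[OF lin])
    moreover have "shift_prod T (b # bs) (x - xa) = 0"
      using x(3) by (simp add: clinear_0[OF T])
    moreover have "c *\<^sub>C s + x - xa = c *\<^sub>C s + (x - xa)" by simp
    ultimately have "shift_prod T (b # bs) (c *\<^sub>C s + x - xa) = 0"
      by (simp only: clinear_add[OF lin] clinear_scale[OF lin]) simp
    then show ?thesis using x(1,2) False
      by (intro exI[of _ xa] exI[of _ "b # bs"]) auto
  qed
qed

lemma eigenvector_in_span:
  assumes T: "clinear T" and eig: "\<And>s. s \<in> S \<Longrightarrow> \<exists>b. T s = b *\<^sub>C s"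
    and x: "x \<in> cv.span S" and a: "T x = a *\<^sub>C x"
  shows "x \<in> cv.span {s \<in> S. T s = a *\<^sub>C s}"
proof -
  obtain xa bs where xa: "xa \<in> cv.span {s \<in> S. T s = a *\<^sub>C s}" "a \<notin> set bs"
    "shift_prod T bs (x - xa) = 0"
    using span_eigenvectors_split[OF T eig x] by blast
  have "cv.subspace {x. T x = a *\<^sub>C x}"
    by (rule cv.subspaceI) (simp_all add: clinear_0[OF T] clinear_add[OF T] clinear_scale[OF T]
        scaleC_add_right cv.scale_left_commute mult.commute)
  then have "cv.span {s \<in> S. T s = a *\<^sub>C s} \<subseteq> {x. T x = a *\<^sub>C x}"
    by (rule cv.span_minimal[rotated]) auto
  then have "T xa = a *\<^sub>C xa" using xa(1) by auto
  then have "T (x - xa) = a *\<^sub>C (x - xa)"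
    by (simp add: clinear_diff[OF T] a cv.scale_right_diff_distrib)
  from shift_prod_eigenvector_eq_0[OF T this xa(2,3)] show ?thesis using xa(1) by simp
qed

text \<open>The part of \<open>x\<close> with eigenvalue \<open>a\<close> does not contribute to \<open>y\<close>, so \<open>y\<close> is killed by factors
  \<open>T - b\<close> with \<open>b \<noteq> a\<close>; these are injective on the eigenspace of \<open>a\<close>.  In short, \<open>(T - a)\<^sup>2\<close> and
  \<open>T - a\<close> have the same kernel on a sum of eigenvectors.\<close>

lemma diagonalizable_imp_semisimple:
  assumes T: "clinear T" and eig: "\<And>s. s \<in> S \<Longrightarrow> \<exists>b. T s = b *\<^sub>C s"
    and x: "x \<in> cv.span S" and y: "y = T x - a *\<^sub>C x" and a: "T y = a *\<^sub>C y"
  shows "y = 0"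
proof -
  obtain xa bs where xa: "xa \<in> cv.span {s \<in> S. T s = a *\<^sub>C s}" "a \<notin> set bs"
    "shift_prod T bs (x - xa) = 0"
    using span_eigenvectors_split[OF T eig x] by blast
  have "cv.subspace {x. T x = a *\<^sub>C x}"
    by (rule cv.subspaceI) (simp_all add: clinear_0[OF T] clinear_add[OF T] clinear_scale[OF T]
        scaleC_add_right cv.scale_left_commute mult.commute)
  then have "cv.span {s \<in> S. T s = a *\<^sub>C s} \<subseteq> {x. T x = a *\<^sub>C x}"
    by (rule cv.span_minimal[rotated]) auto
  then have "T xa = a *\<^sub>C xa" using xa(1) by auto
  then have "y = T (x - xa) - a *\<^sub>C (x - xa)"
    by (simp add: y clinear_diff[OF T] cv.scale_right_diff_distrib)
  then have "shift_prod T bs y = 0"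
    by (simp add: shift_prod_commute_shift[OF T] xa(3) clinear_0[OF T])
  from shift_prod_eigenvector_eq_0[OF T a xa(2) this] show ?thesis .
qed

definition poly_op :: "('a::cvs \<Rightarrow> 'a) \<Rightarrow> complex poly \<Rightarrow> 'a \<Rightarrow> 'a"
  where "poly_op T p x = (\<Sum>i\<le>degree p. poly.coeff p i *\<^sub>C (T ^^ i) x)"

lemma poly_op_bound:
  assumes "degree p \<le> n"
  shows "poly_op T p x = (\<Sum>i\<le>n. poly.coeff p i *\<^sub>C (T ^^ i) x)"
  unfolding poly_op_def
  by (rule sum.mono_neutral_left) (use assms in \<open>auto simp: coeff_eq_0\<close>)

lemma poly_op_linear_factor:
  assumes T: "clinear T"
  shows "poly_op T ([:-a, 1:] * p) x = T (poly_op T p x) - a *\<^sub>C poly_op T p x"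
proof -
  let ?n = "Suc (degree p)"
  let ?q = "[:-a, 1:] * p"
  have q: "?q = pCons 0 p - smult a p" by simp
  have "degree ?q \<le> ?n"
    by (rule order_trans[OF degree_mult_le]) simp
  then have "poly_op T ?q x = (\<Sum>i\<le>?n. poly.coeff ?q i *\<^sub>C (T ^^ i) x)" by (rule poly_op_bound)
  also have "\<dots> = (\<Sum>i\<le>?n. poly.coeff (pCons 0 p) i *\<^sub>C (T ^^ i) x) - a *\<^sub>C (\<Sum>i\<le>?n. poly.coeff p i *\<^sub>C (T ^^ i) x)"
    by (simp add: q cv.scale_left_diff_distrib sum_subtractf cv.scale_sum_right cv.scale_right_distrib del: sum.atMost_Suc mult_pCons_left)
  also have "(\<Sum>i\<le>?n. poly.coeff p i *\<^sub>C (T ^^ i) x) = poly_op T p x"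
    by (rule poly_op_bound[symmetric]) simp
  also have "(\<Sum>i\<le>?n. poly.coeff (pCons 0 p) i *\<^sub>C (T ^^ i) x) = (\<Sum>i\<le>degree p. poly.coeff p i *\<^sub>C T ((T ^^ i) x))"
    by (subst sum.atMost_Suc_shift) simp
  also have "\<dots> = T (poly_op T p x)"
    by (simp add: poly_op_def clinear_sum[OF T] clinear_scale[OF T])
  finally show ?thesis .
qed

lemma poly_op_factored:
  assumes T: "clinear T"
  shows "poly_op T (smult c (\<Prod>b\<leftarrow>bs. [:-b, 1:])) x = c *\<^sub>C shift_prod T bs x"
proof -
  have 1: "poly_op T (\<Prod>b\<leftarrow>bs. [:-b, 1:]) x = shift_prod T bs x"
  proof (induction bs)
    case Nil
    show ?case by (simp add: poly_op_def scaleC_one)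
  next
    case (Cons b bs)
    show ?case
      by (simp only: list.map prod_list.Cons poly_op_linear_factor[OF T] Cons shift_prod_Cons)
  qed
  have "poly_op T (smult c p) x = c *\<^sub>C poly_op T p x" for p
    by (subst poly_op_bound[of _ "degree p"]) (simp_all add: degree_smult_le poly_op_def cv.scale_sum_right)
  then show ?thesis by (simp add: 1)
qed

text \<open>A linear relation among the iterates of \<open>x\<close> is a polynomial in \<open>T\<close> killing \<open>x\<close>, and it splits
  into linear factors.\<close>

lemma fin_dim_shift_prod_eq_0:
  assumes T: "clinear T" and M: "fin_dim M" and orb: "\<And>i. (T ^^ i) x \<in> M"
  shows "\<exists>bs. shift_prod T bs x = 0"
proof -
  obtain B where B: "finite B" "M \<subseteq> cv.span B" using M by (auto simp: fin_dim_def)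
  let ?n = "card B"
  have "\<exists>c. (\<exists>i\<le>?n. c i \<noteq> 0) \<and> (\<Sum>i\<le>?n. c i *\<^sub>C (T ^^ i) x) = 0"
  proof (rule ccontr)
    assume "\<not> ?thesis"
    then have indep: "\<And>c i. (\<Sum>i\<le>?n. c i *\<^sub>C (T ^^ i) x) = 0 \<Longrightarrow> i \<le> ?n \<Longrightarrow> c i = 0" by blast
    let ?f = "\<lambda>i. (T ^^ i) x"
    have inj: "inj_on ?f {..?n}"
    proof (rule inj_onI, rule ccontr)
      fix i j assume ij: "i \<in> {..?n}" "j \<in> {..?n}" "?f i = ?f j" "i \<noteq> j"
      let ?c = "\<lambda>k. if k = i then 1 else if k = j then -1 else (0::complex)"
      have "(\<Sum>k\<le>?n. ?c k *\<^sub>C ?f k) = (\<Sum>k\<in>{i, j}. ?c k *\<^sub>C ?f k)"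
        by (rule sum.mono_neutral_right) (use ij in auto)
      also have "\<dots> = 0" using ij by (simp add: scaleC_one)
      finally show False using indep[of ?c i] ij by simp
    qed
    have "cv.independent (?f ` {..?n})"
    proof (rule cv.independent_if_scalars_zero)
      fix g y assume g: "(\<Sum>y\<in>?f ` {..?n}. g y *\<^sub>C y) = 0" and y: "y \<in> ?f ` {..?n}"
      then show "g y = 0" using indep[of "\<lambda>i. g (?f i)"] by (auto simp: sum.reindex[OF inj])
    qed simp
    then have "card (?f ` {..?n}) \<le> ?n"
      using cv.independent_span_bound[OF B(1)] orb B(2) by blast
    then show False by (simp add: card_image[OF inj])
  qed
  then obtain c i where c: "i \<le> ?n" "c i \<noteq> 0" "(\<Sum>i\<le>?n. c i *\<^sub>C (T ^^ i) x) = 0" by blast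
  define p where "p = (\<Sum>i\<le>?n. Polynomial.monom (c i) i)"
  have coeff: "poly.coeff p i = (if i \<le> ?n then c i else 0)" for i
    by (simp add: p_def coeff_sum)
  have "degree p \<le> ?n" by (rule degree_le) (simp add: coeff)
  then have p0: "poly_op T p x = 0" using c(3) by (simp add: poly_op_bound coeff)
  have "p \<noteq> 0" using c coeff[of i] by auto
  obtain A where A: "p = smult (lead_coeff p) (\<Prod>b\<in>#A. [:-b, 1:])"
    using alg_closed_imp_factorization[OF \<open>p \<noteq> 0\<close>] by blast
  obtain bs where bs: "A = mset bs" by (metis ex_mset)
  have "p = smult (lead_coeff p) (\<Prod>b\<leftarrow>bs. [:-b, 1:])"
    using A by (simp add: bs flip: prod_mset_prod_list)
  then have "lead_coeff p *\<^sub>C shift_prod T bs x = 0"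
    using poly_op_factored[OF T, of "lead_coeff p" bs x] p0 by simp
  then show ?thesis using \<open>p \<noteq> 0\<close> by auto
qed

text \<open>The last nonzero vector among the partial products \<open>(T - b\<^sub>i) \<cdots> (T - b\<^sub>k) x\<close> is an eigenvector.\<close>

lemma fin_dim_eigenvector:
  assumes T: "clinear T" and S: "cv.subspace S" "fin_dim S" and inv: "\<And>x. x \<in> S \<Longrightarrow> T x \<in> S"
    and x: "x \<in> S" "x \<noteq> 0"
  shows "\<exists>a e. e \<in> S \<and> e \<noteq> 0 \<and> T e = a *\<^sub>C e"
proof -
  have "(T ^^ i) x \<in> S" for i by (induction i) (auto intro: inv x(1))
  then obtain bs where bs: "shift_prod T bs x = 0"
    using fin_dim_shift_prod_eq_0[OF T S(2)] by blast
  then show ?thesis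
  proof (induction bs)
    case Nil
    with x(2) show ?case by simp
  next
    case (Cons b bs)
    have in_S: "shift_prod T bs x \<in> S"
      by (induction bs) (auto intro: inv x(1) cv.subspace_diff[OF S(1)] cv.subspace_scale[OF S(1)])
    show ?case
    proof (cases "shift_prod T bs x = 0")
      case False
      then show ?thesis using Cons.prems in_S by auto
    qed (rule Cons.IH)
  qed
qed

text \<open>Induction on the factors: if \<open>(T - a) x\<close> is a sum of eigenvectors, those with eigenvalue
  \<open>b \<noteq> a\<close> can be divided by \<open>b - a\<close> and subtracted from \<open>x\<close>.  What remains is killed by
  \<open>(T - a)\<^sup>2\<close>, hence by \<open>T - a\<close>.\<close>

lemma semisimple_span_eigenvectors:
  assumes T: "clinear T" and M: "cv.subspace M" and inv: "\<And>x. x \<in> M \<Longrightarrow> T x \<in> M"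
    and ss: "\<And>a x. T (T x - a *\<^sub>C x) = a *\<^sub>C (T x - a *\<^sub>C x) \<Longrightarrow> T x = a *\<^sub>C x"
    and x: "x \<in> M" and 0: "shift_prod T bs x = 0"
  shows "x \<in> cv.span {s \<in> M. \<exists>a. T s = a *\<^sub>C s}"
  using x 0
proof (induction bs arbitrary: x rule: rev_induct)
  case Nil
  then show ?case by (simp add: cv.span_zero)
next
  case (snoc a bs)
  let ?E = "{s \<in> M. \<exists>a. T s = a *\<^sub>C s}"
  let ?I = "{y \<in> M. \<exists>x' \<in> cv.span ?E. T (y - (T x' - a *\<^sub>C x')) = a *\<^sub>C (y - (T x' - a *\<^sub>C x'))}"
  have y: "T x - a *\<^sub>C x \<in> cv.span ?E"
    using snoc by (intro snoc.IH cv.subspace_diff[OF M] cv.subspace_scale[OF M] inv)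
      (auto simp: shift_prod_append)
  have "\<exists>x' \<in> cv.span ?E. T (y - (T x' - a *\<^sub>C x')) = a *\<^sub>C (y - (T x' - a *\<^sub>C x'))"
    if "y \<in> cv.span ?E" for y
    using that
  proof (induction rule: cv.span_induct_alt)
    case base
    show ?case by (rule bexI[of _ 0]) (simp_all add: clinear_0[OF T] cv.span_zero)
  next
    case (step c s y)
    obtain x' where x': "x' \<in> cv.span ?E" "T (y - (T x' - a *\<^sub>C x')) = a *\<^sub>C (y - (T x' - a *\<^sub>C x'))"
      using step by blast
    obtain b where b: "T s = b *\<^sub>C s" using step by blast
    show ?case
    proof (cases "b = a")
      case True
      let ?Y = "y - (T x' - a *\<^sub>C x')"
      have "T (c *\<^sub>C s + ?Y) = a *\<^sub>C (c *\<^sub>C s + ?Y)"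
        unfolding clinear_add[OF T] clinear_scale[OF T] x'(2) b True
        by (simp add: scaleC_add_right mult.commute)
      moreover have "c *\<^sub>C s + y - (T x' - a *\<^sub>C x') = c *\<^sub>C s + ?Y" by simp
      ultimately show ?thesis using x'(1) by (intro bexI[of _ x']) (simp_all only:)
    next
      case False
      \<comment> \<open>the multiple of \<open>s\<close> that \<open>T - a\<close> maps to \<open>c s\<close>\<close>
      let ?s = "(c / (b - a)) *\<^sub>C s"
      have "T ?s - a *\<^sub>C ?s = (c / (b - a) * b - a * (c / (b - a))) *\<^sub>C s"
        by (simp only: clinear_scale[OF T] b cv.scale_scale cv.scale_left_diff_distrib)
      also have "c / (b - a) * b - a * (c / (b - a)) = c / (b - a) * (b - a)"
        by (simp only: right_diff_distrib mult.commute[of a])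
      also have "\<dots> = c" using False by simp
      finally have s: "T ?s - a *\<^sub>C ?s = c *\<^sub>C s" .
      have "c *\<^sub>C s + y - (T (?s + x') - a *\<^sub>C (?s + x'))
          = c *\<^sub>C s + y - ((T ?s - a *\<^sub>C ?s) + (T x' - a *\<^sub>C x'))"
        unfolding clinear_add[OF T] scaleC_add_right by (simp only: add_diff_add)
      also have "\<dots> = y - (T x' - a *\<^sub>C x')" unfolding s by simp
      finally have "c *\<^sub>C s + y - (T (?s + x') - a *\<^sub>C (?s + x')) = y - (T x' - a *\<^sub>C x')" .
      moreover have "?s + x' \<in> cv.span ?E"
        using x'(1) step.hyps by (intro cv.span_add cv.span_scale cv.span_base[of s]) auto
      ultimately show ?thesis using x'(2) by (intro bexI[of _ "?s + x'"]) (simp_all only:)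
    qed
  qed
  from this[OF y] obtain x' where x': "x' \<in> cv.span ?E"
    and e: "T (T x - a *\<^sub>C x - (T x' - a *\<^sub>C x')) = a *\<^sub>C (T x - a *\<^sub>C x - (T x' - a *\<^sub>C x'))" by blast
  have eq: "T x - a *\<^sub>C x - (T x' - a *\<^sub>C x') = T (x - x') - a *\<^sub>C (x - x')"
    by (simp add: clinear_diff[OF T] cv.scale_right_diff_distrib)
  from ss[OF e[unfolded eq]] have eig: "T (x - x') = a *\<^sub>C (x - x')" .
  have "x' \<in> M" using x' cv.span_minimal[OF _ M, of ?E] by auto
  then have "x - x' \<in> ?E" using eig snoc.prems cv.subspace_diff[OF M] by blast
  from cv.span_add[OF cv.span_base[OF this] x'] have "(x - x') + x' \<in> cv.span ?E" .
  then show ?case by simp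
qed

text \<open>Each joint eigenspace of some of the operators is stable under the next one, which can be
  diagonalized on it.\<close>

lemma joint_eigenvectors_span:
  fixes F :: "('a::cvs \<Rightarrow> 'a) set"
  assumes "finite F" and fd: "fin_dim (UNIV :: 'a set)"
    and lin: "\<And>T. T \<in> F \<Longrightarrow> clinear T"
    and comm: "\<And>S T x. S \<in> F \<Longrightarrow> T \<in> F \<Longrightarrow> S (T x) = T (S x)"
    and ss: "\<And>T a x. T \<in> F \<Longrightarrow> T (T x - a *\<^sub>C x) = a *\<^sub>C (T x - a *\<^sub>C x) \<Longrightarrow> T x = a *\<^sub>C x"
  shows "x \<in> cv.span {s. \<forall>T\<in>F. \<exists>a. T s = a *\<^sub>C s}"
  using assms
proof (induction F arbitrary: x rule: finite_induct)
  case empty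
  then show ?case by simp
next
  case (insert T F)
  let ?J = "\<lambda>F. {s. \<forall>T\<in>F. \<exists>a. T s = a *\<^sub>C s}"
  have T: "clinear T" using insert.prems by blast
  have "s \<in> cv.span (?J (insert T F))" if s: "s \<in> ?J F" for s
  proof -
    from s obtain a where a: "\<And>S. S \<in> F \<Longrightarrow> S s = a S *\<^sub>C s" by (auto simp: Bex_def) metis
    define M where "M = {x. \<forall>S\<in>F. S x = a S *\<^sub>C x}"
    have M: "cv.subspace M"
      unfolding M_def
      by (rule cv.subspaceI) (auto simp: clinear_0 clinear_add clinear_scale insert.prems(2)
          scaleC_add_right mult.commute)
    have inv: "T x \<in> M" if x: "x \<in> M" for x
    proof -
      have "S (T x) = a S *\<^sub>C T x" if S: "S \<in> F" for S
      proof -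
        have "S (T x) = T (S x)" using S insert.prems(3) by blast
        also have "S x = a S *\<^sub>C x" using S x by (simp add: M_def)
        finally show ?thesis by (simp add: clinear_scale[OF T])
      qed
      then show ?thesis by (simp add: M_def)
    qed
    note ssT = insert.prems(4)[of T, OF insertI1]
    obtain bs where bs: "shift_prod T bs s = 0"
      using fin_dim_shift_prod_eq_0[OF T fd] by blast
    have sM: "s \<in> M" by (simp add: M_def a)
    have "s \<in> cv.span {s \<in> M. \<exists>a. T s = a *\<^sub>C s}"
      using semisimple_span_eigenvectors[OF T M _ _ sM bs] inv ssT by blast
    moreover have "{s \<in> M. \<exists>a. T s = a *\<^sub>C s} \<subseteq> ?J (insert T F)" by (auto simp: M_def)
    ultimately show ?thesis using cv.span_mono by blast
  qed
  then have "cv.span (?J F) \<subseteq> cv.span (?J (insert T F))"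
    by (intro cv.span_minimal cv.subspace_span) auto
  moreover have "x \<in> cv.span (?J F)"
  proof (rule insert.IH[OF fd])
    show "clinear S" if "S \<in> F" for S using that insert.prems(2) by blast
    show "S (T' y) = T' (S y)" if "S \<in> F" "T' \<in> F" for S T' y
      using that insert.prems(3) by blast
    show "S y = a *\<^sub>C y" if "S \<in> F" "S (S y - a *\<^sub>C y) = a *\<^sub>C (S y - a *\<^sub>C y)" for S a y
      by (rule insert.prems(4)[OF insertI2]) (fact that)+
  qed
  ultimately show ?case by blast
qed

section \<open>The principal grading of a Lie algebra\<close>

lemma dual_spaceD:
  assumes "l \<in> dual_space S"
  shows "x \<notin> S \<Longrightarrow> l x = 0" "x \<in> S \<Longrightarrow> y \<in> S \<Longrightarrow> l (x + y) = l x + l y"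
    "x \<in> S \<Longrightarrow> l (c *\<^sub>C x) = c * l x"
  using assms by (auto simp: dual_space_def)

lemma dual_space_sum:
  assumes S: "cv.subspace S" and l: "l \<in> dual_space S" and x: "\<And>i. i \<in> I \<Longrightarrow> x i \<in> S"
  shows "l (\<Sum>i\<in>I. c i *\<^sub>C x i) = (\<Sum>i\<in>I. c i * l (x i))"
  using x
proof (induction I rule: infinite_finite_induct)
  case (insert i I)
  then have "(\<Sum>i\<in>I. c i *\<^sub>C x i) \<in> S"
    by (intro cv.subspace_sum[OF S] cv.subspace_scale[OF S]) auto
  then show ?case
    using insert by (simp add: dual_spaceD[OF l] cv.subspace_scale[OF S])
qed (use dual_spaceD(3)[OF l cv.subspace_0[OF S], of 0] in simp_all)

text \<open>For a new functional \<open>\<gamma>\<close>, the functional \<open>\<gamma> - \<Sum>\<^sub>\<beta> \<gamma>(e\<^sub>\<beta>) \<beta>\<close>, with \<open>e\<close> the dual family of the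
  earlier ones, does not vanish.  A point where it is nonzero, corrected by multiples of the
  \<open>e\<^sub>\<beta>\<close>, lies in the kernel of all earlier functionals but not of \<open>\<gamma>\<close>.\<close>

lemma independent_functionals_surj:
  assumes S: "cv.subspace S" and "finite \<Theta>" and "\<Theta> \<subseteq> dual_space S"
    and "\<And>u. \<forall>x. (\<Sum>\<beta>\<in>\<Theta>. u \<beta> * \<beta> x) = 0 \<Longrightarrow> \<forall>\<beta>\<in>\<Theta>. u \<beta> = 0"
  shows "\<exists>x\<in>S. \<forall>\<beta>\<in>\<Theta>. \<beta> x = g \<beta>"
  using assms(2-)
proof (induction \<Theta> arbitrary: g rule: finite_induct)
  case empty
  then show ?case using cv.subspace_0[OF S] by blast
next
  case (insert \<gamma> \<Theta>)
  have \<gamma>: "\<gamma> \<in> dual_space S" and \<Theta>: "\<And>\<beta>. \<beta> \<in> \<Theta> \<Longrightarrow> \<beta> \<in> dual_space S"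
    using insert.prems by auto
  have "\<forall>\<beta>\<in>\<Theta>. u \<beta> = 0" if u: "\<forall>x. (\<Sum>\<beta>\<in>\<Theta>. u \<beta> * \<beta> x) = 0" for u
  proof -
    \<comment> \<open>independence of the smaller family, by the coefficient 0 at \<open>\<gamma>\<close>\<close>
    let ?u = "u(\<gamma> := 0)"
    have "(\<Sum>\<beta>\<in>\<Theta>. ?u \<beta> * \<beta> x) = (\<Sum>\<beta>\<in>\<Theta>. u \<beta> * \<beta> x)" for x
      using insert.hyps by (intro sum.cong) auto
    then have "\<forall>x. (\<Sum>\<beta>\<in>insert \<gamma> \<Theta>. ?u \<beta> * \<beta> x) = 0"
      using u insert.hyps by simp
    from insert.prems(2)[OF this] show ?thesis using insert.hyps by (metis fun_upd_other insertCI)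
  qed
  then have IH: "\<exists>x\<in>S. \<forall>\<beta>\<in>\<Theta>. \<beta> x = g \<beta>" for g
    using insert.IH insert.prems by blast
  have "\<forall>\<beta>. \<exists>x\<in>S. \<forall>\<beta>'\<in>\<Theta>. \<beta>' x = (if \<beta>' = \<beta> then 1 else 0)"
    by (intro allI IH)
  then obtain e where e: "\<And>\<beta>. e \<beta> \<in> S"
    and e_dual: "\<And>\<beta> \<beta>'. \<beta>' \<in> \<Theta> \<Longrightarrow> \<beta>' (e \<beta>) = (if \<beta>' = \<beta> then 1 else 0)"
    by metis
  \<comment> \<open>the coefficient 1 at \<open>\<gamma>\<close> contradicts independence if the combination vanishes\<close>
  let ?u = "\<lambda>\<beta>. if \<beta> = \<gamma> then 1 else - \<gamma> (e \<beta>)"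
  have "\<not> (\<forall>x. (\<Sum>\<beta>\<in>insert \<gamma> \<Theta>. ?u \<beta> * \<beta> x) = 0)"
    using insert.prems(2)[of ?u] by auto
  then obtain x where x: "(\<Sum>\<beta>\<in>insert \<gamma> \<Theta>. ?u \<beta> * \<beta> x) \<noteq> 0" by blast
  have "(\<Sum>\<beta>\<in>\<Theta>. ?u \<beta> * \<beta> x) = - (\<Sum>\<beta>\<in>\<Theta>. \<beta> x * \<gamma> (e \<beta>))"
    unfolding sum_negf[symmetric] using insert.hyps by (intro sum.cong) auto
  then have x': "\<gamma> x - (\<Sum>\<beta>\<in>\<Theta>. \<beta> x * \<gamma> (e \<beta>)) \<noteq> 0"
    using x insert.hyps by simp
  have xS: "x \<in> S"
  proof (rule ccontr)
    assume "x \<notin> S"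
    then have "(\<Sum>\<beta>\<in>\<Theta>. \<beta> x * \<gamma> (e \<beta>)) = 0" "\<gamma> x = 0"
      by (auto intro: sum.neutral simp: dual_spaceD(1)[OF \<gamma>] dual_spaceD(1)[OF \<Theta>])
    then show False using x' by simp
  qed
  define y where "y = (\<Sum>\<beta>\<in>\<Theta>. (- \<beta> x) *\<^sub>C e \<beta>)"
  have yS: "y \<in> S" unfolding y_def by (intro cv.subspace_sum[OF S] cv.subspace_scale[OF S] e)
  have "\<beta> (x + y) = 0" if \<beta>: "\<beta> \<in> \<Theta>" for \<beta>
  proof -
    have "\<beta> y = (\<Sum>\<beta>'\<in>\<Theta>. - \<beta>' x * \<beta> (e \<beta>'))"
      unfolding y_def by (rule dual_space_sum[OF S \<Theta>[OF \<beta>] e])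
    also have "\<dots> = (\<Sum>\<beta>'\<in>\<Theta>. if \<beta>' = \<beta> then - \<beta> x else 0)"
      by (rule sum.cong) (auto simp: e_dual[OF \<beta>])
    also have "\<dots> = - \<beta> x" using \<beta> insert.hyps by simp
    finally show ?thesis by (simp add: dual_spaceD(2)[OF \<Theta>[OF \<beta>] xS yS])
  qed
  then have ker: "\<beta> (t *\<^sub>C (x + y)) = 0" if "\<beta> \<in> \<Theta>" for t \<beta>
    using that by (simp only: dual_spaceD(3)[OF \<Theta> cv.subspace_add[OF S xS yS]]) simp
  have "\<gamma> y = (\<Sum>\<beta>\<in>\<Theta>. - \<beta> x * \<gamma> (e \<beta>))"
    unfolding y_def by (rule dual_space_sum[OF S \<gamma> e])
  then have nz: "\<gamma> (x + y) \<noteq> 0"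
    using x' by (simp only: dual_spaceD(2)[OF \<gamma> xS yS]) (simp add: sum_negf)
  obtain w where w: "w \<in> S" "\<And>\<beta>. \<beta> \<in> \<Theta> \<Longrightarrow> \<beta> w = g \<beta>" using IH by blast
  define t where "t = (g \<gamma> - \<gamma> w) / \<gamma> (x + y)"
  have tS: "t *\<^sub>C (x + y) \<in> S" by (intro cv.subspace_scale[OF S] cv.subspace_add[OF S] xS yS)
  have "\<gamma> (t *\<^sub>C (x + y)) = g \<gamma> - \<gamma> w"
    using nz by (simp add: dual_spaceD(3)[OF \<gamma> cv.subspace_add[OF S xS yS]] t_def)
  then have "\<gamma> (w + t *\<^sub>C (x + y)) = g \<gamma>"
    by (simp only: dual_spaceD(2)[OF \<gamma> w(1) tS]) simp
  moreover have "\<beta> (w + t *\<^sub>C (x + y)) = g \<beta>" if "\<beta> \<in> \<Theta>" for \<beta>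
    by (simp only: dual_spaceD(2)[OF \<Theta>[OF that] w(1) tS] ker[OF that] w(2)[OF that]) simp
  moreover have "w + t *\<^sub>C (x + y) \<in> S" by (rule cv.subspace_add[OF S w(1) tS])
  ultimately have "w + t *\<^sub>C (x + y) \<in> S \<and> (\<forall>\<beta>\<in>insert \<gamma> \<Theta>. \<beta> (w + t *\<^sub>C (x + y)) = g \<beta>)"
    by simp
  then show ?case by blast
qed

lemma lie_algebraD:
  assumes "lie_algebra br"
  shows "cbilinear br" "br x x = 0" "br x y = - br y x"
    "br x (br y z) = br (br x y) z + br y (br x z)"
proof -
  show bil: "cbilinear br" and alt: "br x x = 0" for x using assms by (auto simp: lie_algebra_def)
  have anti: "br x y = - br y x" for x y
  proof -
    have "br (x + y) (x + y) = br x x + br y x + (br x y + br y y)"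
      by (simp only: clinear_add[OF cbilinearD(1)[OF bil]] clinear_add[OF cbilinearD(2)[OF bil]] ac_simps)
    then have "br y x + br x y = 0" by (simp add: alt)
    then show ?thesis by (simp add: eq_neg_iff_add_eq_0 add.commute)
  qed
  show "br x y = - br y x" by (rule anti)
  have "br x (br y z) + br y (br z x) + br z (br x y) = 0"
    using assms by (auto simp: lie_algebra_def)
  moreover have "br y (br z x) = - br y (br x z)"
    using anti[of z x] clinear_scale[OF cbilinearD(2)[OF bil, of y], of "-1" "br x z"] by simp
  moreover have "br z (br x y) = - br (br x y) z" by (rule anti)
  ultimately show "br x (br y z) = br (br x y) z + br y (br x z)"
    by (simp add: algebra_simps)
qed

text \<open>Commuting semisimple operators have joint eigenvectors spanning the algebra, and the eigenvalues
  depend linearly on the operator.  The zero eigenspace centralizes \<open>h\<close>, so it lies in \<open>h\<close>,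
  which is its own normalizer.\<close>

lemma root_space_decomposition:
  fixes br :: "'g::cvs \<Rightarrow> 'g \<Rightarrow> 'g"
  assumes lie: "lie_algebra br" and fd: "fin_dim (UNIV :: 'g set)"
    and cartan: "cartan_subalgebra br h"
    and abel: "\<And>x y. x \<in> h \<Longrightarrow> y \<in> h \<Longrightarrow> br x y = 0"
    and ss: "\<And>x a y. x \<in> h \<Longrightarrow> br x (br x y - a *\<^sub>C y) = a *\<^sub>C (br x y - a *\<^sub>C y) \<Longrightarrow> br x y = a *\<^sub>C y"
  shows "y \<in> cv.span (h \<union> (\<Union>\<alpha>\<in>roots br h. root_space br h \<alpha>))"
proof -
  note lieD = lie_algebraD[OF lie]
  note lin1 = cbilinearD(1)[OF lieD(1)] and lin2 = cbilinearD(2)[OF lieD(1)]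
  let ?U = "h \<union> (\<Union>\<alpha>\<in>roots br h. root_space br h \<alpha>)"
  obtain X where X: "X \<subseteq> h" "cv.independent X" "h \<subseteq> cv.span X"
    by (rule cv.maximal_independent_subset)
  obtain B :: "'g set" where B: "finite B" "UNIV \<subseteq> cv.span B" using fd by (auto simp: fin_dim_def)
  have "X \<subseteq> cv.span B" using B(2) by (rule order_trans[OF subset_UNIV])
  then have "finite X" using cv.independent_span_bound[OF B(1) X(2)] by simp
  have "y \<in> cv.span {s. \<forall>T\<in>br ` X. \<exists>a. T s = a *\<^sub>C s}"
  proof (rule joint_eigenvectors_span[OF _ fd])
    show "finite (br ` X)" using \<open>finite X\<close> by simp
    show "clinear T" if "T \<in> br ` X" for T using that lin2 by auto
    show "S (T x) = T (S x)" if "S \<in> br ` X" "T \<in> br ` X" for S T x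
    proof -
      from that X(1) obtain s t where st: "S = br s" "T = br t" "s \<in> h" "t \<in> h" by auto
      then show ?thesis
        using lieD(4)[of s t x] by (simp add: abel clinear_0[OF lin1])
    qed
    show "T x = a *\<^sub>C x" if "T \<in> br ` X" "T (T x - a *\<^sub>C x) = a *\<^sub>C (T x - a *\<^sub>C x)" for T a x
      using that X(1) ss by auto
  qed
  moreover have "s \<in> cv.span ?U" if s: "\<forall>T\<in>br ` X. \<exists>a. T s = a *\<^sub>C s" for s
  proof (cases "s = 0")
    case True
    then show ?thesis by (simp add: cv.span_zero)
  next
    case False
    have "cv.subspace {x. \<exists>a. br x s = a *\<^sub>C s}"
    proof (rule cv.subspaceI)
      show "0 \<in> {x. \<exists>a. br x s = a *\<^sub>C s}"
        by (auto simp: clinear_0[OF lin1] intro: exI[of _ 0])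
      show "x + y \<in> {x. \<exists>a. br x s = a *\<^sub>C s}" if "x \<in> {x. \<exists>a. br x s = a *\<^sub>C s}" "y \<in> {x. \<exists>a. br x s = a *\<^sub>C s}" for x y
        using that by (auto simp: clinear_add[OF lin1] scaleC_add_left[symmetric])
      show "c *\<^sub>C x \<in> {x. \<exists>a. br x s = a *\<^sub>C s}" if "x \<in> {x. \<exists>a. br x s = a *\<^sub>C s}" for c x
        using that by (auto simp: clinear_scale[OF lin1])
    qed
    then have "cv.span X \<subseteq> {x. \<exists>a. br x s = a *\<^sub>C s}"
      by (rule cv.span_minimal[rotated]) (use s in auto)
    then have ex: "\<exists>a. br x s = a *\<^sub>C s" if "x \<in> h" for x using X(3) that by blast
    define \<alpha> where "\<alpha> x = (if x \<in> h then SOME a. br x s = a *\<^sub>C s else 0)" for x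
    have \<alpha>: "br x s = \<alpha> x *\<^sub>C s" if "x \<in> h" for x
      unfolding \<alpha>_def using someI_ex[OF ex[OF that]] that by simp
    have h: "cv.subspace h" using cartan by (simp add: cartan_subalgebra_def)
    have "\<alpha> \<in> dual_space h"
      unfolding dual_space_def
    proof (intro CollectI conjI allI ballI impI)
      show "\<alpha> x = 0" if "x \<notin> h" for x using that by (simp add: \<alpha>_def)
      show "\<alpha> (x + y) = \<alpha> x + \<alpha> y" if "x \<in> h" "y \<in> h" for x y
      proof -
        have "\<alpha> (x + y) *\<^sub>C s = (\<alpha> x + \<alpha> y) *\<^sub>C s"
          using that cv.subspace_add[OF h] by (simp add: \<alpha>[symmetric] clinear_add[OF lin1] scaleC_add_left)
        then show ?thesis using False cv.scale_right_imp_eq by blast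
      qed
      show "\<alpha> (c *\<^sub>C x) = c * \<alpha> x" if "x \<in> h" for c x
      proof -
        have "\<alpha> (c *\<^sub>C x) *\<^sub>C s = (c * \<alpha> x) *\<^sub>C s"
          using that cv.subspace_scale[OF h] by (simp add: \<alpha>[symmetric] clinear_scale[OF lin1] scaleC_scaleC[symmetric])
        then show ?thesis using False cv.scale_right_imp_eq by blast
      qed
    qed
    moreover have "s \<in> root_space br h \<alpha>" by (simp add: root_space_def \<alpha>)
    moreover have "s \<in> h" if "\<alpha> = (\<lambda>_. 0)"
    proof -
      have "br s x = 0" if "x \<in> h" for x
        using lieD(3)[of s x] \<alpha>[OF that] by (simp add: \<open>\<alpha> = (\<lambda>_. 0)\<close>)
      then have "s \<in> {x. \<forall>y\<in>h. br x y \<in> h}" using cv.subspace_0[OF h] by auto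
      moreover have "{x. \<forall>y\<in>h. br x y \<in> h} = h" using cartan by (simp add: cartan_subalgebra_def)
      ultimately show ?thesis by simp
    qed
    ultimately have "s \<in> ?U" using False by (cases "\<alpha> = (\<lambda>_. 0)") (auto simp: roots_def)
    then show ?thesis by (rule cv.span_base)
  qed
  ultimately show ?thesis
    using cv.span_minimal[OF _ cv.subspace_span, of "{s. \<forall>T\<in>br ` X. \<exists>a. T s = a *\<^sub>C s}" ?U] by blast
qed

definition ad_eigenspace :: "('g::cvs \<Rightarrow> 'g \<Rightarrow> 'g) \<Rightarrow> 'g \<Rightarrow> int \<Rightarrow> 'g set"
  where "ad_eigenspace br \<rho> m = {x. br \<rho> x = of_int m *\<^sub>C x}"

text \<open>With \<open>\<rho>\<close> taking the value 1 on every simple root, the eigenvalue of \<open>\<rho>\<close> on a root space is the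
  height of the root: a nonzero integer, positive exactly on the positive roots.  The eigenvalues
  are bounded because finitely many root vectors and elements of \<open>h\<close> span the algebra.\<close>

lemma principal_grading:
  fixes br :: "'g::cvs \<Rightarrow> 'g \<Rightarrow> 'g"
  assumes lie: "lie_algebra br" and fd: "fin_dim (UNIV :: 'g set)"
    and cartan: "cartan_subalgebra br h" and base: "root_base br h \<Theta>"
    and abel: "\<And>x y. x \<in> h \<Longrightarrow> y \<in> h \<Longrightarrow> br x y = 0"
    and ss: "\<And>x a y. x \<in> h \<Longrightarrow> br x (br x y - a *\<^sub>C y) = a *\<^sub>C (br x y - a *\<^sub>C y) \<Longrightarrow> br x y = a *\<^sub>C y"
  shows "\<exists>\<rho>\<in>h. \<exists>N::int. ad_eigenspace br \<rho> 0 \<subseteq> h \<and>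
    cv.span (\<Union>m. ad_eigenspace br \<rho> m) = UNIV \<and>
    (\<forall>m>0. ad_eigenspace br \<rho> m \<subseteq> g_plus br h \<Theta>) \<and>
    (\<forall>m. \<forall>x\<in>ad_eigenspace br \<rho> m. x \<noteq> 0 \<longrightarrow> \<bar>m\<bar> < N)"
proof -
  note lieD = lie_algebraD[OF lie]
  note lin1 = cbilinearD(1)[OF lieD(1)] and lin2 = cbilinearD(2)[OF lieD(1)]
  have h: "cv.subspace h" using cartan by (simp add: cartan_subalgebra_def)
  have \<Theta>: "finite \<Theta>" "\<Theta> \<subseteq> roots br h"
    "\<And>u. \<forall>x. (\<Sum>\<beta>\<in>\<Theta>. u \<beta> * \<beta> x) = 0 \<Longrightarrow> \<forall>\<beta>\<in>\<Theta>. u \<beta> = 0"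
    "\<And>\<alpha>. \<alpha> \<in> roots br h \<Longrightarrow> nonneg_comb \<Theta> \<alpha> \<or> nonneg_comb \<Theta> (\<lambda>x. - \<alpha> x)"
    using base by (auto simp: root_base_def)
  have "\<Theta> \<subseteq> dual_space h" using \<Theta>(2) by (auto simp: roots_def)
  from independent_functionals_surj[OF h \<Theta>(1) this \<Theta>(3), where g = "\<lambda>_. 1"]
  obtain \<rho> where \<rho>: "\<rho> \<in> h" "\<And>\<beta>. \<beta> \<in> \<Theta> \<Longrightarrow> \<beta> \<rho> = 1" by blast
  \<comment> \<open>the height of a positive root, which is nonzero since the root is\<close>
  have height: "\<exists>m>0::int. \<alpha> \<rho> = of_int m" if c: "nonneg_comb \<Theta> \<alpha>" "\<alpha> \<noteq> (\<lambda>_. 0)" for \<alpha>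
  proof -
    obtain c :: "_ \<Rightarrow> nat" where c: "\<And>x. \<alpha> x = (\<Sum>\<beta>\<in>\<Theta>. of_nat (c \<beta>) * \<beta> x)"
      using c(1) by (auto simp: nonneg_comb_def)
    have "\<alpha> \<rho> = of_int (int (\<Sum>\<beta>\<in>\<Theta>. c \<beta>))" by (simp add: c \<rho>)
    moreover have "(\<Sum>\<beta>\<in>\<Theta>. c \<beta>) \<noteq> 0"
    proof
      assume "(\<Sum>\<beta>\<in>\<Theta>. c \<beta>) = 0"
      then have "\<alpha> = (\<lambda>_. 0)" using \<Theta>(1) by (auto simp: c)
      then show False using that(2) by simp
    qed
    ultimately show ?thesis by (intro exI[of _ "int (\<Sum>\<beta>\<in>\<Theta>. c \<beta>)"]) linarith
  qed
  let ?P = "\<Union>\<alpha>\<in>{\<alpha>\<in>roots br h. nonneg_comb \<Theta> \<alpha>}. root_space br h \<alpha>"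
  let ?Q = "\<Union>\<alpha>\<in>{\<alpha>\<in>roots br h. nonneg_comb \<Theta> (\<lambda>x. - \<alpha> x)}. root_space br h \<alpha>"
  let ?U = "h \<union> ?P \<union> ?Q"
  have P: "\<exists>m>0::int. br \<rho> x = of_int m *\<^sub>C x" if "x \<in> ?P" for x
    using that height \<rho>(1) by (fastforce simp: root_space_def roots_def)
  have Q: "\<exists>m<0::int. br \<rho> x = of_int m *\<^sub>C x" if xQ: "x \<in> ?Q" for x
  proof -
    obtain \<alpha> where \<alpha>: "\<alpha> \<in> roots br h" "nonneg_comb \<Theta> (\<lambda>x. - \<alpha> x)" "x \<in> root_space br h \<alpha>"
      using xQ by blast
    then have "(\<lambda>x. - \<alpha> x) \<noteq> (\<lambda>_. 0)" by (auto simp: roots_def fun_eq_iff)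
    from height[OF \<alpha>(2) this] obtain m :: int where m: "m > 0" "- \<alpha> \<rho> = of_int m" by blast
    then have "\<alpha> \<rho> = of_int (- m)" by (metis minus_minus of_int_minus)
    then have "br \<rho> x = of_int (- m) *\<^sub>C x" using \<alpha>(3) \<rho>(1) by (simp add: root_space_def)
    then show ?thesis using m(1) by (intro exI[of _ "- m"]) simp
  qed
  have H: "br \<rho> x = of_int 0 *\<^sub>C x" if "x \<in> h" for x using abel \<rho>(1) that by simp
  have eig_int: "\<exists>m::int. br \<rho> x = of_int m *\<^sub>C x" if "x \<in> ?U" for x
    using that H P Q by blast
  then have eig: "\<exists>a. br \<rho> x = a *\<^sub>C x" if "x \<in> ?U" for x using that by blast
  have "h \<union> (\<Union>\<alpha>\<in>roots br h. root_space br h \<alpha>) \<subseteq> ?U" using \<Theta>(4) by blast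
  then have U: "y \<in> cv.span ?U" for y
    using root_space_decomposition[OF lie fd cartan abel ss] cv.span_mono by blast
  have eq: "of_int m = (of_int k :: complex)" if "br \<rho> x = of_int m *\<^sub>C x" "br \<rho> x = of_int k *\<^sub>C x" "x \<noteq> 0" for x m k
    using that cv.scale_right_imp_eq by metis
  have part: "ad_eigenspace br \<rho> m \<subseteq> cv.span {s \<in> S. br \<rho> s = of_int m *\<^sub>C s}"
    if "\<And>x. x \<in> S \<Longrightarrow> \<exists>a. br \<rho> x = a *\<^sub>C x" "cv.span S = UNIV" for m S
    using eigenvector_in_span[OF lin2, of S \<rho>] that by (auto simp: ad_eigenspace_def)
  have U': "cv.span ?U = UNIV" using U by auto
  have "{s \<in> ?U. br \<rho> s = of_int 0 *\<^sub>C s} \<subseteq> h"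
  proof
    fix s assume s: "s \<in> {s \<in> ?U. br \<rho> s = of_int 0 *\<^sub>C s}"
    show "s \<in> h"
    proof (rule ccontr)
      assume "s \<notin> h"
      then have "s \<noteq> 0" using cv.subspace_0[OF h] by auto
      have "s \<in> ?P \<or> s \<in> ?Q" using s \<open>s \<notin> h\<close> by blast
      then have "\<exists>m::int. m \<noteq> 0 \<and> br \<rho> s = of_int m *\<^sub>C s"
      proof
        assume "s \<in> ?P" from P[OF this] show ?thesis by (metis less_irrefl)
      next
        assume "s \<in> ?Q" from Q[OF this] show ?thesis by (metis less_irrefl)
      qed
      then obtain m :: int where m: "m \<noteq> 0" "br \<rho> s = of_int m *\<^sub>C s" by blast
      then show False using eq[OF m(2), of 0] s \<open>s \<noteq> 0\<close> by simp
    qed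
  qed
  then have "cv.span {s \<in> ?U. br \<rho> s = of_int 0 *\<^sub>C s} \<subseteq> h" by (rule cv.span_minimal[OF _ h])
  then have zero: "ad_eigenspace br \<rho> 0 \<subseteq> h" using part[OF eig U', of 0] by blast
  have pos: "ad_eigenspace br \<rho> m \<subseteq> g_plus br h \<Theta>" if "m > 0" for m
  proof -
    have "{s \<in> ?U. br \<rho> s = of_int m *\<^sub>C s} \<subseteq> insert 0 ?P"
    proof
      fix s assume s: "s \<in> {s \<in> ?U. br \<rho> s = of_int m *\<^sub>C s}"
      show "s \<in> insert 0 ?P"
      proof (rule ccontr)
        assume n: "s \<notin> insert 0 ?P"
        then have "s \<in> h \<or> s \<in> ?Q" using s by blast
        then have "\<exists>k::int. k \<le> 0 \<and> br \<rho> s = of_int k *\<^sub>C s"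
        proof
          assume "s \<in> h" from H[OF this] show ?thesis by blast
        next
          assume "s \<in> ?Q" from Q[OF this] show ?thesis by (metis less_imp_le)
        qed
        then obtain k :: int where k: "k \<le> 0" "br \<rho> s = of_int k *\<^sub>C s" by blast
        then show False using eq[OF k(2), of m] s n \<open>m > 0\<close> by simp
      qed
    qed
    then have "cv.span {s \<in> ?U. br \<rho> s = of_int m *\<^sub>C s} \<subseteq> cv.span (insert 0 ?P)" by (rule cv.span_mono)
    also have "\<dots> = g_plus br h \<Theta>" by (simp add: g_plus_def cv.span_insert_0)
    finally show ?thesis using part[OF eig U', of m] by blast
  qed
  have "?U \<subseteq> (\<Union>m. ad_eigenspace br \<rho> m)" using eig_int by (auto simp: ad_eigenspace_def)
  then have span: "cv.span (\<Union>m. ad_eigenspace br \<rho> m) = UNIV" using U cv.span_mono by blast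
  obtain B where B: "B \<subseteq> ?U" "cv.independent B" "?U \<subseteq> cv.span B"
    by (rule cv.maximal_independent_subset)
  obtain C :: "'g set" where C: "finite C" "UNIV \<subseteq> cv.span C" using fd by (auto simp: fin_dim_def)
  have "B \<subseteq> cv.span C" using C(2) by (rule order_trans[OF subset_UNIV])
  then have "finite B" using cv.independent_span_bound[OF C(1) B(2)] by simp
  have "cv.span B = UNIV" using cv.span_minimal[OF B(3) cv.subspace_span] U by blast
  define M where "M s = (SOME m::int. br \<rho> s = of_int m *\<^sub>C s)" for s
  have bound: "\<bar>m\<bar> < (\<Sum>s\<in>B. \<bar>M s\<bar>) + 1" if x: "x \<in> ad_eigenspace br \<rho> m" "x \<noteq> 0" for m x
  proof -
    have "x \<in> cv.span {s \<in> B. br \<rho> s = of_int m *\<^sub>C s}"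
    proof (rule subsetD[OF part[OF _ \<open>cv.span B = UNIV\<close>] x(1)])
      show "\<exists>a. br \<rho> s = a *\<^sub>C s" if "s \<in> B" for s using eig subsetD[OF B(1) that] .
    qed
    moreover have "cv.span S \<subseteq> {0}" if "S \<subseteq> {0}" for S :: "'g set"
      by (rule cv.span_minimal[OF that cv.subspace_single_0])
    ultimately have "\<not> {s \<in> B. br \<rho> s = of_int m *\<^sub>C s} \<subseteq> {0}"
      using x(2) by blast
    then obtain s where s: "s \<in> B" "s \<noteq> 0" "br \<rho> s = of_int m *\<^sub>C s" by blast
    then have "br \<rho> s = of_int (M s) *\<^sub>C s" unfolding M_def by (intro someI)
    then have "M s = m" using eq[OF s(3)] s(2) by simp
    moreover have "\<bar>M s\<bar> \<le> (\<Sum>s\<in>B. \<bar>M s\<bar>)" by (rule member_le_sum) (use s \<open>finite B\<close> in auto)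
    ultimately show ?thesis by simp
  qed
  show ?thesis using \<rho>(1) zero span pos bound by blast
qed

section \<open>The top space of a graded module\<close>

text \<open>An irreducible space with operators of integer degrees, abstracted from a highest weight module
  with its triangular decomposition.  Brackets are only required to lie in the span of operators of
  the right degree after evaluation at a vector, so that the operators can be taken from generators
  instead of the whole Lie algebra.\<close>

locale graded_ops =
  fixes Op :: "int \<Rightarrow> ('w::cvs \<Rightarrow> 'w) set" and D :: "'w \<Rightarrow> 'w"
  assumes Op_linear: "\<And>j X. X \<in> Op j \<Longrightarrow> clinear X"
    and Op_bracket: "\<And>i j X Y u. X \<in> Op i \<Longrightarrow> Y \<in> Op j \<Longrightarrow>
      X (Y u) - Y (X u) \<in> cv.span {Z u | Z. Z \<in> Op (i + j)}"
    and Op_0_commute: "\<And>X Y u. X \<in> Op 0 \<Longrightarrow> Y \<in> Op 0 \<Longrightarrow> X (Y u) = Y (X u)"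
    and Op_irreducible: "\<And>M u. cv.subspace M \<Longrightarrow> (\<And>j X w. X \<in> Op j \<Longrightarrow> w \<in> M \<Longrightarrow> X w \<in> M) \<Longrightarrow>
      u \<in> M \<Longrightarrow> u \<noteq> 0 \<Longrightarrow> M = UNIV"
    and D_linear: "clinear D"
    and D_degree: "\<And>j X u. X \<in> Op j \<Longrightarrow> D (X u) = X (D u) + of_int j *\<^sub>C X u"
begin

fun lowered :: "'w set \<Rightarrow> nat \<Rightarrow> 'w set"
  where "lowered K 0 = K"
  | "lowered K (Suc k) = lowered K k \<union> {Y u | Y u j. Y \<in> Op j \<and> j < 0 \<and> u \<in> lowered K k}"

text \<open>The triangular decomposition in place of the theorem of Poincare, Birkhoff and Witt: an operator
  \<open>X\<close> of nonnegative degree is moved past a lowering operator \<open>Y\<close>, and the commutator is applied to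
  a vector with one lowering operator fewer.  The commutator may have any degree, so one step up
  in \<open>k\<close> must be allowed for it.\<close>

lemma lowered_closed:
  assumes K: "cv.subspace K" and zero: "\<And>X u. X \<in> Op 0 \<Longrightarrow> u \<in> K \<Longrightarrow> X u \<in> K"
    and pos: "\<And>j X u. j > 0 \<Longrightarrow> X \<in> Op j \<Longrightarrow> u \<in> K \<Longrightarrow> X u = 0"
  shows "u \<in> lowered K k \<Longrightarrow> X \<in> Op j \<Longrightarrow> j \<ge> 0 \<Longrightarrow> X u \<in> cv.span (lowered K k)"
proof (induction k arbitrary: u X j)
  case 0
  then show ?case
    using zero[of X u] pos[of j X u] cv.subspace_0[OF K]
    by (cases "j = 0") (auto intro: cv.span_base)
next
  case (Suc k)
  let ?N = "cv.span (lowered K (Suc k))"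
  have mono: "cv.span (lowered K k) \<subseteq> ?N" by (rule cv.span_mono) auto
  have any: "Z w \<in> ?N" if "w \<in> lowered K k" "Z \<in> Op i" for Z w i
  proof (cases "i \<ge> 0")
    case True
    then show ?thesis using Suc.IH[OF that] mono by blast
  next
    case False
    then have "i < 0" by simp
    then have "Z w \<in> lowered K (Suc k)" using that by (simp, blast)
    then show ?thesis by (rule cv.span_base)
  qed
  show ?case
  proof (cases "u \<in> lowered K k")
    case True
    then show ?thesis using any Suc.prems(2) by blast
  next
    case False
    then obtain Y w i where Y: "u = Y w" "Y \<in> Op i" "i < 0" "w \<in> lowered K k"
      using Suc.prems(1) by auto
    have "cv.span (lowered K k) \<subseteq> {x. Y x \<in> ?N}"
      by (rule cv.span_minimal[OF _ subspace_vimage[OF Op_linear[OF Y(2)] cv.subspace_span]])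
        (use any Y(2) in auto)
    then have 1: "Y (X w) \<in> ?N" using Suc.IH[OF Y(4) Suc.prems(2,3)] by auto
    have "cv.span {Z w | Z. Z \<in> Op (j + i)} \<subseteq> ?N"
      by (rule cv.span_minimal[OF _ cv.subspace_span]) (use any Y(4) in auto)
    then have 2: "X (Y w) - Y (X w) \<in> ?N"
      using Op_bracket[OF Suc.prems(2) Y(2), of w] by auto
    from cv.span_add[OF 1 2] show ?thesis by (simp add: Y(1))
  qed
qed

text \<open>By irreducibility, lowering \<open>K\<close> produces the whole space.  Every proper lowering strictly
  decreases the eigenvalue of \<open>D\<close>, so the vectors with the top eigenvalue come from \<open>K\<close> itself.\<close>

lemma top_space_subset:
  assumes K: "cv.subspace K" and zero: "\<And>X u. X \<in> Op 0 \<Longrightarrow> u \<in> K \<Longrightarrow> X u \<in> K"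
    and pos: "\<And>j X u. j > 0 \<Longrightarrow> X \<in> Op j \<Longrightarrow> u \<in> K \<Longrightarrow> X u = 0"
    and top: "\<And>u. u \<in> K \<Longrightarrow> D u = \<mu> *\<^sub>C u" and e: "e \<in> K" "e \<noteq> 0" and x: "D x = \<mu> *\<^sub>C x"
  shows "x \<in> K"
proof -
  let ?C = "\<Union>k. lowered K k"
  have closed: "X u \<in> cv.span ?C" if "X \<in> Op j" "u \<in> ?C" for X j u
  proof -
    from that(2) obtain k where k: "u \<in> lowered K k" by blast
    show ?thesis
    proof (cases "j \<ge> 0")
      case True
      have "cv.span (lowered K k) \<subseteq> cv.span ?C" by (rule cv.span_mono) blast
      moreover have "X u \<in> cv.span (lowered K k)"
        by (rule lowered_closed[OF K _ _ k that(1) True]) (fact zero, fact pos)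
      ultimately show ?thesis by blast
    next
      case False
      then have "j < 0" by simp
      then have "X u \<in> lowered K (Suc k)" using that(1) k by (simp, blast)
      then show ?thesis by (intro cv.span_base) blast
    qed
  qed
  have deg: "u \<in> K \<or> (\<exists>m<0::int. D u = (\<mu> + of_int m) *\<^sub>C u)" if "u \<in> lowered K k" for u k
    using that
  proof (induction k arbitrary: u)
    case (Suc k)
    show ?case
    proof (cases "u \<in> lowered K k")
      case False
      then obtain Y w j where Y: "u = Y w" "Y \<in> Op j" "j < 0" "w \<in> lowered K k"
        using Suc.prems by auto
      have "\<exists>m\<le>0::int. D w = (\<mu> + of_int m) *\<^sub>C w"
        using Suc.IH[OF Y(4)]
      proof
        assume "w \<in> K"
        then show ?thesis by (intro exI[of _ 0]) (simp add: top)
      qed (metis less_imp_le)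
      then obtain m :: int where m: "m \<le> 0" "D w = (\<mu> + of_int m) *\<^sub>C w" by blast
      have "D u = (\<mu> + of_int (m + j)) *\<^sub>C u"
        by (simp add: Y(1) D_degree[OF Y(2)] m(2) clinear_scale[OF Op_linear[OF Y(2)]]
            cv.scale_left_distrib[symmetric] add.assoc)
      then show ?thesis using m(1) Y(3) by (intro disjI2 exI[of _ "m + j"]) auto
    qed (rule Suc.IH)
  qed simp
  have "cv.span ?C = UNIV"
  proof (rule Op_irreducible[OF cv.subspace_span])
    show "X w \<in> cv.span ?C" if "X \<in> Op j" "w \<in> cv.span ?C" for j X w
    proof -
      have "cv.span ?C \<subseteq> {w. X w \<in> cv.span ?C}"
        by (rule cv.span_minimal[OF _ subspace_vimage[OF Op_linear[OF that(1)] cv.subspace_span]])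
          (use closed[OF that(1)] in blast)
      then show ?thesis using that(2) by blast
    qed
    show "e \<in> cv.span ?C" using e(1) by (intro cv.span_base UN_I[of 0]) auto
  qed (rule e(2))
  then have "x \<in> cv.span {s \<in> ?C. D s = \<mu> *\<^sub>C s}"
  proof (intro eigenvector_in_span[OF D_linear _ _ x])
    show "\<exists>b. D s = b *\<^sub>C s" if "s \<in> ?C" for s using that deg top by blast
  qed simp
  moreover have "s \<in> K" if s: "s \<in> ?C" "D s = \<mu> *\<^sub>C s" for s
  proof -
    obtain k where "s \<in> lowered K k" using s(1) by blast
    from deg[OF this] show ?thesis
    proof
      assume "\<exists>m<0::int. D s = (\<mu> + of_int m) *\<^sub>C s"
      then obtain m :: int where "m < 0" "D s = (\<mu> + of_int m) *\<^sub>C s" by blast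
      then have "s = 0" using s(2) by (simp add: scaleC_add_left)
      then show ?thesis using cv.subspace_0[OF K] by simp
    qed
  qed
  then have "cv.span {s \<in> ?C. D s = \<mu> *\<^sub>C s} \<subseteq> K"
    by (intro cv.span_minimal[OF _ K]) blast
  ultimately show ?thesis by blast
qed

text \<open>An operator \<open>H\<close> of degree zero has an eigenvector in the finite dimensional top space.  The
  eigenspace is stable under the other operators of degree zero, so it is the whole top space and
  \<open>H\<close> acts by a scalar.  Hence the line through \<open>v\<close> is stable under all operators of degree zero.\<close>

lemma top_space_one_dimensional:
  assumes S: "cv.subspace S" "fin_dim S" "\<And>X u. X \<in> Op 0 \<Longrightarrow> u \<in> S \<Longrightarrow> X u \<in> S"
    and v: "v \<in> S" "v \<noteq> 0" "\<And>j X. j > 0 \<Longrightarrow> X \<in> Op j \<Longrightarrow> X v = 0" "D v = \<mu> *\<^sub>C v"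
    and x: "D x = \<mu> *\<^sub>C x"
  shows "\<exists>c. x = c *\<^sub>C v"
proof -
  define T where "T = {u \<in> S. D u = \<mu> *\<^sub>C u \<and> (\<forall>j>0. \<forall>X\<in>Op j. X u = 0)}"
  have subT: "cv.subspace T"
  proof (rule cv.subspaceI)
    show "0 \<in> T"
      by (auto simp: T_def cv.subspace_0[OF S(1)] clinear_0[OF D_linear] clinear_0[OF Op_linear])
    show "x + y \<in> T" if x: "x \<in> T" and y: "y \<in> T" for x y
    proof -
      have "X (x + y) = 0" if "j > 0" "X \<in> Op j" for j X
      proof -
        have "X x = 0" "X y = 0" using x y that by (auto simp: T_def)
        then show ?thesis by (simp add: clinear_add[OF Op_linear[OF that(2)]])
      qed
      then show ?thesis using x y
        by (simp add: T_def cv.subspace_add[OF S(1)] clinear_add[OF D_linear] scaleC_add_right)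
    qed
    show "c *\<^sub>C x \<in> T" if x: "x \<in> T" for c x
    proof -
      have "X (c *\<^sub>C x) = 0" if "j > 0" "X \<in> Op j" for j X
      proof -
        have "X x = 0" using x that by (auto simp: T_def)
        then show ?thesis by (simp add: clinear_scale[OF Op_linear[OF that(2)]])
      qed
      then show ?thesis using x
        by (simp add: T_def cv.subspace_scale[OF S(1)] clinear_scale[OF D_linear] mult.commute)
    qed
  qed
  have fdT: "fin_dim T" using S(2) unfolding T_def fin_dim_def by blast
  have vT: "v \<in> T" using v by (auto simp: T_def)
  have T_closed: "H u \<in> T" if H: "H \<in> Op 0" and u: "u \<in> T" for H u
  proof -
    have "X (H u) = 0" if j: "j > 0" and X: "X \<in> Op j" for j X
    proof -
      have "{Z u | Z. Z \<in> Op (j + 0)} \<subseteq> {0}" using u j by (auto simp: T_def)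
      then have "cv.span {Z u | Z. Z \<in> Op (j + 0)} \<subseteq> {0}"
        by (rule cv.span_minimal[OF _ cv.subspace_single_0])
      then have "X (H u) - H (X u) = 0" using Op_bracket[OF X H, of u] by blast
      moreover have "X u = 0" using u j X by (auto simp: T_def)
      ultimately show ?thesis by (simp add: clinear_0[OF Op_linear[OF H]])
    qed
    then show ?thesis using u S(3)[OF H]
      by (simp add: T_def D_degree[OF H] clinear_scale[OF Op_linear[OF H]])
  qed
  have scalar: "\<exists>a. H v = a *\<^sub>C v" if H: "H \<in> Op 0" for H
  proof -
    obtain a e where e: "e \<in> T" "e \<noteq> 0" "H e = a *\<^sub>C e"
      using fin_dim_eigenvector[OF Op_linear[OF H] subT fdT T_closed[OF H] vT v(2)] by blast
    let ?K = "{u \<in> T. H u = a *\<^sub>C u}"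
    have "v \<in> ?K"
    proof (rule top_space_subset[where e = e])
      show "cv.subspace ?K"
        by (rule cv.subspaceI)
          (auto simp: cv.subspace_0[OF subT] cv.subspace_add[OF subT] cv.subspace_scale[OF subT] scaleC_add_right
            clinear_0[OF Op_linear[OF H]] clinear_add[OF Op_linear[OF H]] clinear_scale[OF Op_linear[OF H]] mult.commute)
      show "X u \<in> ?K" if X: "X \<in> Op 0" and u: "u \<in> ?K" for X u
      proof -
        have "H (X u) = X (H u)" by (rule Op_0_commute[OF H X])
        also have "H u = a *\<^sub>C u" using u by simp
        finally show ?thesis using u T_closed[OF X] by (simp add: clinear_scale[OF Op_linear[OF X]])
      qed
    qed (use e v(4) in \<open>auto simp: T_def\<close>)
    then show ?thesis by blast
  qed
  have "x \<in> cv.span {v}"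
  proof (rule top_space_subset[where e = v])
    have sub: "cv.span {v} \<subseteq> T" by (rule cv.span_minimal[OF _ subT]) (use vT in auto)
    show "X u \<in> cv.span {v}" if X: "X \<in> Op 0" and u: "u \<in> cv.span {v}" for X u
    proof -
      obtain c where "u = c *\<^sub>C v" using u by (auto simp: cv.span_singleton)
      moreover obtain a where "X v = a *\<^sub>C v" using scalar[OF X] by blast
      ultimately have "X u = (c * a) *\<^sub>C v" by (simp add: clinear_scale[OF Op_linear[OF X]])
      then show ?thesis by (simp add: cv.span_scale cv.span_base)
    qed
    show "X u = 0" if "j > 0" "X \<in> Op j" "u \<in> cv.span {v}" for j X u
      using that sub by (auto simp: T_def)
    show "D u = \<mu> *\<^sub>C u" if "u \<in> cv.span {v}" for u
      using that sub by (auto simp: T_def)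
  qed (simp_all add: v x cv.span_base)
  then show ?thesis by (auto simp: cv.span_singleton)
qed

end

section \<open>The finite dimensional algebra inside the toroidal algebra\<close>

locale integrable_tau_module =
  fixes br :: "'g::cvs \<Rightarrow> 'g \<Rightarrow> 'g"
    and form :: "'g \<Rightarrow> 'g \<Rightarrow> complex"
    and h :: "'g set"
    and \<Theta> :: "('g \<Rightarrow> complex) set"
    and act :: "('g, 'n::finite, 'b::comm_calg) tau \<Rightarrow> 'v::cvs \<Rightarrow> 'v"
  assumes simple: "simple_lie br" and fd: "fin_dim (UNIV :: 'g set)"
    and cartan: "cartan_subalgebra br h" and base: "root_base br h \<Theta>"
    and form: "invariant_form br form"
    and act_module: "lie_module (tau_bracket br form) act"
    and integrable: "integrable_module br h act"
    and K0: "\<exists>c::nat. c > 0 \<and> (\<forall>u. act (tau_K 0 None 1) u = of_nat c *\<^sub>C u)"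
    and Ki: "\<And>i u. act (tau_K 0 (Some i) 1) u = 0"
    and nontrivial: "(UNIV :: 'v set) \<noteq> {0}"
begin

lemma lie: "lie_algebra br"
  using simple by (simp add: simple_lie_def)

lemma br_bilinear: "cbilinear br"
  using lie by (simp add: lie_algebra_def)

lemma form_bilinear: "cbilinear form"
  using form by (simp add: invariant_form_def)

lemmas br_lin1 = cbilinearD(1)[OF br_bilinear]
  and br_lin2 = cbilinearD(2)[OF br_bilinear]

lemma act_bilinear: "cbilinear act"
  using act_module by (simp add: lie_module_def)

lemmas act_lin1 = cbilinearD(1)[OF act_bilinear]
  and act_lin2 = cbilinearD(2)[OF act_bilinear]

lemma act_bracket: "act X (act Y u) - act Y (act X u) = act (tau_bracket br form X Y) u"
  using act_module unfolding lie_module_def by metis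

lemma tau_X_linear: "clinear (\<lambda>x. tau_X x k b)"
  unfolding tau_X_def by (intro clin)

lemmas act_X_linear = clinear_compose[OF tau_X_linear act_lin1]

lemma tau_bracket_X:
  "tau_bracket br form (tau_X x k b) (tau_X y r b') =
    tau_X (br x y) (k + r) (b * b')
      + form x y *\<^sub>C (\<Sum>i\<in>UNIV. of_int (deg k i) *\<^sub>C tau_K (k + r) i (b * b'))"
  by (rule tau_bracket_generators(1)[OF br_bilinear form_bilinear])

lemma deg_0 [simp]: "deg 0 i = 0"
  by (cases i) (simp_all add: zero_prod_def zero_vec_def)

lemma act_X0_X:
  "act (tau_X x 0 1) (act (tau_X y k b) u) - act (tau_X y k b) (act (tau_X x 0 1) u)
    = act (tau_X (br x y) k b) u"
  by (simp add: act_bracket tau_bracket_X)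

text \<open>Such a subspace is an ideal, and it is nonzero because a simple Lie algebra is not abelian.\<close>

lemma derived_eq_UNIV:
  assumes S: "cv.subspace S" and br: "\<And>x y. br x y \<in> S"
  shows "S = UNIV"
proof -
  have "lie_ideal br S" using S br by (simp add: lie_ideal_def)
  moreover obtain x y where "br x y \<noteq> 0" using simple by (auto simp: simple_lie_def)
  ultimately show ?thesis using simple br[of x y] by (auto simp: simple_lie_def)
qed

text \<open>The kernel is an ideal.  If it were everything, then \<open>[x \<otimes> 1, y \<otimes> t\<^sup>k \<otimes> b] = [x, y] \<otimes> t\<^sup>k \<otimes> b\<close>
  and \<open>[g, g] = g\<close> would make all \<open>x \<otimes> t\<^sup>k \<otimes> b\<close> act as zero, hence also
  \<open>[x \<otimes> t\<^sub>0, y \<otimes> t\<^sub>0\<^bsup>-1\<^esup>] = [x, y] + (x, y) K\<^sub>0\<close>.  As \<open>K\<^sub>0\<close> acts by a positive integer, the form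
  would vanish.\<close>

lemma act_faithful:
  assumes x: "\<And>u. act (tau_X x 0 1) u = 0"
  shows "x = 0"
proof -
  let ?I = "{x. \<forall>u. act (tau_X x 0 1) u = 0}"
  have sub: "cv.subspace ?I"
    by (rule cv.subspaceI)
      (simp_all add: clinear_0[OF act_X_linear] clinear_add[OF act_X_linear] clinear_scale[OF act_X_linear])
  have "br y x \<in> ?I" if "x \<in> ?I" for x y
    using that act_X0_X[of y x 0 1] by (simp add: clinear_0[OF act_lin2] flip: act_X0_X)
  then have "lie_ideal br ?I" using sub by (simp add: lie_ideal_def)
  then have "?I = {0} \<or> ?I = UNIV" using simple by (auto simp: simple_lie_def)
  moreover have "?I \<noteq> UNIV"
  proof
    assume "?I = UNIV"
    then have triv: "act (tau_X x 0 1) u = 0" for x u by auto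
    let ?J = "{x. \<forall>k b u. act (tau_X x k b) u = 0}"
    have "?J = UNIV"
    proof (rule derived_eq_UNIV)
      show "cv.subspace ?J"
        by (rule cv.subspaceI)
          (simp_all add: clinear_0[OF act_X_linear] clinear_add[OF act_X_linear] clinear_scale[OF act_X_linear])
      show "br x y \<in> ?J" for x y
        by (simp add: triv clinear_0[OF act_lin2] flip: act_X0_X)
    qed
    then have zero: "act (tau_X x k b) u = 0" for x k b u by blast
    obtain c :: nat where c: "c > 0" "\<And>u. act (tau_K 0 None 1) u = of_nat c *\<^sub>C u" using K0 by blast
    obtain u :: 'v where u: "u \<noteq> 0" using nontrivial by auto
    have "form x y = 0" for x y
    proof -
      let ?k = "(1, 0) :: 'n expo" and ?r = "(- 1, 0) :: 'n expo"
      have kr: "?k + ?r = 0" by (simp add: zero_prod_def)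
      have "0 = act (tau_bracket br form (tau_X x ?k 1) (tau_X y ?r 1)) u"
        by (simp only: act_bracket[symmetric] zero) simp
      also have "\<dots> = form x y *\<^sub>C (\<Sum>i\<in>UNIV. of_int (deg ?k i) *\<^sub>C act (tau_K 0 i 1) u)"
        by (simp only: tau_bracket_X kr clinear_add[OF act_lin1] clinear_scale[OF act_lin1]
            clinear_sum[OF act_lin1] zero) simp
      also have "(\<Sum>i\<in>UNIV. of_int (deg ?k i) *\<^sub>C act (tau_K 0 i 1) u)
          = (\<Sum>i\<in>UNIV. if i = (None :: 'n option) then of_nat c *\<^sub>C u else 0)"
      proof (rule sum.cong)
        show "of_int (deg ?k i) *\<^sub>C act (tau_K 0 i 1) u = (if i = None then of_nat c *\<^sub>C u else 0)"
          for i :: "'n option"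
          by (cases i) (simp_all add: c(2) Ki scaleC_one)
      qed simp
      also have "\<dots> = of_nat c *\<^sub>C u" by simp
      finally show ?thesis using c(1) u by auto
    qed
    then have "(x::'g) = 0" for x using form by (simp add: invariant_form_def)
    then show False using simple by (auto simp: simple_lie_def)
  qed
  ultimately show ?thesis using x by blast
qed

lemma weight_vectors_span: "cv.span (\<Union>\<mu>\<in>dual_space (tau_H h). weight_space act (tau_H h) \<mu>) = UNIV"
  using integrable by (simp add: integrable_module_def direct_sum_def)

lemma cartan_in_H: "x \<in> h \<Longrightarrow> tau_X x 0 1 \<in> tau_H h"
  unfolding tau_H_def by (intro cv.span_base) blast

lemma weight_spaceD: "u \<in> weight_space A H \<mu> \<Longrightarrow> k \<in> H \<Longrightarrow> A k u = \<mu> k *\<^sub>C u"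
  unfolding weight_space_def by blast

lemma zero_on_weight_vectors:
  assumes "\<And>\<mu> u. u \<in> weight_space act (tau_H h) \<mu> \<Longrightarrow> act X u = 0"
  shows "act X u = 0"
proof -
  have "cv.subspace {u. act X u = 0}"
    by (rule cv.subspaceI) (simp_all add: clinear_0[OF act_lin2] clinear_add[OF act_lin2] clinear_scale[OF act_lin2])
  then have "cv.span (\<Union>\<mu>\<in>dual_space (tau_H h). weight_space act (tau_H h) \<mu>) \<subseteq> {u. act X u = 0}"
    by (rule cv.span_minimal[rotated]) (use assms in blast)
  then show ?thesis by (auto simp: weight_vectors_span)
qed

lemma cartan_abelian:
  assumes "x \<in> h" "y \<in> h" shows "br x y = 0"
proof (rule act_faithful, rule zero_on_weight_vectors)
  fix \<mu> u assume u: "u \<in> weight_space act (tau_H h) \<mu>"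
  have "act (tau_X z 0 1) u = \<mu> (tau_X z 0 1) *\<^sub>C u" if "z \<in> h" for z
    by (rule weight_spaceD[OF u cartan_in_H[OF that]])
  then show "act (tau_X (br x y) 0 1) u = 0"
    using assms by (simp add: clinear_scale[OF act_lin2] mult.commute flip: act_X0_X)
qed

text \<open>On a vector \<open>u\<close> of \<open>x\<close>-eigenvalue \<open>\<xi>\<close>, the operator \<open>ad x - a\<close> applied to \<open>y\<close> becomes
  \<open>x - (a + \<xi>)\<close> applied to \<open>y u\<close>.  Thus \<open>(ad x - a)\<^sup>2 y = 0\<close> turns into a statement on the
  diagonalizable operator \<open>x\<close> on the module, and faithfulness brings the conclusion back.\<close>

lemma cartan_semisimple:
  assumes x: "x \<in> h" and y: "br x (br x y - a *\<^sub>C y) = a *\<^sub>C (br x y - a *\<^sub>C y)"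
  shows "br x y = a *\<^sub>C y"
proof -
  let ?A = "act (tau_X x 0 1)" and ?y = "br x y - a *\<^sub>C y"
  let ?S = "\<Union>\<mu>\<in>dual_space (tau_H h). weight_space act (tau_H h) \<mu>"
  have eig: "\<exists>b. ?A s = b *\<^sub>C s" if "s \<in> ?S" for s
    using that weight_spaceD[OF _ cartan_in_H[OF x]] by blast
  have "?y = 0"
  proof (rule act_faithful, rule zero_on_weight_vectors)
    fix \<mu> u assume u: "u \<in> weight_space act (tau_H h) \<mu>"
    define \<xi> where "\<xi> = \<mu> (tau_X x 0 1)"
    have \<xi>: "?A u = \<xi> *\<^sub>C u"
      unfolding \<xi>_def by (rule weight_spaceD[OF u cartan_in_H[OF x]])
    \<comment> \<open>on the eigenvector \<open>u\<close>, the operator \<open>x\<close> acts on \<open>z u\<close> as \<open>ad x + \<xi>\<close> acts on \<open>z\<close>\<close>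
    have sep: "?A (act (tau_X z 0 1) u) = act (tau_X (br x z) 0 1) u + \<xi> *\<^sub>C act (tau_X z 0 1) u" for z
      using act_X0_X[of x z 0 1 u] by (simp add: \<xi> clinear_scale[OF act_lin2] diff_eq_eq)
    show "act (tau_X ?y 0 1) u = 0"
    proof (rule diagonalizable_imp_semisimple[OF act_lin2 eig])
      show "act (tau_X y 0 1) u \<in> cv.span ?S" by (simp only: weight_vectors_span UNIV_I)
      show "act (tau_X ?y 0 1) u = ?A (act (tau_X y 0 1) u) - (a + \<xi>) *\<^sub>C act (tau_X y 0 1) u"
        unfolding sep clinear_diff[OF act_X_linear] clinear_scale[OF act_X_linear]
        by (simp add: scaleC_add_left)
      show "?A (act (tau_X ?y 0 1) u) = (a + \<xi>) *\<^sub>C act (tau_X ?y 0 1) u"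
        unfolding sep y clinear_scale[OF act_X_linear] by (simp only: scaleC_add_left)
    qed
  qed
  then show ?thesis by simp
qed

lemma principal_element:
  "\<exists>\<rho>\<in>h. \<exists>N::int. ad_eigenspace br \<rho> 0 \<subseteq> h \<and>
    cv.span (\<Union>m. ad_eigenspace br \<rho> m) = UNIV \<and>
    (\<forall>m>0. ad_eigenspace br \<rho> m \<subseteq> g_plus br h \<Theta>) \<and>
    (\<forall>m. \<forall>x\<in>ad_eigenspace br \<rho> m. x \<noteq> 0 \<longrightarrow> \<bar>m\<bar> < N)"
proof (rule principal_grading[OF lie fd cartan base])
  show "br x y = 0" if "x \<in> h" "y \<in> h" for x y using cartan_abelian that .
  show "br x y = a *\<^sub>C y" if "x \<in> h" "br x (br x y - a *\<^sub>C y) = a *\<^sub>C (br x y - a *\<^sub>C y)" for x a y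
    using cartan_semisimple that .
qed

end

section \<open>Generators of the multiloop algebra\<close>

lemma gt_Y_linear: "clinear (\<lambda>y. gt_Y y r b)"
  unfolding gt_Y_def by (intro clin)

text \<open>Taking for \<open>E\<close> the eigenvectors of an element of the Cartan subalgebra reduces linear statements
  about the multiloop algebra to homogeneous generators.\<close>

lemma loop_part_mem:
  fixes S :: "('g::cvs, 'n::finite, 'b::comm_calg) gtilde set"
  assumes S: "cv.subspace S" and E: "cv.span E = UNIV"
    and X: "\<And>x k r b. x \<in> E \<Longrightarrow> gt_Y (x \<otimes> lmon k, 0) r b \<in> S"
    and K: "\<And>r b. gt_Y (0, 1) r b \<in> S"
  shows "(Y, 0) \<in> S"
proof -
  have lin: "clinear (\<lambda>Y. (Y, 0))" by (intro clin)
  have "Y \<in> {Y. (Y, 0) \<in> S}"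
  proof (rule loop_mem[OF subspace_vimage[OF lin S]])
    fix y :: "'g aff" and r :: "int ^ 'n" and b :: 'b
    obtain p c where y: "y = (p, c)" by (cases y)
    have "clinear (\<lambda>p. gt_Y (p, 0) r b)"
      by (rule clinear_compose[OF _ gt_Y_linear]) (intro clin)
    note subp = subspace_vimage[OF this S]
    have "p \<in> {p. gt_Y (p, 0) r b \<in> S}"
    proof (rule tensor_mem[OF subp])
      fix x :: 'g and q :: "int \<Rightarrow>\<^sub>0 complex"
      have "q \<in> {q. x \<otimes> q \<in> {p. gt_Y (p, 0) r b \<in> S}}"
      proof (rule laurent_mem[OF subspace_vimage[OF tens_linear_right subp]])
        fix k
        have "cv.span E \<subseteq> {x. x \<otimes> lmon k \<in> {p. gt_Y (p, 0) r b \<in> S}}"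
          by (rule cv.span_minimal[OF _ subspace_vimage[OF tens_linear_left subp]]) (use X in auto)
        then show "lmon k \<in> {q. x \<otimes> q \<in> {p. gt_Y (p, 0) r b \<in> S}}" by (auto simp: E)
      qed
      then show "x \<otimes> q \<in> {p. gt_Y (p, 0) r b \<in> S}" by simp
    qed
    then have "gt_Y (p, 0) r b + c *\<^sub>C gt_Y (0, 1) r b \<in> S"
      using K by (intro cv.subspace_add[OF S] cv.subspace_scale[OF S]) auto
    also have "gt_Y (p, 0) r b + c *\<^sub>C gt_Y (0, 1) r b = gt_Y y r b"
      by (simp add: y clinear_scale[OF gt_Y_linear, symmetric] clinear_add[OF gt_Y_linear, symmetric]
          scaleC_Pair scaleC_complex_def)
    finally show "(y \<otimes> lmon r) \<otimes> b \<in> {Y. (Y, 0) \<in> S}" by (simp add: gt_Y_def)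
  qed
  then show ?thesis by simp
qed

lemma G_sub_mem:
  fixes S :: "('g::cvs, 'n::finite, 'b::comm_calg) gtilde set"
  assumes S: "cv.subspace S" and E: "cv.span E = UNIV"
    and X: "\<And>x k r b. x \<in> E \<Longrightarrow> gt_Y (x \<otimes> lmon k, 0) r b \<in> S"
    and K: "\<And>r b. gt_Y (0, 1) r b \<in> S" and d: "gt_d None \<in> S" and Z: "Z \<in> G_sub"
  shows "Z \<in> S"
proof -
  have "Z = (fst Z, 0) + snd Z $ None *\<^sub>C gt_d None"
    using Z by (simp add: G_sub_def gt_d_def scaleC_Pair prod_eq_iff vec_eq_iff scaleC_vec_def axis_def
        split_option_all scaleC_complex_def)
  moreover have "(fst Z, 0) + snd Z $ None *\<^sub>C gt_d None \<in> S"
    by (intro cv.subspace_add[OF S] cv.subspace_scale[OF S] d loop_part_mem[OF S E X K])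
  ultimately show ?thesis by simp
qed

lemma gtilde_mem:
  fixes S :: "('g::cvs, 'n::finite, 'b::comm_calg) gtilde set"
  assumes S: "cv.subspace S" and E: "cv.span E = UNIV"
    and X: "\<And>x k r b. x \<in> E \<Longrightarrow> gt_Y (x \<otimes> lmon k, 0) r b \<in> S"
    and K: "\<And>r b. gt_Y (0, 1) r b \<in> S" and d: "\<And>i. gt_d i \<in> S"
  shows "Z \<in> S"
proof -
  let ?D = "\<Sum>i\<in>UNIV. snd Z $ i *\<^sub>C gt_d i :: ('g, 'n, 'b) gtilde"
  have "snd ?D $ j = snd Z $ j" for j
  proof -
    have "snd ?D $ j = (\<Sum>i\<in>UNIV. snd (snd Z $ i *\<^sub>C gt_d i :: ('g, 'n, 'b) gtilde) $ j)"
      by (simp add: clinear_sum[OF clinear_snd])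
    also have "\<dots> = (\<Sum>i\<in>UNIV. if i = j then snd Z $ j else 0)"
      by (rule sum.cong) (auto simp: gt_d_def scaleC_Pair scaleC_vec_def axis_def scaleC_complex_def)
    finally show ?thesis by simp
  qed
  moreover have "fst ?D = 0"
    by (simp add: clinear_sum[OF clinear_fst] gt_d_def scaleC_Pair)
  ultimately have "Z = (fst Z, 0) + ?D"
    by (simp add: prod_eq_iff vec_eq_iff)
  moreover have "(fst Z, 0) + ?D \<in> S"
    by (intro cv.subspace_add[OF S] cv.subspace_sum[OF S] cv.subspace_scale[OF S] d loop_part_mem[OF S E X K])
  ultimately show ?thesis by simp
qed

lemma surj_phi: "surj phi"
proof -
  have "Z \<in> range phi" for Z :: "('a, 'b, 'c) gtilde"
  proof (rule gtilde_mem)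
    show "cv.subspace (range phi :: ('a, 'b, 'c) gtilde set)"
    proof (rule cv.subspaceI)
      show "0 \<in> range phi" using clinear_0[OF phi_generators(1)] by (metis rangeI)
      show "x + y \<in> range phi" if "x \<in> range phi" "y \<in> range phi" for x y
        using that clinear_add[OF phi_generators(1)] by (metis (no_types, lifting) imageE rangeI)
      show "c *\<^sub>C x \<in> range phi" if "x \<in> range phi" for c x
        using that clinear_scale[OF phi_generators(1)] by (metis (no_types, lifting) imageE rangeI)
    qed
    show "cv.span UNIV = (UNIV :: 'a set)" by simp
    show "gt_Y (x \<otimes> lmon k, 0) r b \<in> range phi" for x k r b
      by (rule range_eqI[of _ _ "tau_X x (k, r) b"]) (simp add: phi_generators)
    show "gt_Y (0, 1) r b \<in> range phi" for r b
      by (rule range_eqI[of _ _ "tau_K (0, r) None b"]) (simp add: phi_generators)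
    show "gt_d i \<in> range phi" for i
      by (rule range_eqI[of _ _ "tau_d i"]) (simp add: phi_generators)
  qed
  then show ?thesis by blast
qed

section \<open>The grading by the derivations\<close>

text \<open>The element \<open>\<rho>\<close> and the bound \<open>N\<close> are parameters here because the integer degrees of the
  generators depend on them; they are supplied by \<open>principal_element\<close>.\<close>

locale graded_tau_module = integrable_tau_module br form h \<Theta> act
  for br :: "'g::cvs \<Rightarrow> 'g \<Rightarrow> 'g" and form h \<Theta>
    and act :: "('g, 'n::finite, 'b::comm_calg) tau \<Rightarrow> 'v::cvs \<Rightarrow> 'v" +
  fixes \<rho> :: 'g and N :: int
    and actG :: "('g, 'n, 'b) gtilde \<Rightarrow> 'v \<Rightarrow> 'v"
    and lam :: "('g, 'n, 'b) tau \<Rightarrow> complex"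
    and v :: 'v
  assumes \<rho>_in_h: "\<rho> \<in> h" and eig_0: "ad_eigenspace br \<rho> 0 \<subseteq> h"
    and eig_span: "cv.span (\<Union>m. ad_eigenspace br \<rho> m) = UNIV"
    and eig_pos: "\<And>m. m > 0 \<Longrightarrow> ad_eigenspace br \<rho> m \<subseteq> g_plus br h \<Theta>"
    and eig_bound: "\<And>m x. x \<in> ad_eigenspace br \<rho> m \<Longrightarrow> x \<noteq> 0 \<Longrightarrow> \<bar>m\<bar> < N"
    and irreducible: "irreducible_module act"
    and ker_phi: "\<And>X u. phi X = 0 \<Longrightarrow> act X u = 0"
    and actG_def: "actG = induced_act phi act"
    and v_weight: "v \<in> weight_space act (tau_H h) lam" and v_nz: "v \<noteq> 0"
    and v_highest: "\<And>X. X \<in> tau_plus (g_plus br h \<Theta>) \<Longrightarrow> act X v = 0"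
begin

text \<open>Homogeneous generators of \<open>G\<close>, lifted to the toroidal algebra.  The degree is the eigenvalue of
  \<open>N d\<^sub>0 + \<rho>\<close>; the weight \<open>N\<close> of \<open>d\<^sub>0\<close> makes the sign of the degree that of the exponent of \<open>t\<^sub>0\<close>,
  or of the height if this exponent is zero.\<close>

definition Gen :: "int \<Rightarrow> ('g, 'n, 'b) tau set"
  where "Gen j = {tau_X x (k, r) b | x m k r b. x \<in> ad_eigenspace br \<rho> m \<and> j = k * N + m} \<union>
    (if j = 0 then insert (tau_d None) {tau_K (0, r) None b | r b. True} else {})"

lemma Gen_cases:
  assumes "X \<in> Gen j"
  obtains (X) x m k r b where "X = tau_X x (k, r) b" "x \<in> ad_eigenspace br \<rho> m" "j = k * N + m"
    | (K) r b where "X = tau_K (0, r) None b" "j = 0"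
    | (d) "X = tau_d None" "j = 0"
  using assms by (auto simp: Gen_def split: if_splits)

lemma Gen_X: "x \<in> ad_eigenspace br \<rho> m \<Longrightarrow> tau_X x (k, r) b \<in> Gen (k * N + m)"
  and Gen_K: "tau_K (0, r) None b \<in> Gen 0"
  and Gen_d: "tau_d None \<in> Gen 0"
  unfolding Gen_def by (blast, simp_all, blast)

lemma act_K_Some: "act (tau_K (k, r) (Some i) b) u = 0"
  by (rule ker_phi) (simp add: phi_generators)

lemma act_K_None: "k \<noteq> 0 \<Longrightarrow> act (tau_K (k, r) None b) u = 0"
  by (rule ker_phi) (simp add: phi_generators)

lemma act_phi_cong: "phi X = phi Y \<Longrightarrow> act X u = act Y u"
  using ker_phi[of "X - Y" u] clinear_diff[OF phi_generators(1), of X Y] clinear_diff[OF act_lin1, of X Y]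
  by simp

lemma actG_phi: "actG (phi X) = act X"
  unfolding actG_def induced_act_def
  by (rule ext) (rule act_phi_cong, simp add: surj_f_inv_f[OF surj_phi])

lemma actG_lin1: "clinear (\<lambda>X. actG X u)"
proof -
  have *: "\<exists>X'. X = phi X'" for X :: "('g, 'n, 'b) gtilde" using surjD[OF surj_phi] .
  show ?thesis
  proof (rule clinearI)
    fix X Y :: "('g, 'n, 'b) gtilde" and c
    obtain X' Y' where "X = phi X'" "Y = phi Y'" using *[of X] *[of Y] by blast
    then show "actG (X + Y) u = actG X u + actG Y u" "actG (c *\<^sub>C X) u = c *\<^sub>C actG X u"
      by (simp_all add: actG_phi clinear_add[OF phi_generators(1), symmetric]
          clinear_scale[OF phi_generators(1), symmetric] clinear_add[OF act_lin1] clinear_scale[OF act_lin1])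
  qed
qed

lemma actG_lin2: "clinear (actG X)"
  by (metis surjD[OF surj_phi] actG_phi act_lin2)

lemma phi_Gen_in_G_sub: "X \<in> Gen j \<Longrightarrow> phi X \<in> G_sub"
  by (erule Gen_cases) (simp_all add: phi_generators G_sub_def gt_Y_def gt_d_def axis_def)

lemma G_sub_closed:
  fixes A :: "('g, 'n, 'b) gtilde \<Rightarrow> 'x::cvs \<Rightarrow> 'y::cvs"
  assumes lin: "\<And>u. clinear (\<lambda>X. A X u)" and M: "cv.subspace M"
    and gen: "\<And>j X. X \<in> Gen j \<Longrightarrow> A (phi X) u \<in> M" and X: "X \<in> G_sub"
  shows "A X u \<in> M"
proof -
  have sub: "cv.subspace {X. A X u \<in> M}" by (rule subspace_vimage[OF lin M])
  have "X \<in> {X. A X u \<in> M}"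
  proof (rule G_sub_mem[OF sub eig_span _ _ _ X])
    fix x k and r :: "int ^ 'n" and b :: 'b
    assume "x \<in> (\<Union>m. ad_eigenspace br \<rho> m)"
    then obtain m where "x \<in> ad_eigenspace br \<rho> m" by blast
    from gen[OF Gen_X[OF this, of k r b]]
    show "gt_Y (x \<otimes> lmon k, 0) r b \<in> {X. A X u \<in> M}" by (simp add: phi_generators)
  next
    fix r :: "int ^ 'n" and b :: 'b
    show "gt_Y (0, 1) r b \<in> {X. A X u \<in> M}" using gen[OF Gen_K[of r b]] by (simp add: phi_generators)
    show "gt_d None \<in> {X. A X u \<in> M}" using gen[OF Gen_d] by (simp add: phi_generators)
  qed
  then show ?thesis by (rule CollectD)
qed

lemma gtilde_closed:
  fixes A :: "('g, 'n, 'b) gtilde \<Rightarrow> 'x::cvs \<Rightarrow> 'y::cvs"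
  assumes lin: "clinear (\<lambda>X. A X u)" and M: "cv.subspace M"
    and gen: "\<And>j X. X \<in> Gen j \<Longrightarrow> A (phi X) u \<in> M" and d: "\<And>i. A (gt_d (Some i)) u \<in> M"
  shows "A X u \<in> M"
proof -
  have sub: "cv.subspace {X. A X u \<in> M}" by (rule subspace_vimage[OF lin M])
  have "X \<in> {X. A X u \<in> M}"
  proof (rule gtilde_mem[OF sub eig_span])
    fix x k and r :: "int ^ 'n" and b :: 'b
    assume "x \<in> (\<Union>m. ad_eigenspace br \<rho> m)"
    then obtain m where "x \<in> ad_eigenspace br \<rho> m" by blast
    from gen[OF Gen_X[OF this, of k r b]]
    show "gt_Y (x \<otimes> lmon k, 0) r b \<in> {X. A X u \<in> M}" by (simp add: phi_generators)
  next
    fix r :: "int ^ 'n" and b :: 'b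
    show "gt_Y (0, 1) r b \<in> {X. A X u \<in> M}" using gen[OF Gen_K[of r b]] by (simp add: phi_generators)
  next
    fix i show "gt_d i \<in> {X. A X u \<in> M}"
      using gen[OF Gen_d] d by (cases i) (simp_all add: phi_generators)
  qed
  then show ?thesis by (rule CollectD)
qed

lemma submodule_eq_UNIV:
  assumes M: "cv.subspace M" and gen: "\<And>j X u. X \<in> Gen j \<Longrightarrow> u \<in> M \<Longrightarrow> act X u \<in> M"
    and d: "\<And>i u. u \<in> M \<Longrightarrow> act (tau_d (Some i)) u \<in> M" and u: "u \<in> M" "u \<noteq> 0"
  shows "M = UNIV"
proof -
  have "actG Z w \<in> M" if w: "w \<in> M" for Z w
  proof (rule gtilde_closed[OF actG_lin1 M])
    show "actG (phi X) w \<in> M" if "X \<in> Gen j" for X j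
      unfolding actG_phi using gen[OF that w] .
    have "actG (phi (tau_d (Some i))) w \<in> M" for i
      unfolding actG_phi by (rule d[OF w])
    then show "actG (gt_d (Some i)) w \<in> M" for i by (simp add: phi_generators)
  qed
  then have "submodule UNIV act M" using M actG_phi by (metis submodule_def)
  then show ?thesis using irreducible u unfolding irreducible_module_def by blast
qed

definition V_deg :: "int ^ 'n \<Rightarrow> 'v set"
  where "V_deg r = {u. \<forall>i. act (tau_d (Some i)) u = (lam (tau_d (Some i)) + of_int (r $ i)) *\<^sub>C u}"

lemma V_deg_subspace: "cv.subspace (V_deg r)"
  unfolding V_deg_def
  by (rule cv.subspaceI)
    (simp_all add: clinear_0[OF act_lin2] clinear_add[OF act_lin2] clinear_scale[OF act_lin2]
      scaleC_add_right mult.commute)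

lemma tau_H_generators: "tau_d i \<in> tau_H h" "tau_K 0 i 1 \<in> tau_H h"
  unfolding tau_H_def by (rule cv.span_base; blast)+

lemma v_in_V_deg: "v \<in> V_deg 0"
  using weight_spaceD[OF v_weight tau_H_generators(1)] by (simp add: V_deg_def)

lemma V_deg_act:
  assumes "tau_bracket br form (tau_d (Some i)) X = of_int m *\<^sub>C X"
    and "act (tau_d (Some i)) u = a *\<^sub>C u"
  shows "act (tau_d (Some i)) (act X u) = (a + of_int m) *\<^sub>C act X u"
  using act_bracket[of "tau_d (Some i)" X u]
  by (simp add: assms clinear_scale[OF act_lin2] clinear_scale[OF act_lin1] diff_eq_eq scaleC_add_left add.commute)

lemma V_deg_X: "u \<in> V_deg s \<Longrightarrow> act (tau_X x (k, r) b) u \<in> V_deg (r + s)"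
  and V_deg_K: "u \<in> V_deg s \<Longrightarrow> act (tau_K (k, r) j b) u \<in> V_deg (r + s)"
  and V_deg_d: "u \<in> V_deg s \<Longrightarrow> act (tau_d j) u \<in> V_deg s"
proof -
  note gens = tau_bracket_generators[OF br_bilinear form_bilinear]
  assume "u \<in> V_deg s"
  then have u: "act (tau_d (Some i)) u = (lam (tau_d (Some i)) + of_int (s $ i)) *\<^sub>C u" for i
    by (simp add: V_deg_def)
  show "act (tau_X x (k, r) b) u \<in> V_deg (r + s)"
    using V_deg_act[OF gens(4) u] by (simp add: V_deg_def add.assoc add.commute[of _ "of_int (r $ _)"])
  show "act (tau_K (k, r) j b) u \<in> V_deg (r + s)"
    using V_deg_act[OF gens(5) u] by (simp add: V_deg_def add.assoc add.commute[of _ "of_int (r $ _)"])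
  have "tau_bracket br form (tau_d (Some i)) (tau_d j) = of_int 0 *\<^sub>C tau_d j" for i
    by (simp add: gens(6))
  from V_deg_act[OF this u] show "act (tau_d j) u \<in> V_deg s"
    by (simp add: V_deg_def)
qed

lemma V_deg_Gen: "X \<in> Gen j \<Longrightarrow> \<exists>r. \<forall>s. \<forall>u\<in>V_deg s. act X u \<in> V_deg (r + s)"
proof (erule Gen_cases)
  assume "X = tau_d None"
  then show ?thesis using V_deg_d by (intro exI[of _ 0]) simp
qed (use V_deg_X V_deg_K in blast)+

text \<open>\<open>G\<close> alone generates the module, although it does not contain the \<open>d\<^sub>i\<close>: the span of the homogeneous
  elements of \<open>M\<close> is stable under the generators and under the \<open>d\<^sub>i\<close>, and it contains \<open>v\<close>.\<close>

lemma generated_by_v: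
  assumes M: "cv.subspace M" and gen: "\<And>j X u. X \<in> Gen j \<Longrightarrow> u \<in> M \<Longrightarrow> act X u \<in> M" and v: "v \<in> M"
  shows "M = UNIV"
proof -
  let ?H = "\<Union>r. M \<inter> V_deg r"
  have lin: "act X u \<in> cv.span ?H" if "\<And>u. u \<in> ?H \<Longrightarrow> act X u \<in> ?H" "u \<in> cv.span ?H" for X u
  proof -
    have "cv.span ?H \<subseteq> {u. act X u \<in> cv.span ?H}"
      by (rule cv.span_minimal[OF _ subspace_vimage[OF act_lin2 cv.subspace_span]])
        (use that(1) cv.span_base in blast)
    then show ?thesis using that(2) by blast
  qed
  have "cv.span ?H = UNIV"
  proof (rule submodule_eq_UNIV[OF cv.subspace_span])
    show "act X u \<in> cv.span ?H" if "X \<in> Gen j" "u \<in> cv.span ?H" for j X u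
      using V_deg_Gen[OF that(1)] gen[OF that(1)] by (intro lin[OF _ that(2)]) blast
    show "act (tau_d (Some i)) u \<in> cv.span ?H" if "u \<in> cv.span ?H" for i u
    proof (rule lin[OF _ that])
      fix w assume "w \<in> ?H"
      then obtain r where r: "w \<in> M" "w \<in> V_deg r" by blast
      then have "act (tau_d (Some i)) w \<in> M"
        using cv.subspace_scale[OF M] by (simp add: V_deg_def)
      then show "act (tau_d (Some i)) w \<in> ?H" using V_deg_d[OF r(2)] by blast
    qed
    show "v \<in> cv.span ?H" using v v_in_V_deg by (intro cv.span_base) blast
  qed (rule v_nz)
  moreover have "cv.span ?H \<subseteq> M" by (rule cv.span_minimal[OF _ M]) blast
  ultimately show ?thesis by blast
qed

lemma V_deg_span: "cv.span (\<Union>r. V_deg r) = UNIV"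
proof (rule generated_by_v[OF cv.subspace_span])
  show "act X u \<in> cv.span (\<Union>r. V_deg r)" if "X \<in> Gen j" "u \<in> cv.span (\<Union>r. V_deg r)" for j X u
  proof -
    have "cv.span (\<Union>r. V_deg r) \<subseteq> {u. act X u \<in> cv.span (\<Union>r. V_deg r)}"
      by (rule cv.span_minimal[OF _ subspace_vimage[OF act_lin2 cv.subspace_span]])
        (use V_deg_Gen[OF that(1)] cv.span_base in blast)
    then show ?thesis using that(2) by blast
  qed
  show "v \<in> cv.span (\<Union>r. V_deg r)" using v_in_V_deg by (intro cv.span_base) blast
qed

text \<open>Applying \<open>d\<^sub>i - (\<alpha>\<^sub>i + q\<^sub>i)\<close> removes the component of degree \<open>q\<close> and rescales the others, nontrivially
  for degrees that differ from \<open>q\<close> in the \<open>i\<close>-th coordinate.\<close>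

lemma sum_homogeneous_eq_0:
  assumes "finite J" and "\<And>r. r \<in> J \<Longrightarrow> u r \<in> V_deg r" and "(\<Sum>r\<in>J. u r) = 0" and "r \<in> J"
  shows "u r = 0"
  using assms
proof (induction J arbitrary: u r rule: finite_induct)
  case (insert q J)
  have J: "u r = 0" if r: "r \<in> J" for r
  proof -
    have "r \<noteq> q" using r insert.hyps by blast
    then obtain i where i: "r $ i \<noteq> q $ i" by (auto simp: vec_eq_iff)
    have eig: "act (tau_d (Some i)) (u s) - (lam (tau_d (Some i)) + of_int (q $ i)) *\<^sub>C u s
        = of_int (s $ i - q $ i) *\<^sub>C u s" if "s \<in> insert q J" for s
      using insert.prems(1)[OF that] by (simp add: V_deg_def scaleC_add_left cv.scale_left_diff_distrib)
    have "(\<Sum>s\<in>insert q J. of_int (s $ i - q $ i) *\<^sub>C u s)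
        = act (tau_d (Some i)) (\<Sum>s\<in>insert q J. u s) - (lam (tau_d (Some i)) + of_int (q $ i)) *\<^sub>C (\<Sum>s\<in>insert q J. u s)"
      unfolding clinear_sum[OF act_lin2] cv.scale_sum_right sum_subtractf[symmetric]
      by (rule sum.cong) (simp_all only: eig)
    also have "\<dots> = 0" unfolding insert.prems(2) by (simp add: clinear_0[OF act_lin2])
    also have "(\<Sum>s\<in>insert q J. of_int (s $ i - q $ i) *\<^sub>C u s) = (\<Sum>s\<in>J. of_int (s $ i - q $ i) *\<^sub>C u s)"
      by (rule sum.mono_neutral_right) (use insert.hyps in auto)
    finally have "(\<Sum>s\<in>J. of_int (s $ i - q $ i) *\<^sub>C u s) = 0" .
    note sum_J = this
    have "of_int (s $ i - q $ i) *\<^sub>C u s \<in> V_deg s" if "s \<in> J" for s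
      using insert.prems(1) that by (intro cv.subspace_scale[OF V_deg_subspace]) simp
    from insert.IH[where u = "\<lambda>s. of_int (s $ i - q $ i) *\<^sub>C u s", OF this sum_J r]
    have "of_int (r $ i - q $ i) *\<^sub>C u r = 0" .
    then show ?thesis using i by (simp only: cv.scale_eq_0_iff of_int_eq_0_iff) simp
  qed
  then have "u q = 0" using insert.prems(2) insert.hyps by simp
  then show ?case using J insert.prems(3) by blast
qed simp

end

section \<open>The quotient by a maximal submodule\<close>

locale highest_weight_quotient = graded_tau_module br form h \<Theta> act \<rho> N actG lam v
  for br :: "'g::cvs \<Rightarrow> 'g \<Rightarrow> 'g" and form h \<Theta>
    and act :: "('g, 'n::finite, 'b::comm_calg) tau \<Rightarrow> 'v::cvs \<Rightarrow> 'v"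
    and \<rho> N actG lam v +
  fixes W :: "'v set" and \<pi> :: "'v \<Rightarrow> 'w::cvs"
    and actW :: "('g, 'n, 'b) gtilde \<Rightarrow> 'w \<Rightarrow> 'w"
  assumes W_maximal: "maximal_proper_submodule G_sub actG W"
    and \<pi>_quotient: "quotient_map W \<pi>"
    and actW_def: "actW = quotient_act \<pi> actG"
    and fin_weights: "\<And>\<mu>. \<mu> \<in> dual_space (gt_H0 h) \<Longrightarrow> fin_dim (weight_space actW (gt_H0 h) \<mu>)"
begin

lemma \<pi>_linear: "clinear \<pi>" and \<pi>_surj: "surj \<pi>" and \<pi>_eq_0_iff: "\<pi> u = 0 \<longleftrightarrow> u \<in> W"
  using \<pi>_quotient by (auto simp: quotient_map_def)

lemma actW_\<pi>:
  assumes X: "X \<in> G_sub"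
  shows "actW X (\<pi> u) = \<pi> (actG X u)"
proof -
  have W: "submodule G_sub actG W" using W_maximal by (simp add: maximal_proper_submodule_def)
  have "\<pi> (inv \<pi> (\<pi> u) - u) = 0"
    by (simp add: clinear_diff[OF \<pi>_linear] surj_f_inv_f[OF \<pi>_surj])
  then have "inv \<pi> (\<pi> u) - u \<in> W" by (simp only: \<pi>_eq_0_iff)
  then have "actG X (inv \<pi> (\<pi> u) - u) \<in> W" using W X unfolding submodule_def by blast
  then have "\<pi> (actG X (inv \<pi> (\<pi> u)) - actG X u) = 0"
    by (simp add: \<pi>_eq_0_iff clinear_diff[OF actG_lin2])
  then show ?thesis by (simp add: actW_def quotient_act_def clinear_diff[OF \<pi>_linear])
qed

lemma actW_lin1: "clinear (\<lambda>X. actW X w)"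
  unfolding actW_def quotient_act_def by (rule clinear_compose[OF actG_lin1 \<pi>_linear])

lemma actW_lin2:
  assumes X: "X \<in> G_sub"
  shows "clinear (actW X)"
proof (rule clinearI)
  fix w w' c
  obtain u u' where "w = \<pi> u" "w' = \<pi> u'" using surjD[OF \<pi>_surj, of w] surjD[OF \<pi>_surj, of w'] by blast
  then show "actW X (w + w') = actW X w + actW X w'" "actW X (c *\<^sub>C w) = c *\<^sub>C actW X w"
    by (simp_all add: actW_\<pi>[OF X] clinear_add[OF \<pi>_linear, symmetric] clinear_scale[OF \<pi>_linear, symmetric]
        clinear_add[OF actG_lin2] clinear_scale[OF actG_lin2])
qed

lemma actW_Gen: "X \<in> Gen j \<Longrightarrow> actW (phi X) (\<pi> u) = \<pi> (act X u)"
  by (simp add: actW_\<pi>[OF phi_Gen_in_G_sub] actG_phi)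

text \<open>The homogeneous generators span \<open>G\<close>, so the preimage of \<open>M\<close> is a \<open>G\<close>-submodule; it is strictly
  larger than \<open>W\<close>, and \<open>W\<close> is maximal.\<close>

lemma W_irreducible:
  assumes M: "cv.subspace M" and gen: "\<And>j X w. X \<in> Gen j \<Longrightarrow> w \<in> M \<Longrightarrow> actW (phi X) w \<in> M"
    and w: "w \<in> M" "w \<noteq> 0"
  shows "M = UNIV"
proof -
  let ?M = "{u. \<pi> u \<in> M}"
  have sub: "cv.subspace ?M" by (rule subspace_vimage[OF \<pi>_linear M])
  have "actG X u \<in> ?M" if "X \<in> G_sub" "u \<in> ?M" for X u
  proof (rule G_sub_closed[OF actG_lin1 sub _ that(1)])
    show "actG (phi X) u \<in> ?M" if "X \<in> Gen j" for j X
      using gen[OF that, of "\<pi> u"] \<open>u \<in> ?M\<close> by (simp add: actW_Gen[OF that] actG_phi)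
  qed
  then have "submodule G_sub actG ?M" using sub by (simp add: submodule_def)
  moreover have "W \<subseteq> ?M"
  proof
    fix u assume "u \<in> W"
    then have "\<pi> u = 0" by (simp only: \<pi>_eq_0_iff)
    then show "u \<in> ?M" using cv.subspace_0[OF M] by simp
  qed
  ultimately have "?M = W \<or> ?M = UNIV" using W_maximal unfolding maximal_proper_submodule_def by blast
  moreover obtain u where u: "w = \<pi> u" using surjD[OF \<pi>_surj] by blast
  moreover have "u \<notin> W" using w(2) \<pi>_eq_0_iff[of u] by (simp add: u)
  moreover have "u \<in> ?M" using w(1) by (simp add: u)
  ultimately have "?M = UNIV" by blast
  then have "\<pi> u \<in> M" for u by blast
  then show ?thesis using \<pi>_surj by (metis UNIV_eq_I surjD)
qed

text \<open>By invariance \<open>- m (x, y) = ([x, \<rho>], y) = (x, [\<rho>, y]) = m' (x, y)\<close>.  Hence the central term of a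
  bracket of generators has the degree of the bracket.\<close>

lemma form_eigen:
  assumes x: "x \<in> ad_eigenspace br \<rho> m" and y: "y \<in> ad_eigenspace br \<rho> m'" and "form x y \<noteq> 0"
  shows "m + m' = 0"
proof -
  have "form (br x \<rho>) y = form x (br \<rho> y)" using form unfolding invariant_form_def by blast
  moreover have "br x \<rho> = (- of_int m) *\<^sub>C x"
    using x lie_algebraD(3)[OF lie, of x \<rho>] by (simp add: ad_eigenspace_def)
  moreover have "br \<rho> y = of_int m' *\<^sub>C y" using y by (simp add: ad_eigenspace_def)
  ultimately have "- of_int m * form x y = of_int m' * form x y"
    by (simp only: clinear_scale[OF cbilinearD(1)[OF form_bilinear]]
        clinear_scale[OF cbilinearD(2)[OF form_bilinear]] scaleC_complex_def)
  then have "of_int (m + m') * form x y = 0" by (simp add: distrib_right add_eq_0_iff)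
  then show ?thesis using \<open>form x y \<noteq> 0\<close> by (simp only: mult_eq_0_iff of_int_eq_0_iff) simp
qed

lemma eig_bracket:
  assumes x: "x \<in> ad_eigenspace br \<rho> m" and y: "y \<in> ad_eigenspace br \<rho> m'"
  shows "br x y \<in> ad_eigenspace br \<rho> (m + m')"
proof -
  have "br \<rho> (br x y) = br (br \<rho> x) y + br x (br \<rho> y)" by (rule lie_algebraD(4)[OF lie])
  also have "\<dots> = of_int m *\<^sub>C br x y + of_int m' *\<^sub>C br x y"
    using x y by (simp add: ad_eigenspace_def clinear_scale[OF br_lin1] clinear_scale[OF br_lin2])
  finally show ?thesis by (simp add: ad_eigenspace_def scaleC_add_left)
qed

lemma act_bracket_XX:
  "act (tau_X x (k, r) b) (act (tau_X y (k', r') b') u) - act (tau_X y (k', r') b') (act (tau_X x (k, r) b) u)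
    = act (tau_X (br x y) (k + k', r + r') (b * b')) u
      + (form x y * of_int k) *\<^sub>C act (tau_K (k + k', r + r') None (b * b')) u"
proof -
  have "(\<Sum>i\<in>UNIV. of_int (deg (k, r) i) *\<^sub>C act (tau_K (k + k', r + r') i (b * b')) u)
      = (\<Sum>i\<in>UNIV. if i = (None :: 'n option) then of_int k *\<^sub>C act (tau_K (k + k', r + r') None (b * b')) u else 0)"
  proof (rule sum.cong)
    show "of_int (deg (k, r) i) *\<^sub>C act (tau_K (k + k', r + r') i (b * b')) u
      = (if i = None then of_int k *\<^sub>C act (tau_K (k + k', r + r') None (b * b')) u else 0)" for i :: "'n option"
      by (cases i) (simp_all add: act_K_Some)
  qed simp
  then show ?thesis
    by (simp add: act_bracket tau_bracket_X clinear_add[OF act_lin1] clinear_scale[OF act_lin1]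
        clinear_sum[OF act_lin1])
qed

lemma act_K_commute:
  "act (tau_K k i b) (act (U, 0) u) = act (U, 0) (act (tau_K k i b) u)"
  using act_bracket[of "tau_K k i b" "(U, 0)" u] tau_bracket_generators(2)[OF br_bilinear form_bilinear, of k i b U]
  by (simp add: clinear_0[OF act_lin1])

lemma act_d_commutator:
  "act (tau_d None) (act (tau_X x (k, r) b) u) - act (tau_X x (k, r) b) (act (tau_d None) u)
    = of_int k *\<^sub>C act (tau_X x (k, r) b) u"
  "act (tau_d None) (act (tau_K (k, r) i b) u) - act (tau_K (k, r) i b) (act (tau_d None) u)
    = of_int k *\<^sub>C act (tau_K (k, r) i b) u"
  by (simp_all add: act_bracket tau_bracket_generators(4,5)[OF br_bilinear form_bilinear]
      clinear_scale[OF act_lin1])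

text \<open>The central term of a bracket of two loop generators acts nontrivially only if the exponents of
  \<open>t\<^sub>0\<close> cancel, and then by \<open>form_eigen\<close> the total degree is zero, the degree of \<open>K\<^sub>0 \<otimes> t\<^sup>r \<otimes> b\<close>.\<close>

lemma act_Gen_bracket:
  assumes X: "X \<in> Gen i" and Y: "Y \<in> Gen j"
  shows "act X (act Y u) - act Y (act X u) \<in> cv.span {act Z u | Z. Z \<in> Gen (i + j)}" (is "_ \<in> ?S (i + j)")
proof -
  have base: "act Z u \<in> ?S j" if "Z \<in> Gen j" for Z j using that by (intro cv.span_base) blast
  have flip: "act X (act Y u) - act Y (act X u) \<in> ?S (i + j)"
    if "act Y (act X u) - act X (act Y u) \<in> ?S (j + i)" for X Y i j
    using cv.span_neg[OF that] by (simp add: add.commute)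
  have K_comm: "act X (act Y u) - act Y (act X u) \<in> ?S (i + j)"
    if "X = tau_K (0, r) None b" "Y \<in> Gen j" for X Y r b i j
    using that(2)
  proof (cases rule: Gen_cases)
    case (X x m k r' b')
    then show ?thesis by (simp add: that(1) act_K_commute tau_X_def cv.span_zero)
  next
    case (K r' b')
    then show ?thesis
      using act_K_commute[of "(0, r)" None b "(0, zK (0, r') None) \<otimes> b'"] 
      by (simp add: that(1) tau_K_def[of _ _ b'] cv.span_zero)
  next
    case d
    then show ?thesis
      using act_d_commutator(2)[of 0 r None b u] by (simp add: that(1) cv.span_zero)
  qed
  have d_comm: "act X (act Y u) - act Y (act X u) \<in> ?S (i + j)"
    if "X = tau_d None" "i = 0" "Y \<in> Gen j" for X Y i j
    using that(3)
  proof (cases rule: Gen_cases)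
    case (X x m k r b)
    then show ?thesis
      using cv.span_scale[OF base[OF that(3)], of "of_int k"] by (simp add: that act_d_commutator)
  next
    case (K r b)
    then show ?thesis using act_d_commutator(2)[of 0 r None b u] by (simp add: that(1) cv.span_zero)
  next
    case d
    then show ?thesis by (simp add: that(1) cv.span_zero)
  qed
  from X show ?thesis
  proof (cases rule: Gen_cases)
    case X: (X x m k r b)
    from Y show ?thesis
    proof (cases rule: Gen_cases)
      case Y: (X y m' k' r' b')
      have "tau_X (br x y) (k + k', r + r') (b * b') \<in> Gen (i + j)"
        using Gen_X[OF eig_bracket[OF X(2) Y(2)], of "k + k'" "r + r'" "b * b'"]
        by (simp add: X(3) Y(3) algebra_simps)
      moreover have "(form x y * of_int k) *\<^sub>C act (tau_K (k + k', r + r') None (b * b')) u \<in> ?S (i + j)"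
      proof (cases "form x y = 0 \<or> k + k' \<noteq> 0")
        case True
        then show ?thesis by (auto simp: act_K_None cv.span_zero)
      next
        case False
        then have kk: "k + k' = 0" and "m + m' = 0" using form_eigen[OF X(2) Y(2)] by auto
        then have "i + j = 0" by (simp add: X(3) Y(3)) (metis add.commute add.left_commute add_0 distrib_right mult_zero_left)
        then show ?thesis unfolding kk by (intro cv.span_scale base) (simp add: Gen_K)
      qed
      ultimately show ?thesis
        unfolding X(1) Y(1) act_bracket_XX by (intro cv.span_add base)
    next
      case K: (K r' b')
      show ?thesis by (rule flip, rule K_comm[OF K(1) \<open>X \<in> Gen i\<close>])
    next
      case d: d
      show ?thesis by (rule flip, rule d_comm[OF d \<open>X \<in> Gen i\<close>])
    qed
  next
    case K: (K r b)
    show ?thesis by (rule K_comm[OF K(1) Y])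
  next
    case d: d
    show ?thesis by (rule d_comm[OF d Y])
  qed
qed

lemma degree_signs:
  assumes x: "x \<in> ad_eigenspace br \<rho> m" "x \<noteq> 0"
  shows "k * N + m > 0 \<Longrightarrow> k > 0 \<or> k = 0 \<and> m > 0" and "k * N + m = 0 \<Longrightarrow> k = 0 \<and> m = 0"
proof -
  have N: "\<bar>m\<bar> < N" by (rule eig_bound[OF x])
  have neg: "k * N + m < 0" if "k < 0"
  proof -
    have "k * N \<le> (-1) * N" using that N by (intro mult_right_mono) auto
    then show ?thesis using N by linarith
  qed
  have pos: "k * N + m > 0" if "k > 0"
  proof -
    have "1 * N \<le> k * N" using that N by (intro mult_right_mono) auto
    then show ?thesis using N by linarith
  qed
  show "k * N + m > 0 \<Longrightarrow> k > 0 \<or> k = 0 \<and> m > 0"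
    and "k * N + m = 0 \<Longrightarrow> k = 0 \<and> m = 0"
    using neg pos by (cases k "0::int" rule: linorder_cases; simp)+
qed

lemma act_X_zero: "act (tau_X 0 k b) u = 0"
  using clinear_0[OF act_X_linear, of k b u] .

text \<open>A generator \<open>x \<otimes> t\<^sub>0\<^sup>k t\<^sup>r \<otimes> b\<close> with \<open>x = 0\<close> is assigned many degrees, zero possibly among them
  although \<open>k \<noteq> 0\<close>; asking for a nonzero action excludes it, and \<open>N\<close> then forces \<open>k = 0\<close>.\<close>

lemma Gen_0_cases:
  assumes "X \<in> Gen 0" and "\<exists>u. act X u \<noteq> 0"
  obtains (X) x r b where "X = tau_X x (0, r) b" "x \<in> h"
    | (K) r b where "X = tau_K (0, r) None b"
    | (d) "X = tau_d None"
  using assms(1)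
proof (cases rule: Gen_cases)
  case (X x m k r b)
  have "x \<noteq> 0" using assms(2) X(1) act_X_zero by auto
  then have "k = 0 \<and> m = 0" using degree_signs(2)[OF X(2)] X(3) by simp
  then show thesis using that(1) X(1,2) eig_0 by blast
qed (use that in blast)+

text \<open>The Cartan subalgebra is abelian, and the cocycle \<open>k (x, y) K\<^sub>0\<close> vanishes since the exponent \<open>k\<close> of
  \<open>t\<^sub>0\<close> is zero.\<close>

lemma act_Gen_0_commute:
  assumes X: "X \<in> Gen 0" and Y: "Y \<in> Gen 0"
  shows "act X (act Y u) = act Y (act X u)"
proof (cases "(\<exists>u. act X u \<noteq> 0) \<and> (\<exists>u. act Y u \<noteq> 0)")
  case False
  then consider "\<And>u. act X u = 0" | "\<And>u. act Y u = 0" by blast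
  then show ?thesis by cases (simp_all add: clinear_0[OF act_lin2])
next
  case True
  have d: "act (tau_d None) (act Y u) = act Y (act (tau_d None) u)"
    if "Y \<in> Gen 0" "\<exists>u. act Y u \<noteq> 0" for Y
    using that
  proof (cases rule: Gen_0_cases)
    case (X x r b)
    then show ?thesis using act_d_commutator(1)[of x 0 r b u] by simp
  next
    case (K r b)
    then show ?thesis using act_d_commutator(2)[of 0 r None b u] by simp
  qed simp
  have K: "act (tau_K (0, r) None b) (act Y u) = act Y (act (tau_K (0, r) None b) u)"
    if "Y \<in> Gen 0" "\<exists>u. act Y u \<noteq> 0" for Y r b
    using that
  proof (cases rule: Gen_0_cases)
    case (X x r b)
    then show ?thesis by (simp add: act_K_commute tau_X_def)
  next
    case (K r' b')
    then show ?thesis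
      using act_K_commute[of "(0, r)" None b "(0, zK (0, r') None) \<otimes> b'"]
      by (simp add: tau_K_def[of _ _ b'])
  next
    case d
    then show ?thesis using act_d_commutator(2)[of 0 r None b u] by simp
  qed
  note tX = conjunct1[OF True] and tY = conjunct2[OF True]
  from X tX show ?thesis
  proof (cases rule: Gen_0_cases)
    case X: (X x r b)
    from Y tY show ?thesis
    proof (cases rule: Gen_0_cases)
      case Y: (X y r' b')
      show ?thesis
        using act_bracket_XX[of x 0 r b y 0 r' b' u] cartan_abelian[OF X(2) Y(2)]
        by (simp add: X(1) Y(1) act_X_zero)
    next
      case K': (K r' b')
      then show ?thesis using K[OF \<open>X \<in> Gen 0\<close> tX, of r' b'] by simp
    next
      case d': d
      then show ?thesis using d[OF \<open>X \<in> Gen 0\<close> tX] by simp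
    qed
  next
    case K': (K r b)
    then show ?thesis using K[OF Y tY, of r b] by simp
  next
    case d': d
    then show ?thesis using d[OF Y tY] by simp
  qed
qed

section \<open>The principal operator and the top weight\<close>

definition \<delta> :: "('g, 'n, 'b) tau"
  where "\<delta> = of_int N *\<^sub>C tau_d None + tau_X \<rho> 0 1"

lemma act_\<delta>: "act \<delta> u = of_int N *\<^sub>C act (tau_d None) u + act (tau_X \<rho> 0 1) u"
  by (simp add: \<delta>_def clinear_add[OF act_lin1] clinear_scale[OF act_lin1])

lemma phi_\<delta>_in_G_sub: "phi \<delta> \<in> G_sub"
  by (simp add: \<delta>_def clinear_add[OF phi_generators(1)] clinear_scale[OF phi_generators(1)] zero_prod_def
      phi_generators G_sub_def gt_Y_def gt_d_def scaleC_Pair scaleC_vec_def axis_def scaleC_complex_def)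

lemma act_\<delta>_Gen:
  assumes "X \<in> Gen j"
  shows "act \<delta> (act X u) = act X (act \<delta> u) + of_int j *\<^sub>C act X u"
  using assms
proof (cases rule: Gen_cases)
  case (X x m k r b)
  have "act (tau_X \<rho> 0 1) (act X u) - act X (act (tau_X \<rho> 0 1) u) = of_int m *\<^sub>C act X u"
    using X(2) by (simp add: X(1) act_X0_X ad_eigenspace_def clinear_scale[OF act_X_linear])
  then have 1: "act (tau_X \<rho> 0 1) (act X u) = act X (act (tau_X \<rho> 0 1) u) + of_int m *\<^sub>C act X u"
    by (simp add: diff_eq_eq add.commute)
  have "act (tau_d None) (act X u) - act X (act (tau_d None) u) = of_int k *\<^sub>C act X u"
    by (simp add: X(1) act_d_commutator)
  then have 2: "act (tau_d None) (act X u) = act X (act (tau_d None) u) + of_int k *\<^sub>C act X u"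
    by (simp add: diff_eq_eq add.commute)
  show ?thesis
    by (simp add: act_\<delta> 1 2 clinear_add[OF act_lin2] clinear_scale[OF act_lin2] X(3) scaleC_add_right
        scaleC_add_left mult.commute)
next
  case (K r b)
  have "act (tau_d None) (act X u) = act X (act (tau_d None) u)"
    using act_d_commutator(2)[of 0 r None b u] by (simp add: K(1))
  moreover have "act (tau_X \<rho> 0 1) (act X u) = act X (act (tau_X \<rho> 0 1) u)"
    by (simp add: K(1) act_K_commute tau_X_def)
  ultimately show ?thesis
    by (simp add: act_\<delta> clinear_add[OF act_lin2] clinear_scale[OF act_lin2] K(2))
next
  case d
  have "act (tau_X \<rho> 0 1) (act X u) = act X (act (tau_X \<rho> 0 1) u)"
    using act_d_commutator(1)[of \<rho> 0 0 1 u] by (simp add: d(1) zero_prod_def)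
  then show ?thesis
    by (simp add: act_\<delta> clinear_add[OF act_lin2] clinear_scale[OF act_lin2] d)
qed

lemma W_induct: "(\<And>u. P (\<pi> u)) \<Longrightarrow> P w"
  using surjD[OF \<pi>_surj, of w] by auto

definition W_ops :: "int \<Rightarrow> ('w \<Rightarrow> 'w) set"
  where "W_ops j = (\<lambda>X. actW (phi X)) ` Gen j"

sublocale graded_ops W_ops "actW (phi \<delta>)"
proof (rule graded_ops.intro)
  fix j X assume "X \<in> W_ops j"
  then show "clinear X" using actW_lin2[OF phi_Gen_in_G_sub] by (auto simp: W_ops_def)
next
  fix i j X Y w
  assume "X \<in> W_ops i" "Y \<in> W_ops j"
  then obtain X' Y' where X: "X = actW (phi X')" "X' \<in> Gen i" and Y: "Y = actW (phi Y')" "Y' \<in> Gen j" by (auto simp: W_ops_def)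
  show "X (Y w) - Y (X w) \<in> cv.span {Z w | Z. Z \<in> W_ops (i + j)}" (is "_ \<in> ?S w")
  proof (rule W_induct[where w = w])
    fix u
    have "cv.span {act Z u | Z. Z \<in> Gen (i + j)} \<subseteq> {u'. \<pi> u' \<in> ?S (\<pi> u)}"
    proof (rule cv.span_minimal[OF _ subspace_vimage[OF \<pi>_linear cv.subspace_span]], rule subsetI)
      fix u' assume "u' \<in> {act Z u | Z. Z \<in> Gen (i + j)}"
      then obtain Z where Z: "u' = act Z u" "Z \<in> Gen (i + j)" by blast
      have "\<pi> u' = actW (phi Z) (\<pi> u)" by (simp add: Z(1) actW_Gen[OF Z(2)])
      then have "\<pi> u' \<in> {Z (\<pi> u) | Z. Z \<in> W_ops (i + j)}" using Z(2) by (auto simp: W_ops_def)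
      then show "u' \<in> {u'. \<pi> u' \<in> ?S (\<pi> u)}" by (simp add: cv.span_base)
    qed
    then have "\<pi> (act X' (act Y' u) - act Y' (act X' u)) \<in> ?S (\<pi> u)"
      using act_Gen_bracket[OF X(2) Y(2), of u] by blast
    then show "X (Y (\<pi> u)) - Y (X (\<pi> u)) \<in> ?S (\<pi> u)"
      by (simp add: X(1) Y(1) actW_Gen[OF X(2)] actW_Gen[OF Y(2)] clinear_diff[OF \<pi>_linear])
  qed
next
  fix X Y w
  assume "X \<in> W_ops 0" "Y \<in> W_ops 0"
  then obtain X' Y' where X: "X = actW (phi X')" "X' \<in> Gen 0" and Y: "Y = actW (phi Y')" "Y' \<in> Gen 0" by (auto simp: W_ops_def)
  show "X (Y w) = Y (X w)"
    by (rule W_induct[where w = w])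
      (simp add: X(1) Y(1) actW_Gen[OF X(2)] actW_Gen[OF Y(2)] act_Gen_0_commute[OF X(2) Y(2)])
next
  fix M w
  assume "cv.subspace M" "\<And>j X w. X \<in> W_ops j \<Longrightarrow> w \<in> M \<Longrightarrow> X w \<in> M" "w \<in> M" "w \<noteq> 0"
  then show "M = UNIV" by (intro W_irreducible[of M w]) (auto simp: W_ops_def)
next
  show "clinear (actW (phi \<delta>))" by (rule actW_lin2[OF phi_\<delta>_in_G_sub])
next
  fix j X w
  assume "X \<in> W_ops j"
  then obtain X' where X: "X = actW (phi X')" "X' \<in> Gen j" by (auto simp: W_ops_def)
  show "actW (phi \<delta>) (X w) = X (actW (phi \<delta>) w) + of_int j *\<^sub>C X w"
    by (rule W_induct[where w = w])
      (simp add: X(1) actW_Gen[OF X(2)] actW_\<pi>[OF phi_\<delta>_in_G_sub] actG_phi act_\<delta>_Gen[OF X(2)]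
        clinear_add[OF \<pi>_linear] clinear_scale[OF \<pi>_linear])
qed

text \<open>Otherwise the \<open>G\<close>-submodule \<open>W\<close> would contain the generator \<open>v\<close> of \<open>V\<close>.\<close>

lemma \<pi>_v_nz: "\<pi> v \<noteq> 0"
proof
  assume "\<pi> v = 0"
  then have v: "v \<in> W" by (simp only: \<pi>_eq_0_iff)
  have W: "submodule G_sub actG W" "W \<noteq> UNIV"
    using W_maximal by (auto simp: maximal_proper_submodule_def)
  have "W = UNIV"
  proof (rule generated_by_v[OF _ _ v])
    show "cv.subspace W" using W(1) by (simp add: submodule_def)
    show "act X u \<in> W" if "X \<in> Gen j" "u \<in> W" for j X u
      using W(1) phi_Gen_in_G_sub[OF that(1)] that(2) unfolding submodule_def actG_phi[symmetric] by blast
  qed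
  then show False using W(2) by simp
qed

text \<open>A positive degree means a positive power of \<open>t\<^sub>0\<close>, or no \<open>t\<^sub>0\<close> and a positive height.\<close>

lemma Gen_pos_kills_v:
  assumes "j > 0" and "X \<in> Gen j"
  shows "act X v = 0"
  using assms(2)
proof (cases rule: Gen_cases)
  case (X x m k r b)
  show ?thesis
  proof (cases "x = 0")
    case True
    then show ?thesis by (simp add: X(1) act_X_zero)
  next
    case False
    have "k > 0 \<or> k = 0 \<and> m > 0" using degree_signs(1)[OF X(2) False] X(3) assms(1) by simp
    then have "X \<in> tau_plus (g_plus br h \<Theta>)"
    proof
      assume "k > 0"
      then have "k \<ge> 1" by simp
      then show ?thesis unfolding tau_plus_def X(1) by (intro cv.span_base) blast
    next
      assume "k = 0 \<and> m > 0"
      moreover from this have "x \<in> g_plus br h \<Theta>" using eig_pos X(2) by blast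
      ultimately show ?thesis unfolding tau_plus_def X(1) by (intro cv.span_base) blast
    qed
    then show ?thesis by (rule v_highest)
  qed
qed (use assms(1) in auto)

text \<open>Spanning by generators of degree zero is what makes the Cartan subalgebra commute with all of
  them and act on the image of \<open>v\<close> by scalars.\<close>

lemma gt_H0_generators:
  fixes P :: "('g, 'n, 'b) gtilde \<Rightarrow> bool"
  assumes sub: "cv.subspace {X. P X}"
    and gen: "\<And>X. X \<in> Gen 0 \<Longrightarrow> X \<in> tau_H h \<Longrightarrow> P (phi X)" and X: "X \<in> gt_H0 h"
  shows "P X"
proof -
  have h: "x \<in> ad_eigenspace br \<rho> 0" if "x \<in> h" for x
    using cartan_abelian[OF \<rho>_in_h that] by (simp add: ad_eigenspace_def)
  have "P (gt_Y (x \<otimes> lmon 0, 0) 0 1)" if "x \<in> h" for x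
    using gen[of "tau_X x 0 1"] Gen_X[OF h[OF that], of 0 0 1] cartan_in_H[OF that]
    by (simp add: zero_prod_def phi_generators)
  moreover have "P (gt_Y (0, 1) 0 1)"
    using gen[of "tau_K 0 None 1"] Gen_K[of 0 1] tau_H_generators(2)[of None]
    by (simp add: zero_prod_def phi_generators)
  moreover have "P (gt_d None)"
    using gen[OF Gen_d tau_H_generators(1)] by (simp add: phi_generators)
  ultimately have "gt_H0 h \<subseteq> {X. P X}"
    unfolding gt_H0_def by (intro cv.span_minimal[OF _ sub]) auto
  then show ?thesis using X by auto
qed

lemma gt_H0_in_G_sub: "X \<in> gt_H0 h \<Longrightarrow> X \<in> G_sub"
  for X :: "('g, 'n, 'b) gtilde"
proof (rule gt_H0_generators[of "\<lambda>X. X \<in> G_sub"])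
  show "cv.subspace {X. X \<in> (G_sub :: ('g, 'n, 'b) gtilde set)}"
    by (rule cv.subspaceI) (auto simp: G_sub_def scaleC_prod_def scaleC_vec_def)
qed (simp_all add: phi_Gen_in_G_sub)

lemma gt_H0_commutes:
  assumes H: "H \<in> Gen 0" and X: "X \<in> gt_H0 h"
  shows "actW X (actW (phi H) w) = actW (phi H) (actW X w)"
proof (rule gt_H0_generators[OF _ _ X])
  note linH = actW_lin2[OF phi_Gen_in_G_sub[OF H]]
  show "cv.subspace {X. actW X (actW (phi H) w) = actW (phi H) (actW X w)}"
    by (rule cv.subspaceI)
      (simp_all add: clinear_0[OF actW_lin1] clinear_add[OF actW_lin1] clinear_scale[OF actW_lin1]
        clinear_0[OF linH] clinear_add[OF linH] clinear_scale[OF linH])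
  show "actW (phi X) (actW (phi H) w) = actW (phi H) (actW (phi X) w)" if "X \<in> Gen 0" for X
    using Op_0_commute that H by (auto simp: W_ops_def)
qed

text \<open>The weight of \<open>\<pi> v\<close>, extended by zero to be the canonical representative of a functional on
  \<open>gt_H0 h\<close>.\<close>

definition top_weight :: "('g, 'n, 'b) gtilde \<Rightarrow> complex"
  where "top_weight X = (if X \<in> gt_H0 h then SOME c. actW X (\<pi> v) = c *\<^sub>C \<pi> v else 0)"

lemma top_weight: "X \<in> gt_H0 h \<Longrightarrow> actW X (\<pi> v) = top_weight X *\<^sub>C \<pi> v"
proof -
  assume X: "X \<in> gt_H0 h"
  have "\<exists>c. actW X (\<pi> v) = c *\<^sub>C \<pi> v"
  proof (rule gt_H0_generators[OF _ _ X])
    show "cv.subspace {X. \<exists>c. actW X (\<pi> v) = c *\<^sub>C \<pi> v}"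
    proof (rule cv.subspaceI)
      show "0 \<in> {X. \<exists>c. actW X (\<pi> v) = c *\<^sub>C \<pi> v}"
        by (auto simp: clinear_0[OF actW_lin1] intro: exI[of _ 0])
      show "X + Y \<in> {X. \<exists>c. actW X (\<pi> v) = c *\<^sub>C \<pi> v}"
        if "X \<in> {X. \<exists>c. actW X (\<pi> v) = c *\<^sub>C \<pi> v}" "Y \<in> {X. \<exists>c. actW X (\<pi> v) = c *\<^sub>C \<pi> v}" for X Y
        using that scaleC_add_left[symmetric, where x = "\<pi> v"] by (fastforce simp: clinear_add[OF actW_lin1])
      show "c *\<^sub>C X \<in> {X. \<exists>c. actW X (\<pi> v) = c *\<^sub>C \<pi> v}" if "X \<in> {X. \<exists>c. actW X (\<pi> v) = c *\<^sub>C \<pi> v}" for c X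
        using that by (auto simp: clinear_scale[OF actW_lin1])
    qed
    show "\<exists>c. actW (phi X) (\<pi> v) = c *\<^sub>C \<pi> v" if "X \<in> Gen 0" "X \<in> tau_H h" for X
      by (simp add: actW_Gen[OF that(1)] weight_spaceD[OF v_weight that(2)] clinear_scale[OF \<pi>_linear])
  qed
  then show ?thesis unfolding top_weight_def using X someI_ex by simp
qed

lemma top_weight_dual: "top_weight \<in> dual_space (gt_H0 h)"
proof -
  have sub: "cv.subspace (gt_H0 h)" unfolding gt_H0_def by (rule cv.subspace_span)
  have eq: "a = b" if "a *\<^sub>C \<pi> v = b *\<^sub>C \<pi> v" for a b
    using that \<pi>_v_nz cv.scale_right_imp_eq by blast
  show ?thesis
    unfolding dual_space_def
  proof (intro CollectI conjI allI ballI impI)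
    show "top_weight X = 0" if "X \<notin> gt_H0 h" for X using that by (simp add: top_weight_def)
    show "top_weight (X + Y) = top_weight X + top_weight Y" if "X \<in> gt_H0 h" "Y \<in> gt_H0 h" for X Y
      by (rule eq) (simp only: top_weight[OF cv.subspace_add[OF sub that], symmetric] scaleC_add_left
          clinear_add[OF actW_lin1] top_weight[OF that(1)] top_weight[OF that(2)])
    show "top_weight (c *\<^sub>C X) = c * top_weight X" if "X \<in> gt_H0 h" for X c
      by (rule eq) (simp only: top_weight[OF cv.subspace_scale[OF sub that], symmetric] scaleC_scaleC[symmetric]
          clinear_scale[OF actW_lin1] top_weight[OF that])
  qed
qed

lemma act_\<delta>_v: "act \<delta> v = (of_int N * lam (tau_d None) + lam (tau_X \<rho> 0 1)) *\<^sub>C v"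
  by (simp add: act_\<delta> weight_spaceD[OF v_weight tau_H_generators(1)]
      weight_spaceD[OF v_weight cartan_in_H[OF \<rho>_in_h]] scaleC_add_left)

text \<open>The image of \<open>u\<close> is in the top space of the quotient, which is a line.  The finite dimensional
  space required for this is the weight space of \<open>\<pi> v\<close>; it is stable under the generators of degree
  zero because these commute with the Cartan subalgebra.\<close>

lemma top_eigenvector:
  assumes u: "act \<delta> u = (of_int N * lam (tau_d None) + lam (tau_X \<rho> 0 1)) *\<^sub>C u"
  shows "\<exists>c. \<pi> u = c *\<^sub>C \<pi> v"
proof (rule top_space_one_dimensional)
  let ?S = "weight_space actW (gt_H0 h) top_weight"
  show "cv.subspace ?S"
    unfolding weight_space_def
    by (rule cv.subspaceI)
      (auto simp: clinear_0[OF actW_lin2[OF gt_H0_in_G_sub]] clinear_add[OF actW_lin2[OF gt_H0_in_G_sub]]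
        clinear_scale[OF actW_lin2[OF gt_H0_in_G_sub]] scaleC_add_right mult.commute)
  show "fin_dim ?S" by (rule fin_weights[OF top_weight_dual])
  show "X w \<in> ?S" if X: "X \<in> W_ops 0" and w: "w \<in> ?S" for X w
  proof -
    obtain H where H: "X = actW (phi H)" "H \<in> Gen 0" using X by (auto simp: W_ops_def)
    have "actW Y (X w) = top_weight Y *\<^sub>C X w" if Y: "Y \<in> gt_H0 h" for Y
      unfolding H(1) gt_H0_commutes[OF H(2) Y] weight_spaceD[OF w Y]
      by (rule clinear_scale[OF actW_lin2[OF phi_Gen_in_G_sub[OF H(2)]]])
    then show ?thesis unfolding weight_space_def by blast
  qed
  show "\<pi> v \<in> ?S" unfolding weight_space_def using top_weight by blast
  show "\<pi> v \<noteq> 0" by (rule \<pi>_v_nz)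
  show "X (\<pi> v) = 0" if "j > 0" "X \<in> W_ops j" for j X
    using that(2) Gen_pos_kills_v[OF that(1)] by (auto simp: W_ops_def actW_Gen clinear_0[OF \<pi>_linear])
  show "actW (phi \<delta>) (\<pi> v) = (of_int N * lam (tau_d None) + lam (tau_X \<rho> 0 1)) *\<^sub>C \<pi> v"
    by (simp only: actW_\<pi>[OF phi_\<delta>_in_G_sub] actG_phi act_\<delta>_v clinear_scale[OF \<pi>_linear])
  show "actW (phi \<delta>) (\<pi> u) = (of_int N * lam (tau_d None) + lam (tau_X \<rho> 0 1)) *\<^sub>C \<pi> u"
    by (simp only: actW_\<pi>[OF phi_\<delta>_in_G_sub] actG_phi u clinear_scale[OF \<pi>_linear])
qed

section \<open>Central operators on the quotient\<close>

lemma central_operatorD: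
  assumes "central_operator act (0, q) z"
  shows "clinear z" and "X \<in> Gen j \<Longrightarrow> z (act X u) = act X (z u)"
    and "act (tau_d (Some i)) (z u) = z (act (tau_d (Some i)) u) + of_int (q $ i) *\<^sub>C z u"
    and "z (act (tau_X x k b) u) = act (tau_X x k b) (z u)"
proof -
  have loop: "z (act (U, 0) u) = act (U, 0) (z u)" for U u
    using assms unfolding central_operator_def by (metis snd_conv)
  have der: "act (tau_d i) (z u) - z (act (tau_d i) u) = of_int (deg (0, q) i) *\<^sub>C z u" for i u
    using assms unfolding central_operator_def by blast
  show "clinear z" using assms by (simp add: central_operator_def)
  show "z (act (tau_X x k b) u) = act (tau_X x k b) (z u)"
    unfolding tau_X_def by (rule loop)
  show "z (act X u) = act X (z u)" if "X \<in> Gen j"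
    using that
  proof (cases rule: Gen_cases)
    case (X x m k r b)
    then show ?thesis by (simp add: tau_X_def loop)
  next
    case (K r b)
    then show ?thesis by (simp add: tau_K_def loop)
  next
    case d
    then show ?thesis using der[of None u] by simp
  qed
  show "act (tau_d (Some i)) (z u) = z (act (tau_d (Some i)) u) + of_int (q $ i) *\<^sub>C z u"
    using der[of "Some i" u] by (simp add: diff_eq_eq add.commute)
qed

text \<open>The range of \<open>z\<close> is a submodule, since \<open>z\<close> is homogeneous.\<close>

lemma central_surj:
  assumes z: "central_operator act (0, q) z" and nz: "z \<noteq> (\<lambda>_. 0)"
  shows "surj z"
proof -
  note zD = central_operatorD[OF z]
  obtain u where u: "z u \<noteq> 0" using nz by auto
  show ?thesis
  proof (rule submodule_eq_UNIV[OF _ _ _ _ u])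
    show "cv.subspace (range z)"
    proof (rule cv.subspaceI)
      show "0 \<in> range z" using clinear_0[OF zD(1)] by (metis rangeI)
      show "x + y \<in> range z" if "x \<in> range z" "y \<in> range z" for x y
        using that by (auto simp: clinear_add[OF zD(1), symmetric])
      show "c *\<^sub>C x \<in> range z" if "x \<in> range z" for c x
        using that by (auto simp: clinear_scale[OF zD(1), symmetric])
    qed
    show "act X w \<in> range z" if "X \<in> Gen j" "w \<in> range z" for j X w
      using that(2) by (auto simp: zD(2)[OF that(1), symmetric])
    show "act (tau_d (Some i)) w \<in> range z" if "w \<in> range z" for i w
      using that by (auto simp: zD(3) clinear_add[OF zD(1), symmetric] clinear_scale[OF zD(1), symmetric])
  qed simp
qed

lemma central_V_deg:
  assumes z: "central_operator act (0, q) z" and u: "u \<in> V_deg r"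
  shows "z u \<in> V_deg (r + q)"
  using u by (simp add: V_deg_def central_operatorD(3)[OF z] clinear_scale[OF central_operatorD(1)[OF z]]
      clinear_add[OF central_operatorD(1)[OF z]] scaleC_add_left add.assoc)

text \<open>As \<open>z\<close> commutes with \<open>\<delta>\<close>, the image of \<open>z v\<close> is a multiple \<open>c\<close> of \<open>\<pi> v\<close>.  The vectors \<open>u\<close> with
  \<open>\<pi> (z u) = c \<pi> u\<close> form a \<open>G\<close>-submodule containing \<open>v\<close>, so they are all of \<open>V\<close>.\<close>

theorem central_operator_scalar:
  assumes z: "central_operator act (0, q) z" and nz: "z \<noteq> (\<lambda>_. 0)"
  obtains c where "c \<noteq> 0" "\<And>u. \<pi> (z u) = c *\<^sub>C \<pi> u"
proof -
  note zD = central_operatorD[OF z]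
  have "act \<delta> (z v) = z (act \<delta> v)"
    by (simp add: act_\<delta> zD(2)[OF Gen_d] zD(4) clinear_add[OF zD(1)] clinear_scale[OF zD(1)])
  then have "act \<delta> (z v) = (of_int N * lam (tau_d None) + lam (tau_X \<rho> 0 1)) *\<^sub>C z v"
    by (simp only: act_\<delta>_v clinear_scale[OF zD(1)])
  from top_eigenvector[OF this] obtain c where c: "\<pi> (z v) = c *\<^sub>C \<pi> v" by blast
  let ?M = "{u. \<pi> (z u) = c *\<^sub>C \<pi> u}"
  have "?M = UNIV"
  proof (rule generated_by_v)
    show "cv.subspace ?M"
      by (rule cv.subspaceI)
        (simp_all add: clinear_0[OF zD(1)] clinear_add[OF zD(1)] clinear_scale[OF zD(1)]
          clinear_0[OF \<pi>_linear] clinear_add[OF \<pi>_linear] clinear_scale[OF \<pi>_linear] scaleC_add_right mult.commute)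
    show "act X u \<in> ?M" if X: "X \<in> Gen j" and u: "u \<in> ?M" for j X u
    proof -
      have "\<pi> (z (act X u)) = actW (phi X) (\<pi> (z u))" by (simp add: zD(2)[OF X] actW_Gen[OF X])
      also have "\<pi> (z u) = c *\<^sub>C \<pi> u" using u by simp
      finally show ?thesis
        by (simp add: clinear_scale[OF actW_lin2[OF phi_Gen_in_G_sub[OF X]]] actW_Gen[OF X])
    qed
    show "v \<in> ?M" by (simp add: c)
  qed
  then have scal: "\<pi> (z u) = c *\<^sub>C \<pi> u" for u by blast
  moreover have "c \<noteq> 0"
  proof
    assume "c = 0"
    obtain u where "v = z u" using surjD[OF central_surj[OF z nz]] by blast
    then have "\<pi> v = 0" using scal[of u] \<open>c = 0\<close> by simp
    then show False using \<pi>_v_nz by simp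
  qed
  ultimately show thesis by (rule that[rotated])
qed

end

section \<open>Sums of irreducible submodules\<close>

lemma submodule_span_Union:
  assumes lin: "\<And>X. clinear (A X)" and M: "\<And>i. i \<in> I \<Longrightarrow> submodule L A (M i)"
  shows "submodule L A (cv.span (\<Union>i\<in>I. M i))"
  unfolding submodule_def
proof (intro conjI ballI)
  fix X u assume X: "X \<in> L" and u: "u \<in> cv.span (\<Union>i\<in>I. M i)"
  have "cv.span (\<Union>i\<in>I. M i) \<subseteq> {u. A X u \<in> cv.span (\<Union>i\<in>I. M i)}"
  proof (rule cv.span_minimal[OF _ subspace_vimage[OF lin cv.subspace_span]], rule subsetI)
    fix w assume "w \<in> (\<Union>i\<in>I. M i)"
    then have "A X w \<in> (\<Union>i\<in>I. M i)" using M X by (auto simp: submodule_def)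
    then show "w \<in> {u. A X u \<in> cv.span (\<Union>i\<in>I. M i)}" by (simp add: cv.span_base)
  qed
  then show "A X u \<in> cv.span (\<Union>i\<in>I. M i)" using u by blast
qed (rule cv.subspace_span)

text \<open>Irreducible summands are added one at a time; a new one either lies in the sum so far or meets it
  in zero.\<close>

lemma finite_sum_of_irreducibles_direct:
  assumes "finite I" and lin: "\<And>X. clinear (A X)" and "\<And>i. i \<in> I \<Longrightarrow> submodule L A (M i)"
    and "\<And>i S. i \<in> I \<Longrightarrow> submodule L A S \<Longrightarrow> M i \<inter> S \<subseteq> {0} \<or> M i \<subseteq> S"
  shows "\<exists>F\<subseteq>I. direct_sum F M (cv.span (\<Union>i\<in>I. M i))"
  using assms(1,3,4)
proof (induction I rule: finite_induct)
  case empty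
  show ?case by (auto simp: direct_sum_def)
next
  case (insert i I)
  let ?U = "cv.span (\<Union>i\<in>I. M i)"
  obtain F where F: "F \<subseteq> I" "direct_sum F M ?U" using insert by blast
  have U: "submodule L A ?U" by (rule submodule_span_Union[OF lin]) (use insert.prems(1) in blast)
  have sub: "cv.subspace (M i)" using insert.prems(1)[of i] by (simp add: submodule_def)
  have U_F: "?U = cv.span (\<Union>j\<in>F. M j)" using F(2) by (simp add: direct_sum_def)
  have "M i \<inter> ?U \<subseteq> {0} \<or> M i \<subseteq> ?U" by (rule insert.prems(2)[OF insertI1 U])
  then show ?case
  proof
    assume "M i \<subseteq> ?U"
    then have "(\<Union>j\<in>insert i I. M j) \<subseteq> ?U" using cv.span_superset[of "\<Union>j\<in>I. M j"] by blast
    then have "cv.span (\<Union>j\<in>insert i I. M j) \<subseteq> ?U" by (rule cv.span_minimal[OF _ cv.subspace_span])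
    moreover have "?U \<subseteq> cv.span (\<Union>j\<in>insert i I. M j)" by (rule cv.span_mono) blast
    ultimately have "cv.span (\<Union>j\<in>insert i I. M j) = ?U" by (rule equalityI)
    then show ?thesis using F by auto
  next
    assume disj: "M i \<inter> ?U \<subseteq> {0}"
    have indep: "\<forall>j\<in>J. f j = 0"
      if J: "finite J" "J \<subseteq> insert i F" "\<forall>j\<in>J. f j \<in> M j" "(\<Sum>j\<in>J. f j) = 0" for J f
    proof -
      let ?K = "J - {i}"
      have F_indep: "\<forall>j\<in>?K. f j = 0" if "(\<Sum>j\<in>?K. f j) = 0"
      proof -
        have "finite ?K" "?K \<subseteq> F" "\<forall>j\<in>?K. f j \<in> M j" using J by auto
        then show ?thesis using F(2) that unfolding direct_sum_def by blast
      qed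
      show ?thesis
      proof (cases "i \<in> J")
        case False
        then show ?thesis using F_indep J(4) by simp
      next
        case True
        have split: "f i + (\<Sum>j\<in>?K. f j) = 0" using J(1,4) True by (simp add: sum.remove)
        have "(\<Sum>j\<in>?K. f j) \<in> ?U" unfolding U_F
          using J(2,3) by (intro cv.subspace_sum[OF cv.subspace_span] cv.span_base) blast
        then have "- (\<Sum>j\<in>?K. f j) \<in> ?U" by (rule cv.span_neg)
        moreover have "f i = - (\<Sum>j\<in>?K. f j)" using split by (simp add: eq_neg_iff_add_eq_0)
        ultimately have "f i \<in> ?U" by simp
        then have "f i = 0" using disj J(3) True by blast
        then show ?thesis using F_indep split by auto
      qed
    qed
    have "(\<Union>j\<in>insert i I. M j) \<subseteq> cv.span (\<Union>j\<in>insert i F. M j)"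
    proof -
      have "?U \<subseteq> cv.span (\<Union>j\<in>insert i F. M j)" unfolding U_F by (rule cv.span_mono) blast
      then have "M j \<subseteq> cv.span (\<Union>j\<in>insert i F. M j)" if "j \<in> I" for j
        using cv.span_superset[of "\<Union>j\<in>I. M j"] that by blast
      moreover have "M i \<subseteq> cv.span (\<Union>j\<in>insert i F. M j)"
        using cv.span_superset[of "\<Union>j\<in>insert i F. M j"] by blast
      ultimately show ?thesis by blast
    qed
    then have "cv.span (\<Union>j\<in>insert i I. M j) \<subseteq> cv.span (\<Union>j\<in>insert i F. M j)"
      by (rule cv.span_minimal[OF _ cv.subspace_span])
    moreover have "cv.span (\<Union>j\<in>insert i F. M j) \<subseteq> cv.span (\<Union>j\<in>insert i I. M j)"
      by (rule cv.span_mono) (use F(1) in blast)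
    ultimately have "cv.span (\<Union>j\<in>insert i I. M j) = cv.span (\<Union>j\<in>insert i F. M j)" by (rule equalityI)
    moreover have "\<forall>j\<in>insert i F. cv.subspace (M j)" using F(2) sub by (simp add: direct_sum_def)
    ultimately have "direct_sum (insert i F) M (cv.span (\<Union>j\<in>insert i I. M j))"
      using indep unfolding direct_sum_def by blast
    then show ?thesis using F(1) by (intro exI[of _ "insert i F"]) auto
  qed
qed

lemma U_orbit_submodule:
  assumes lin: "\<And>X. clinear (A X)"
  shows "submodule UNIV A (U_orbit A v)" and "v \<in> U_orbit A v"
proof -
  show "submodule UNIV A (U_orbit A v)"
    unfolding submodule_def
  proof (intro conjI ballI)
    fix X u assume "u \<in> U_orbit A v"
    have "U_orbit A v \<subseteq> {u. A X u \<in> U_orbit A v}"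
      unfolding U_orbit_def
    proof (rule cv.span_minimal[OF _ subspace_vimage[OF lin cv.subspace_span]], rule subsetI)
      fix u assume "u \<in> {foldr A xs v | xs. True}"
      then obtain xs where "u = foldr A xs v" by blast
      then have "A X u = foldr A (X # xs) v" by simp
      then have "A X u \<in> {foldr A xs v | xs. True}" by blast
      then show "u \<in> {u. A X u \<in> cv.span {foldr A xs v | xs. True}}" by (simp add: cv.span_base)
    qed
    then show "A X u \<in> U_orbit A v" using \<open>u \<in> U_orbit A v\<close> by blast
  qed (simp add: U_orbit_def)
  have "v = foldr A [] v" by simp
  then have "v \<in> {foldr A xs v | xs. True}" by blast
  then show "v \<in> U_orbit A v" unfolding U_orbit_def by (rule cv.span_base)
qed

lemma U_orbit_minimal:
  assumes M: "submodule UNIV A M" and v: "v \<in> M"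
  shows "U_orbit A v \<subseteq> M"
  unfolding U_orbit_def
proof (rule cv.span_minimal)
  show "cv.subspace M" using M by (simp add: submodule_def)
  have "foldr A xs v \<in> M" for xs
    using M v by (induction xs) (auto simp: submodule_def)
  then show "{foldr A xs v | xs. True} \<subseteq> M" by blast
qed

lemma tensor_laurent_mem:
  assumes S: "cv.subspace S" and gen: "\<And>w s. w \<otimes> lmon s \<in> S"
  shows "t \<in> S"
proof (rule tensor_mem[OF S])
  fix w and p :: "'b \<Rightarrow>\<^sub>0 complex"
  have "p \<in> {p. w \<otimes> p \<in> S}"
    by (rule laurent_mem[OF subspace_vimage[OF tens_linear_right S]]) (simp add: gen)
  then show "w \<otimes> p \<in> S" by simp
qed

text \<open>Taking the coefficient of a monomial is a well-defined map on the tensor product.\<close>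

lemma tens_lmon_nonzero:
  fixes w :: "'w::cvs"
  assumes "w \<noteq> 0" shows "w \<otimes> lmon s \<noteq> 0"
proof
  have bil: "cbilinear (\<lambda>w p. Poly_Mapping.lookup p s *\<^sub>C w)" for s :: 'k
    by (auto simp: cbilinear_def clinear_iff scaleC_add_right scaleC_add_left lookup_add lookup_scaleC
        scaleC_complex_def mult.commute)
  assume "w \<otimes> lmon s = 0"
  then have "tensor_lift (\<lambda>w p. Poly_Mapping.lookup p s *\<^sub>C w) (w \<otimes> lmon s) = 0"
    by (simp only: tensor_lift_0[OF bil])
  then show False using assms by (simp add: tensor_lift_tens[OF bil] scaleC_one)
qed

section \<open>The loop module\<close>

context graded_tau_module
begin

lemma V_deg_unique:
  assumes "clinear A" "clinear B" "\<And>q u. u \<in> V_deg q \<Longrightarrow> A u = B u"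
  shows "A u = B u"
proof -
  have "cv.subspace {u. A u = B u}"
    by (rule cv.subspaceI) (simp_all add: assms(1,2) clinear_0 clinear_add clinear_scale)
  then have "cv.span (\<Union>r. V_deg r) \<subseteq> {u. A u = B u}"
    by (rule cv.span_minimal[rotated]) (use assms(3) in blast)
  then show ?thesis by (auto simp: V_deg_span)
qed

text \<open>Every vector has unique homogeneous components, encoded here as a finitely supported family
  \<open>u\<close> with \<open>P x u\<close>, so linear maps on the \<open>V\<^sub>r\<close> glue to a linear map on \<open>V\<close>.\<close>

lemma V_deg_extension:
  fixes g :: "int ^ 'n \<Rightarrow> 'v \<Rightarrow> 'x::cvs"
  assumes g: "\<And>r. clinear (g r)"
  shows "\<exists>f. clinear f \<and> (\<forall>r. \<forall>u\<in>V_deg r. f u = g r u)"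
proof -
  define P where "P x u \<longleftrightarrow> finite {r. u r \<noteq> 0} \<and> (\<forall>r. u r \<in> V_deg r) \<and> (\<Sum>r | u r \<noteq> 0. u r) = x"
    for x :: 'v and u :: "int ^ 'n \<Rightarrow> 'v"
  define F where "F u = (\<Sum>r | u r \<noteq> 0. g r (u r))" for u :: "int ^ 'n \<Rightarrow> 'v"
  have sum_eq: "(\<Sum>r | u r \<noteq> 0. k r (u r)) = (\<Sum>r\<in>S. k r (u r))"
    if "finite S" "{r. u r \<noteq> 0} \<subseteq> S" "\<And>r. k r 0 = 0"
    for u :: "int ^ 'n \<Rightarrow> 'v" and S and k :: "int ^ 'n \<Rightarrow> 'v \<Rightarrow> 'y::cvs"
    by (rule sum.mono_neutral_left) (use that in auto)
  have F_eq: "F u = (\<Sum>r\<in>S. g r (u r))" if "finite S" "{r. u r \<noteq> 0} \<subseteq> S" for u S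
    unfolding F_def by (rule sum_eq[OF that]) (rule clinear_0[OF g])
  have P_eq: "x = (\<Sum>r\<in>S. u r)" if "P x u" "finite S" "{r. u r \<noteq> 0} \<subseteq> S" for x u S
    using sum_eq[OF that(2,3), of "\<lambda>r x. x"] that(1) by (simp add: P_def)
  have add: "P (x + y) (\<lambda>r. u r + w r) \<and> F (\<lambda>r. u r + w r) = F u + F w" if u: "P x u" and w: "P y w" for x y u w
  proof -
    let ?S = "{r. u r \<noteq> 0} \<union> {r. w r \<noteq> 0}"
    have S: "finite ?S" "{r. u r \<noteq> 0} \<subseteq> ?S" "{r. w r \<noteq> 0} \<subseteq> ?S" "{r. u r + w r \<noteq> 0} \<subseteq> ?S"
      using u w by (auto simp: P_def)
    have "x + y = (\<Sum>r\<in>?S. u r + w r)"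
      using P_eq[OF u S(1,2)] P_eq[OF w S(1,3)] by (simp add: sum.distrib)
    then have "P (x + y) (\<lambda>r. u r + w r)"
      using u w finite_subset[OF S(4,1)] sum_eq[OF S(1,4), of "\<lambda>r x. x"]
      by (simp add: P_def cv.subspace_add[OF V_deg_subspace])
    then show ?thesis
      by (simp add: F_eq[OF S(1,2)] F_eq[OF S(1,3)] F_eq[OF S(1,4)] clinear_add[OF g] sum.distrib)
  qed
  have scale: "P (c *\<^sub>C x) (\<lambda>r. c *\<^sub>C u r) \<and> F (\<lambda>r. c *\<^sub>C u r) = c *\<^sub>C F u" if u: "P x u" for x u c
  proof -
    let ?S = "{r. u r \<noteq> 0}"
    have S: "finite ?S" "?S \<subseteq> ?S" "{r. c *\<^sub>C u r \<noteq> 0} \<subseteq> ?S" using u by (auto simp: P_def)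
    have "c *\<^sub>C x = (\<Sum>r\<in>?S. c *\<^sub>C u r)" using P_eq[OF u S(1,2)] by (simp add: cv.scale_sum_right)
    then have "P (c *\<^sub>C x) (\<lambda>r. c *\<^sub>C u r)"
      using u finite_subset[OF S(3,1)] sum_eq[OF S(1,3), of "\<lambda>r x. x"]
      by (simp only: P_def cv.subspace_scale[OF V_deg_subspace] simp_thms)
    then show ?thesis
      by (simp add: F_eq[OF S(1,2)] F_eq[OF S(1,3)] clinear_scale[OF g] cv.scale_sum_right)
  qed
  have unique: "u = w" if u: "P x u" and w: "P x w" for x u w
  proof
    fix r
    have "P (x + (-1) *\<^sub>C x) (\<lambda>r. u r + (-1) *\<^sub>C w r)" using add[OF u conjunct1[OF scale[OF w]]] by blast
    then have d: "P 0 (\<lambda>r. u r - w r)" by simp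
    show "u r = w r"
    proof (cases "u r - w r = 0")
      case False
      then have "u r - w r = 0"
        using d by (intro sum_homogeneous_eq_0[where J = "{r. u r - w r \<noteq> 0}" and u = "\<lambda>r. u r - w r"])
          (simp_all add: P_def)
      then show ?thesis by simp
    qed simp
  qed
  have single: "P x (\<lambda>q. if q = r then x else 0) \<and> F (\<lambda>q. if q = r then x else 0) = g r x"
    if "x \<in> V_deg r" for x r
  proof -
    have S: "finite {r}" "{q. (if q = r then x else 0) \<noteq> 0} \<subseteq> {r}" by auto
    have "P x (\<lambda>q. if q = r then x else 0)"
      using that finite_subset[OF S(2,1)] sum_eq[OF S, of "\<lambda>r x. x"]
      by (simp add: P_def cv.subspace_0[OF V_deg_subspace])
    then show ?thesis by (simp add: F_eq[OF S])
  qed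
  have "\<exists>u. P x u" for x
  proof -
    have "cv.subspace {x. \<exists>u. P x u}"
    proof (rule cv.subspaceI)
      have "P 0 (\<lambda>_. 0)" by (simp add: P_def cv.subspace_0[OF V_deg_subspace])
      then show "0 \<in> {x. \<exists>u. P x u}" by blast
      show "x + y \<in> {x. \<exists>u. P x u}" if "x \<in> {x. \<exists>u. P x u}" "y \<in> {x. \<exists>u. P x u}" for x y
        using that add by blast
      show "c *\<^sub>C x \<in> {x. \<exists>u. P x u}" if "x \<in> {x. \<exists>u. P x u}" for c x
        using that scale by blast
    qed
    then have "cv.span (\<Union>r. V_deg r) \<subseteq> {x. \<exists>u. P x u}"
      by (rule cv.span_minimal[rotated]) (use single in blast)
    then show ?thesis by (auto simp: V_deg_span)
  qed
  then obtain comp where comp: "\<And>x. P x (comp x)" by metis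
  have comp_eq: "comp x = u" if "P x u" for x u by (rule unique[OF comp that])
  have "clinear (\<lambda>x. F (comp x))"
  proof (rule clinearI)
    fix x y c
    show "F (comp (x + y)) = F (comp x) + F (comp y)"
      using add[OF comp[of x] comp[of y]] comp_eq by metis
    show "F (comp (c *\<^sub>C x)) = c *\<^sub>C F (comp x)"
      using scale[OF comp[of x], of c] comp_eq by metis
  qed
  moreover have "F (comp x) = g r x" if "x \<in> V_deg r" for x r
    using single[OF that] comp_eq by metis
  ultimately show ?thesis by blast
qed

end

locale loop_module = highest_weight_quotient br form h \<Theta> act \<rho> N actG lam v W \<pi> actW
  for br :: "'g::cvs \<Rightarrow> 'g \<Rightarrow> 'g" and form h \<Theta>
    and act :: "('g, 'n::finite, 'b::comm_calg) tau \<Rightarrow> 'v::cvs \<Rightarrow> 'v"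
    and \<rho> N actG lam v W
    and \<pi> :: "'v \<Rightarrow> 'w::cvs" and actW +
  fixes actT :: "('g, 'n, 'b) gtilde \<Rightarrow> ('w, 'n laurent_n) tensor \<Rightarrow> ('w, 'n laurent_n) tensor"
  assumes actT_def: "actT = rho actW (\<lambda>i. lam (tau_d (Some i)))"
begin

lemma actW_add: "X \<in> G_sub \<Longrightarrow> Y \<in> G_sub \<Longrightarrow> actW (X + Y) u = actW X u + actW Y u"
  and actW_scale: "X \<in> G_sub \<Longrightarrow> actW (c *\<^sub>C X) u = c *\<^sub>C actW X u"
  by (simp_all add: clinear_add[OF actW_lin1] clinear_scale[OF actW_lin1])

lemma actT_lin2: "clinear (actT X)"
  unfolding actT_def rho_def
  by (rule tensor_lift_linear[OF rho_aux3]) (fact actW_add actW_scale actW_lin2)+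

lemma actT_tens:
  "actT X (u \<otimes> lmon s) =
    tensor_lift (\<lambda>h b. tensor_lift (\<lambda>y.
        lin_ext (\<lambda>r. actW (gt_Y y r b) u \<otimes> (lmon r * lmon s))) h) (fst X)
      + snd X $ None *\<^sub>C (actW (gt_d None) u \<otimes> lmon s)
      + (\<Sum>i\<in>UNIV. snd X $ Some i * (lam (tau_d (Some i)) + of_int (s $ i))) *\<^sub>C (u \<otimes> lmon s)"
  unfolding actT_def
  by (rule rho_tens) (fact actW_add actW_scale actW_lin2)+

lemma actT_lin1: "clinear (\<lambda>X. actT X t)"
proof -
  have bil: "cbilinear (\<lambda>h b. tensor_lift (\<lambda>y. lin_ext (\<lambda>r. actW (gt_Y y r b) u \<otimes> (lmon r * p))) h)"
    for u :: 'w and p :: "'n laurent_n"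
    by (rule rho_aux2) (fact actW_add actW_scale actW_lin2)+
  have gen: "actT (X + Y) (u \<otimes> lmon s) = actT X (u \<otimes> lmon s) + actT Y (u \<otimes> lmon s)"
    "actT (c *\<^sub>C X) (u \<otimes> lmon s) = c *\<^sub>C actT X (u \<otimes> lmon s)" for X Y c u s
    unfolding actT_tens
    by (simp_all add: clinear_add[OF tensor_lift_linear[OF bil]] clinear_scale[OF tensor_lift_linear[OF bil]]
        scaleC_add_left scaleC_add_right sum.distrib distrib_right scaleC_prod_def scaleC_vec_def
        scaleC_complex_def mult.assoc sum_distrib_left)
  show ?thesis
  proof (rule clinearI)
    fix X Y c
    have "t \<in> {t. actT (X + Y) t = actT X t + actT Y t}"
      by (rule tensor_laurent_mem)
        (simp_all add: gen cv.subspace_def clinear_0[OF actT_lin2] clinear_add[OF actT_lin2]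
          clinear_scale[OF actT_lin2] scaleC_add_right)
    then show "actT (X + Y) t = actT X t + actT Y t" by simp
    have "t \<in> {t. actT (c *\<^sub>C X) t = c *\<^sub>C actT X t}"
      by (rule tensor_laurent_mem)
        (simp_all add: gen cv.subspace_def clinear_0[OF actT_lin2] clinear_add[OF actT_lin2]
          clinear_scale[OF actT_lin2] scaleC_add_right mult.commute)
    then show "actT (c *\<^sub>C X) t = c *\<^sub>C actT X t" by simp
  qed
qed

lemma actT_G_deg:
  assumes X: "X \<in> G_deg br form r"
  shows "actT X (u \<otimes> lmon s) = actW X u \<otimes> lmon (r + s)"
  unfolding actT_def
  by (rule rho_G_deg[OF _ _ _ br_bilinear form_bilinear X]) (fact actW_add actW_scale actW_lin2)+

lemma actT_d: "actT (gt_d (Some i)) (u \<otimes> lmon s) = (lam (tau_d (Some i)) + of_int (s $ i)) *\<^sub>C (u \<otimes> lmon s)"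
  unfolding actT_def
  by (rule rho_d) (fact actW_add actW_scale actW_lin2)+

lemma Gen_shift:
  assumes "X \<in> Gen j"
  obtains r where "\<And>s u. u \<in> V_deg s \<Longrightarrow> act X u \<in> V_deg (r + s)"
    and "\<And>w s. actT (phi X) (w \<otimes> lmon s) = actW (phi X) w \<otimes> lmon (r + s)"
proof -
  note gens = gtilde_bracket_generators[OF br_bilinear form_bilinear]
  have Y: "gt_Y y r b \<in> G_deg br form r" for y r and b :: 'b
    by (simp add: G_deg_def gens(3)) (simp add: G_sub_def gt_Y_def)
  have d: "(gt_d None :: ('g, 'n, 'b) gtilde) \<in> G_deg br form 0"
    by (simp add: G_deg_def gens(4)) (simp add: G_sub_def gt_d_def axis_def)
  from assms show thesis
  proof (cases rule: Gen_cases)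
    case (X x m k r b)
    have "phi X \<in> G_deg br form r" using Y by (simp add: X(1) phi_generators)
    then show thesis using V_deg_X actT_G_deg by (intro that[of r]) (simp_all add: X(1))
  next
    case (K r b)
    have "phi X \<in> G_deg br form r" using Y by (simp add: K(1) phi_generators)
    then show thesis using V_deg_K actT_G_deg by (intro that[of r]) (simp_all add: K(1))
  next
    case d': d
    have "phi X \<in> G_deg br form 0" using d by (simp add: d'(1) phi_generators)
    then show thesis using V_deg_d actT_G_deg[of "phi X" 0] by (intro that[of 0]) (simp_all add: d'(1))
  qed
qed

text \<open>For \<open>s = 0\<close> this is the embedding of \<open>V\<close> into the loop module; the others are its translates by
  \<open>t\<^sup>s\<close>.\<close>

definition emb :: "int ^ 'n \<Rightarrow> 'v \<Rightarrow> ('w, 'n laurent_n) tensor"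
  where "emb s = (SOME f. clinear f \<and> (\<forall>r. \<forall>u\<in>V_deg r. f u = \<pi> u \<otimes> lmon (r + s)))"

lemma emb_linear: "clinear (emb s)" and emb_V_deg: "u \<in> V_deg r \<Longrightarrow> emb s u = \<pi> u \<otimes> lmon (r + s)"
proof -
  have "\<exists>f. clinear f \<and> (\<forall>r. \<forall>u\<in>V_deg r. f u = \<pi> u \<otimes> lmon (r + s))"
    by (rule V_deg_extension) (intro clinear_tens1 \<pi>_linear)
  from someI_ex[OF this]
  show "clinear (emb s)" and "u \<in> V_deg r \<Longrightarrow> emb s u = \<pi> u \<otimes> lmon (r + s)"
    unfolding emb_def by blast+
qed

lemma emb_Gen:
  assumes X: "X \<in> Gen j"
  shows "emb s (act X u) = actT (phi X) (emb s u)"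
proof (rule V_deg_unique[OF clinear_compose[OF act_lin2 emb_linear] clinear_compose[OF emb_linear actT_lin2]])
  fix q u assume u: "u \<in> V_deg q"
  obtain r where r: "\<And>s u. u \<in> V_deg s \<Longrightarrow> act X u \<in> V_deg (r + s)"
    "\<And>w s. actT (phi X) (w \<otimes> lmon s) = actW (phi X) w \<otimes> lmon (r + s)"
    by (rule Gen_shift[OF X]) blast
  show "emb s (act X u) = actT (phi X) (emb s u)"
    by (simp only: emb_V_deg[OF r(1)[OF u]] emb_V_deg[OF u] r(2) actW_Gen[OF X] add.assoc)
qed

lemma emb_d: "actT (gt_d (Some i)) (emb s u) = emb s (act (tau_d (Some i)) u) + of_int (s $ i) *\<^sub>C emb s u"
proof (rule V_deg_unique[OF clinear_compose[OF emb_linear actT_lin2]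
      clinear_plus[OF clinear_compose[OF act_lin2 emb_linear] clinear_scaled[OF emb_linear]]])
  fix q u assume u: "u \<in> V_deg q"
  then have "act (tau_d (Some i)) u = (lam (tau_d (Some i)) + of_int (q $ i)) *\<^sub>C u"
    by (simp add: V_deg_def)
  then show "actT (gt_d (Some i)) (emb s u) = emb s (act (tau_d (Some i)) u) + of_int (s $ i) *\<^sub>C emb s u"
    by (simp add: clinear_scale[OF emb_linear] clinear_add[OF emb_linear] emb_V_deg[OF u] actT_d scaleC_add_left)
qed

lemma emb_v: "emb s v = \<pi> v \<otimes> lmon s"
  using emb_V_deg[OF v_in_V_deg] by simp

lemma range_emb_submodule: "submodule UNIV actT (range (emb s))"
proof -
  have sub: "cv.subspace (range (emb s))"
  proof (rule cv.subspaceI)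
    show "0 \<in> range (emb s)" using clinear_0[OF emb_linear] by (metis rangeI)
    show "x + y \<in> range (emb s)" if "x \<in> range (emb s)" "y \<in> range (emb s)" for x y
      using that by (auto simp: clinear_add[OF emb_linear, symmetric])
    show "c *\<^sub>C x \<in> range (emb s)" if "x \<in> range (emb s)" for c x
      using that by (auto simp: clinear_scale[OF emb_linear, symmetric])
  qed
  have "actT X (emb s u) \<in> range (emb s)" for X u
  proof (rule gtilde_closed[OF actT_lin1 sub])
    show "actT (phi X) (emb s u) \<in> range (emb s)" if "X \<in> Gen j" for j X
      by (simp add: emb_Gen[OF that, symmetric])
    show "actT (gt_d (Some i)) (emb s u) \<in> range (emb s)" for i
      by (simp only: emb_d clinear_scale[OF emb_linear, symmetric] clinear_add[OF emb_linear, symmetric] rangeI)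
  qed
  then show ?thesis using sub unfolding submodule_def by blast
qed

text \<open>By \<open>emb_Gen\<close> and \<open>emb_d\<close> the preimage of \<open>S\<close> is a submodule of the irreducible module \<open>V\<close>, even
  though \<open>emb s\<close> commutes with the \<open>d\<^sub>i\<close> only up to scalars.\<close>

lemma range_emb_irreducible:
  assumes S: "submodule UNIV actT S" and u: "emb s u \<in> S" "u \<noteq> 0"
  shows "range (emb s) \<subseteq> S"
proof -
  have sub: "cv.subspace S" and closed: "\<And>X t. t \<in> S \<Longrightarrow> actT X t \<in> S"
    using S by (auto simp: submodule_def)
  have "{u. emb s u \<in> S} = UNIV"
  proof (rule submodule_eq_UNIV[OF subspace_vimage[OF emb_linear sub], where u = u])
    show "act X w \<in> {u. emb s u \<in> S}" if "X \<in> Gen j" "w \<in> {u. emb s u \<in> S}" for j X w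
      using that(2) closed by (simp add: emb_Gen[OF that(1)])
    show "act (tau_d (Some i)) w \<in> {u. emb s u \<in> S}" if w: "w \<in> {u. emb s u \<in> S}" for i w
    proof -
      have "actT (gt_d (Some i)) (emb s w) - of_int (s $ i) *\<^sub>C emb s w \<in> S"
        using w closed by (intro cv.subspace_diff[OF sub] cv.subspace_scale[OF sub]) auto
      then show ?thesis by (simp add: emb_d)
    qed
  qed (use u in auto)
  then show ?thesis by blast
qed

lemma U_orbit_eq_range_emb: "U_orbit actT (\<pi> v \<otimes> lmon s) = range (emb s)"
proof
  show "U_orbit actT (\<pi> v \<otimes> lmon s) \<subseteq> range (emb s)"
    by (rule U_orbit_minimal[OF range_emb_submodule]) (metis emb_v rangeI)
  show "range (emb s) \<subseteq> U_orbit actT (\<pi> v \<otimes> lmon s)"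
  proof (rule range_emb_irreducible[OF U_orbit_submodule(1)[OF actT_lin2] _ v_nz])
    show "emb s v \<in> U_orbit actT (\<pi> v \<otimes> lmon s)"
      unfolding emb_v by (rule U_orbit_submodule(2)[OF actT_lin2])
  qed
qed

lemma emb_hom: "emb 0 (actG X u) = actT X (emb 0 u)"
proof -
  have "emb 0 (actG X u) - actT X (emb 0 u) \<in> {0}"
  proof (rule gtilde_closed[of "\<lambda>X u. emb 0 (actG X u) - actT X (emb 0 u)", OF _ cv.subspace_single_0])
    show "clinear (\<lambda>X. emb 0 (actG X u) - actT X (emb 0 u))"
      by (intro clinear_minus clinear_compose[OF actG_lin1 emb_linear] actT_lin1)
    show "emb 0 (actG (phi X) u) - actT (phi X) (emb 0 u) \<in> {0}" if "X \<in> Gen j" for j X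
      by (simp add: actG_phi emb_Gen[OF that])
    show "emb 0 (actG (gt_d (Some i)) u) - actT (gt_d (Some i)) (emb 0 u) \<in> {0}" for i
      using actG_phi[of "tau_d (Some i)"] by (simp add: phi_generators emb_d)
  qed
  then show ?thesis by simp
qed

lemma emb_inj: "inj (emb 0)"
proof (rule injI)
  fix u u' assume eq: "emb 0 u = emb 0 u'"
  have zero: "submodule UNIV actT {0}"
    by (simp add: submodule_def clinear_0[OF actT_lin2] cv.subspace_single_0)
  show "u = u'"
  proof (rule ccontr)
    assume "u \<noteq> u'"
    then have "range (emb 0) \<subseteq> {0}"
      using eq by (intro range_emb_irreducible[OF zero, of 0 "u - u'"]) (simp_all add: clinear_diff[OF emb_linear])
    then have "emb 0 v = 0" by blast
    then show False using tens_lmon_nonzero[OF \<pi>_v_nz, of "0 :: int ^ 'n"] by (simp add: emb_v)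
  qed
qed

text \<open>Homogeneous generators satisfy \<open>X u \<otimes> t\<^sup>s = X (u \<otimes> t\<^bsup>s-r\<^esup>)\<close>, so the vectors \<open>u\<close> all of whose
  translates \<open>\<pi> u \<otimes> t\<^sup>s\<close> lie in the span form a \<open>G\<close>-submodule containing \<open>v\<close>.\<close>

lemma orbits_span: "cv.span (\<Union>s. range (emb s)) = UNIV"
proof -
  let ?S = "cv.span (\<Union>s. range (emb s))"
  have closed: "actT X t \<in> ?S" if "t \<in> ?S" for X t
    using submodule_span_Union[of actT UNIV UNIV "\<lambda>s. range (emb s)", OF actT_lin2 range_emb_submodule] that
    unfolding submodule_def by blast
  have "{u. \<forall>s. \<pi> u \<otimes> lmon s \<in> ?S} = UNIV"
  proof (rule generated_by_v)
    have "cv.subspace {u. \<pi> u \<otimes> lmon s \<in> ?S}" for s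
      by (rule subspace_vimage[OF clinear_tens1[OF \<pi>_linear] cv.subspace_span])
    then show "cv.subspace {u. \<forall>s. \<pi> u \<otimes> lmon s \<in> ?S}" by (simp add: cv.subspace_def)
    show "act X u \<in> {u. \<forall>s. \<pi> u \<otimes> lmon s \<in> ?S}" if X: "X \<in> Gen j" and u: "u \<in> {u. \<forall>s. \<pi> u \<otimes> lmon s \<in> ?S}" for j X u
    proof -
      obtain r where r: "\<And>w s. actT (phi X) (w \<otimes> lmon s) = actW (phi X) w \<otimes> lmon (r + s)"
        by (rule Gen_shift[OF X]) blast
      have "\<pi> (act X u) \<otimes> lmon s = actT (phi X) (\<pi> u \<otimes> lmon (s - r))" for s
        by (simp add: r actW_Gen[OF X])
      then show ?thesis using u closed by simp
    qed
    have "emb s v \<in> ?S" for s by (intro cv.span_base) blast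
    then show "v \<in> {u. \<forall>s. \<pi> u \<otimes> lmon s \<in> ?S}" by (simp add: emb_v)
  qed
  then have "\<pi> u \<otimes> lmon s \<in> ?S" for u s by blast
  then have "w \<otimes> lmon s \<in> ?S" for w s by (rule W_induct)
  then have "t \<in> ?S" for t by (rule tensor_laurent_mem[OF cv.subspace_span])
  then show ?thesis by blast
qed

section \<open>Periodicity of the orbits\<close>

text \<open>Since \<open>z\<close> has degree \<open>q\<close> and acts on the quotient by the scalar \<open>c\<close>, composing \<open>emb s\<close> with the
  surjection \<open>z\<close> gives \<open>c\<close> times \<open>emb (s + q)\<close>.\<close>

lemma range_emb_shift:
  assumes z: "central_operator act (0, q) z" and nz: "z \<noteq> (\<lambda>_. 0)"
  shows "range (emb (s + q)) = range (emb s)"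
proof -
  obtain c where c: "c \<noteq> 0" "\<And>u. \<pi> (z u) = c *\<^sub>C \<pi> u"
    by (rule central_operator_scalar[OF z nz]) blast
  note lin = central_operatorD(1)[OF z]
  have eq: "emb s (z u) = c *\<^sub>C emb (s + q) u" for u
  proof (rule V_deg_unique[OF clinear_compose[OF lin emb_linear] clinear_scaled[OF emb_linear]])
    fix r u assume u: "u \<in> V_deg r"
    show "emb s (z u) = c *\<^sub>C emb (s + q) u"
      by (simp add: emb_V_deg[OF central_V_deg[OF z u]] emb_V_deg[OF u] c(2) clinear_scale[OF tens_linear_left]
          ac_simps)
  qed
  have "emb (s + q) u = emb s ((1 / c) *\<^sub>C z u)" for u
    using c(1) by (simp add: clinear_scale[OF emb_linear] eq scaleC_one)
  moreover have "\<exists>u'. emb s u = emb (s + q) u'" for u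
  proof -
    obtain u' where "u = z u'" using surjD[OF central_surj[OF z nz]] by blast
    then have "emb s u = emb (s + q) (c *\<^sub>C u')" by (simp add: eq clinear_scale[OF emb_linear])
    then show ?thesis by blast
  qed
  ultimately show ?thesis by (auto, metis rangeI)
qed

text \<open>Negative multiples are reduced to positive ones by starting from the shifted exponent.\<close>

lemma range_emb_periodic:
  assumes z: "central_operator act (0, axis i l) z" and nz: "z \<noteq> (\<lambda>_. 0)"
  shows "range (emb (s + axis i (l * k))) = range (emb s)"
proof -
  have axis_add: "axis i (a + b) = axis i a + (axis i b :: int ^ 'n)" for a b :: int
    by (simp add: vec_eq_iff axis_def)
  have nat: "range (emb (s + axis i (l * int m))) = range (emb s)" for s m
  proof (induction m)
    case 0
    have "axis i 0 = (0 :: int ^ 'n)" by (simp add: vec_eq_iff axis_def)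
    then show ?case by (simp only: of_nat_0 mult_zero_right add_0_right)
  next
    case (Suc m)
    have "s + axis i (l * int (Suc m)) = (s + axis i (l * int m)) + axis i l"
      by (simp add: distrib_left axis_add add.commute add.left_commute)
    then show ?case by (simp only: range_emb_shift[OF z nz] Suc)
  qed
  show ?thesis
  proof (cases "k \<ge> 0")
    case True
    then show ?thesis using nat[of s "nat k"] by simp
  next
    case False
    have eq: "(s + axis i (l * k)) + axis i (l * int (nat (- k))) = s"
      using False by (simp add: vec_eq_iff axis_def)
    show ?thesis using nat[of "s + axis i (l * k)" "nat (- k)"] unfolding eq by (rule sym)
  qed
qed

text \<open>Every exponent can be reduced modulo the \<open>l\<^sub>i\<close> into the finite box without changing the orbit.\<close>

theorem orbits_direct_sum:
  assumes l: "\<And>i. l i > 0" and z: "\<And>i. central_operator act (0, axis i (int (l i))) (z i)"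
    and nz: "\<And>i. z i \<noteq> (\<lambda>_. 0)"
  shows "\<exists>F \<subseteq> {s :: int ^ 'n. \<forall>i. 0 \<le> s $ i \<and> s $ i < int (l i)}. direct_sum F (\<lambda>s. range (emb s)) UNIV"
proof -
  let ?B = "{s :: int ^ 'n. \<forall>i. 0 \<le> s $ i \<and> s $ i < int (l i)}"
  have "?B \<subseteq> vec_lambda ` (\<Pi>\<^sub>E i\<in>UNIV. {0..<int (l i)})"
  proof
    fix s assume "s \<in> ?B"
    then have "vec_nth s \<in> (\<Pi>\<^sub>E i\<in>UNIV. {0..<int (l i)})" by auto
    then show "s \<in> vec_lambda ` (\<Pi>\<^sub>E i\<in>UNIV. {0..<int (l i)})"
      by (intro image_eqI[of _ _ "vec_nth s"]) (simp_all add: vec_nth_inverse)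
  qed
  then have "finite ?B"
    by (rule finite_subset) (intro finite_imageI finite_PiE, simp_all)
  have multi: "range (emb (s + (\<Sum>i\<in>A. axis i (int (l i) * k i)))) = range (emb s)" if "finite A" for s k A
    using that
  proof (induction A rule: finite_induct)
    case (insert i A)
    have "s + (\<Sum>j\<in>insert i A. axis j (int (l j) * k j))
        = (s + (\<Sum>j\<in>A. axis j (int (l j) * k j))) + axis i (int (l i) * k i)"
      using insert.hyps by (simp add: add.commute add.left_commute)
    then show ?case by (simp only: range_emb_periodic[OF z nz] insert.IH)
  qed simp
  have reduce: "\<exists>s'\<in>?B. range (emb s) = range (emb s')" for s
  proof
    let ?s = "\<chi> i. s $ i mod int (l i)"
    let ?d = "\<Sum>i\<in>UNIV. axis i (int (l i) * (s $ i div int (l i))) :: int ^ 'n"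
    have "?d $ j = int (l j) * (s $ j div int (l j))" for j
    proof -
      have "?d $ j = (\<Sum>i\<in>UNIV. if i = j then int (l j) * (s $ j div int (l j)) else 0)"
        unfolding sum_component by (rule sum.cong) (auto simp: axis_def)
      then show ?thesis by simp
    qed
    then have "s = ?s + ?d" by (simp add: vec_eq_iff)
    from arg_cong[OF this, of "\<lambda>s. range (emb s)"] multi[OF finite, of ?s]
    show "range (emb s) = range (emb ?s)" by (rule trans)
    show "?s \<in> ?B" using l by simp
  qed
  have "\<exists>F\<subseteq>?B. direct_sum F (\<lambda>s. range (emb s)) (cv.span (\<Union>s\<in>?B. range (emb s)))"
  proof (rule finite_sum_of_irreducibles_direct[where A = actT and L = UNIV and M = "\<lambda>s. range (emb s)"])
    show "finite ?B" by fact
    show "clinear (actT X)" for X by (rule actT_lin2)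
    show "submodule UNIV actT (range (emb s))" for s by (rule range_emb_submodule)
    show "range (emb s) \<inter> S \<subseteq> {0} \<or> range (emb s) \<subseteq> S" if S: "submodule UNIV actT S" for s S
    proof (cases "\<exists>u. emb s u \<in> S \<and> u \<noteq> 0")
      case True
      then show ?thesis using range_emb_irreducible[OF S] by blast
    next
      case False
      then show ?thesis using clinear_0[OF emb_linear] by auto
    qed
  qed
  moreover have "(\<Union>s\<in>?B. range (emb s)) = (\<Union>s. range (emb s))" using reduce by blast
  ultimately show ?thesis by (simp only: orbits_span)
qed

end

theorem proposition5p1:
  fixes br :: "'g::cvs \<Rightarrow> 'g \<Rightarrow> 'g"
    and form :: "'g \<Rightarrow> 'g \<Rightarrow> complex"
    and h :: "'g set"
    and \<Theta> :: "('g \<Rightarrow> complex) set"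
    and act :: "('g, 'n::finite, 'b::comm_calg) tau \<Rightarrow> 'v::cvs \<Rightarrow> 'v"
    and actG :: "('g, 'n, 'b) gtilde \<Rightarrow> 'v \<Rightarrow> 'v"
    and l :: "'n \<Rightarrow> nat"
    and z :: "'n \<Rightarrow> 'v \<Rightarrow> 'v"
    and W :: "'v set"
    and \<pi> :: "'v \<Rightarrow> 'w::cvs"
    and actW :: "('g, 'n, 'b) gtilde \<Rightarrow> 'w \<Rightarrow> 'w"
    and lam :: "('g, 'n, 'b) tau \<Rightarrow> complex"
    and v :: 'v
    and actT :: "('g, 'n, 'b) gtilde \<Rightarrow> ('w, 'n laurent_n) tensor \<Rightarrow> ('w, 'n laurent_n) tensor"
  assumes "simple_lie br" and "fin_dim (UNIV :: 'g set)"
    and "cartan_subalgebra br h" and "root_base br h \<Theta>"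
    and "invariant_form br form" and "normalized_form br h form"
    and "finitely_generated_alg TYPE('b)"
    and "lie_module (tau_bracket br form) act"
    and "irreducible_module act"
    and "integrable_module br h act"
    and "\<And>\<mu>. \<mu> \<in> dual_space (tau_H h) \<Longrightarrow> fin_dim (weight_space act (tau_H h) \<mu>)"
    and "\<exists>c::nat. c > 0 \<and> (\<forall>u. act (tau_K 0 None 1) u = of_nat c *\<^sub>C u)"
    and "\<And>i u. act (tau_K 0 (Some i) 1) u = 0"
    and "\<And>X u. phi X = 0 \<Longrightarrow> act X u = 0"
    and actG: "actG = induced_act phi act"
    and "\<And>i. l i > 0"
    and "\<And>i. central_operator act (0, axis i (int (l i))) (z i)"
    and "\<And>i. z i \<noteq> (\<lambda>_. 0)"
    and "maximal_proper_submodule G_sub actG W"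
    and "quotient_map W \<pi>"
    and actW: "actW = quotient_act \<pi> actG"
    and "\<And>\<mu>. \<mu> \<in> dual_space (gt_H0 h) \<Longrightarrow> fin_dim (weight_space actW (gt_H0 h) \<mu>)"
    and "lam \<in> dual_space (tau_H h)" and "v \<in> weight_space act (tau_H h) lam" and "v \<noteq> 0"
    and "\<And>X. X \<in> tau_plus (g_plus br h \<Theta>) \<Longrightarrow> act X v = 0"
    and actT: "actT = rho actW (\<lambda>i. lam (tau_d (Some i)))"
  shows "(UNIV :: ('w, 'n laurent_n) tensor set) = cv.span (\<Union>s. U_orbit actT (\<pi> v \<otimes> lmon s)) \<and>
    (\<exists>F \<subseteq> {s :: int ^ 'n. \<forall>i. 0 \<le> s $ i \<and> s $ i < int (l i)}.
      direct_sum F (\<lambda>s. U_orbit actT (\<pi> v \<otimes> lmon s)) UNIV) \<and>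
    (\<exists>f. clinear f \<and> bij_betw f UNIV (U_orbit actT (\<pi> v \<otimes> 1)) \<and>
      (\<forall>X u. f (actG X u) = actT X (f u)))"
proof -
  interpret integrable_tau_module br form h \<Theta> act
  proof (rule integrable_tau_module.intro)
    show "(UNIV :: 'v set) \<noteq> {0}" using \<open>v \<noteq> 0\<close> by blast
  qed (fact assms)+
  obtain \<rho> and N :: int where rho: "\<rho> \<in> h" "ad_eigenspace br \<rho> 0 \<subseteq> h"
    "cv.span (\<Union>m. ad_eigenspace br \<rho> m) = UNIV"
    "\<And>m. m > 0 \<Longrightarrow> ad_eigenspace br \<rho> m \<subseteq> g_plus br h \<Theta>"
    "\<And>m x. x \<in> ad_eigenspace br \<rho> m \<Longrightarrow> x \<noteq> 0 \<Longrightarrow> \<bar>m\<bar> < N"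
    using principal_element by blast
  interpret graded_tau_module br form h \<Theta> act \<rho> N actG lam v
    by (intro graded_tau_module.intro graded_tau_module_axioms.intro integrable_tau_module_axioms)
      (fact rho assms)+
  interpret highest_weight_quotient br form h \<Theta> act \<rho> N actG lam v W \<pi> actW
    by (intro highest_weight_quotient.intro highest_weight_quotient_axioms.intro graded_tau_module_axioms)
      (fact assms)+
  interpret loop_module br form h \<Theta> act \<rho> N actG lam v W \<pi> actW actT
    by (intro loop_module.intro loop_module_axioms.intro highest_weight_quotient_axioms) (fact assms)
  have orbit: "U_orbit actT (\<pi> v \<otimes> 1) = range (emb 0)"
    using U_orbit_eq_range_emb[of 0] by (simp only: single_one)
  have "bij_betw (emb 0) UNIV (U_orbit actT (\<pi> v \<otimes> 1))"
    unfolding orbit bij_betw_def using emb_inj by simp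
  then have "\<exists>f. clinear f \<and> bij_betw f UNIV (U_orbit actT (\<pi> v \<otimes> 1)) \<and>
      (\<forall>X u. f (actG X u) = actT X (f u))"
    by (intro exI[of _ "emb 0"] conjI allI emb_linear emb_hom)
  moreover have "\<exists>F \<subseteq> {s :: int ^ 'n. \<forall>i. 0 \<le> s $ i \<and> s $ i < int (l i)}.
      direct_sum F (\<lambda>s. U_orbit actT (\<pi> v \<otimes> lmon s)) UNIV"
    unfolding U_orbit_eq_range_emb by (rule orbits_direct_sum[of l z]) (fact assms)+
  moreover have "UNIV = cv.span (\<Union>s. U_orbit actT (\<pi> v \<otimes> lmon s))"
    by (simp only: U_orbit_eq_range_emb orbits_span)
  ultimately show ?thesis by (intro conjI)
qed

end
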